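(* Fix $h\ge0$, $D\in\mathbb R$. There exists $\beta'>0$ such that for every $\beta\in(0,\beta')$: for any integer $n$ and nonnegative integers $h(k,l)$ ($1\le k<l\le n$), $h(k),h'(k)$ ($k\in[n]$), $h,h'$, with $H$ their total sum, $$\nu\Big(\prod_{k<l}T_{k,l}^{h(k,l)}\prod_kT_k^{h(k)}T^h\prod_kS_k^{h'(k)}S^{h'}\Big)=\prod_{k<l}a(h(k,l))\,(A_2^2)^{h(k,l)/2}\;\nu\Big(\prod_kT_k^{h(k)}T^h\prod_kS_k^{h'(k)}S^{h'}\Big)+O(N^{-(H+1)/2}),$$ where $a(x)=\mathbb E[g^x]$ for $g\sim N(0,1)$ and the implied constant is independent of $N$.
   Context: Fix an integer $\mathcal S\ge1$ and $N\ge2$; $\Sigma_N=\{0,\pm1,\dots,\pm\mathcal S\}^N$. For $\beta>0$, $h\ge0$, $D\in\mathbb R$ and i.i.d. standard Gaussians $(g_{i,j})_{i<j}$, $H_N(\sigma)=\frac{\beta}{\sqrt N}\sum_{i<j}g_{i,j}\sigma_i\sigma_j+D\sum_i\sigma_i^2+h\sum_i\sigma_i$, Gibbs measure $G(\sigma)\propto e^{H_N(\sigma)}$ on $\Sigma_N$. Replicas are i.i.d. samples from $G$ given the disorder; $\langle\cdot\rangle$ is the product Gibbs average, $\nu(f)=\mathbb E\langle f\rangle$. $p,q$: for $\eta\sim N(0,1)$, $\langle\phi\rangle_\eta=\sum_s\phi(s)w_\eta(s)/\sum_sw_\eta(s)$, $w_\eta(s)=\exp(\beta\sqrt q\eta s+hs+(D+\frac{\beta^2}{2}(p-q))s^2)$,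 $s\in\{0,\pm1,\dots,\pm\mathcal S\}$; $(p,q)$ solves $q=\mathbb E\langle s\rangle_\eta^2$, $p=\mathbb E\langle s^2\rangle_\eta$ (unique at high temperature). Basis: $b_i=\langle\sigma_i\rangle$, $\tilde b_i=\langle\sigma_i^2\rangle$; $T_{k,l}=\frac1N\sum_i(\sigma_i^k-b_i)(\sigma_i^l-b_i)$ ($k\ne l$), $T_k=\frac1N\sum_i(\sigma^k_i-b_i)b_i$, $T=\frac1N\sum_ib_i^2-q$, $S_k=\frac1N\sum_i((\sigma_i^k)^2-\tilde b_i)$, $S=\frac1N\sum_i\tilde b_i-p$. Constant: with $m_j=\langle s^j\rangle_\eta$, $A=\mathbb E[(m_2-m_1^2)^2]$ and $A_2^2=\frac{A}{N(1-\beta^2A)}$. *)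

theory Defs
  imports "HOL-Probability.Probability"
begin

definition spins :: "nat \<Rightarrow> int set" where
  "spins S = {- int S .. int S}"

definition configs :: "nat \<Rightarrow> nat \<Rightarrow> (nat \<Rightarrow> int) set" where
  "configs S N = PiE {1..N} (\<lambda>_. spins S)"

definition replica_configs :: "nat \<Rightarrow> nat \<Rightarrow> nat \<Rightarrow> (nat \<Rightarrow> nat \<Rightarrow> int) set" where
  "replica_configs S N n = PiE {1..n} (\<lambda>_. configs S N)"

definition std_normal_measure :: "real measure" where
  "std_normal_measure = density lborel std_normal_density"

definition disorder_measure :: "nat \<Rightarrow> (nat \<times> nat \<Rightarrow> real) measure" where
  "disorder_measure N = PiM {(i,j). 1 \<le> i \<and> i < j \<and> j \<le> N} (\<lambda>_. std_normal_measure)"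

definition hamiltonian ::
  "nat \<Rightarrow> real \<Rightarrow> real \<Rightarrow> real \<Rightarrow> (nat \<times> nat \<Rightarrow> real) \<Rightarrow> (nat \<Rightarrow> int) \<Rightarrow> real" where
  "hamiltonian N \<beta> D hf g \<sigma> =
     \<beta> / sqrt (real N) * (\<Sum>i\<in>{1..N}. \<Sum>j\<in>{i<..N}. g (i,j) * of_int (\<sigma> i) * of_int (\<sigma> j))
     + D * (\<Sum>i\<in>{1..N}. (of_int (\<sigma> i))^2) + hf * (\<Sum>i\<in>{1..N}. of_int (\<sigma> i))"

definition gibbs ::
  "nat \<Rightarrow> nat \<Rightarrow> real \<Rightarrow> real \<Rightarrow> real \<Rightarrow> (nat \<times> nat \<Rightarrow> real) \<Rightarrow> (nat \<Rightarrow> int) \<Rightarrow> real" where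
  "gibbs S N \<beta> D hf g \<sigma> =
     exp (hamiltonian N \<beta> D hf g \<sigma>) / (\<Sum>\<tau>\<in>configs S N. exp (hamiltonian N \<beta> D hf g \<tau>))"

definition gibbs_avg ::
  "nat \<Rightarrow> nat \<Rightarrow> real \<Rightarrow> real \<Rightarrow> real \<Rightarrow> nat \<Rightarrow> (nat \<times> nat \<Rightarrow> real)
     \<Rightarrow> ((nat \<Rightarrow> nat \<Rightarrow> int) \<Rightarrow> real) \<Rightarrow> real" where
  "gibbs_avg S N \<beta> D hf n g F =
     (\<Sum>\<tau>\<in>replica_configs S N n. F \<tau> * (\<Prod>k\<in>{1..n}. gibbs S N \<beta> D hf g (\<tau> k)))"

definition nu ::
  "nat \<Rightarrow> nat \<Rightarrow> real \<Rightarrow> real \<Rightarrow> real \<Rightarrow> nat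
     \<Rightarrow> ((nat \<times> nat \<Rightarrow> real) \<Rightarrow> (nat \<Rightarrow> nat \<Rightarrow> int) \<Rightarrow> real) \<Rightarrow> real" where
  "nu S N \<beta> D hf n F = integral\<^sup>L (disorder_measure N) (\<lambda>g. gibbs_avg S N \<beta> D hf n g (F g))"

definition bmag :: "nat \<Rightarrow> nat \<Rightarrow> real \<Rightarrow> real \<Rightarrow> real \<Rightarrow> (nat \<times> nat \<Rightarrow> real) \<Rightarrow> nat \<Rightarrow> real" where
  "bmag S N \<beta> D hf g i = (\<Sum>\<sigma>\<in>configs S N. of_int (\<sigma> i) * gibbs S N \<beta> D hf g \<sigma>)"

definition bsq :: "nat \<Rightarrow> nat \<Rightarrow> real \<Rightarrow> real \<Rightarrow> real \<Rightarrow> (nat \<times> nat \<Rightarrow> real) \<Rightarrow> nat \<Rightarrow> real" where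
  "bsq S N \<beta> D hf g i = (\<Sum>\<sigma>\<in>configs S N. (of_int (\<sigma> i))^2 * gibbs S N \<beta> D hf g \<sigma>)"

definition T_kl ::
  "nat \<Rightarrow> nat \<Rightarrow> real \<Rightarrow> real \<Rightarrow> real \<Rightarrow> (nat \<times> nat \<Rightarrow> real) \<Rightarrow> (nat \<Rightarrow> nat \<Rightarrow> int) \<Rightarrow> nat \<Rightarrow> nat \<Rightarrow> real" where
  "T_kl S N \<beta> D hf g \<tau> k l = (1 / real N) * (\<Sum>i\<in>{1..N}.
      (of_int (\<tau> k i) - bmag S N \<beta> D hf g i) * (of_int (\<tau> l i) - bmag S N \<beta> D hf g i))"

definition T_k ::
  "nat \<Rightarrow> nat \<Rightarrow> real \<Rightarrow> real \<Rightarrow> real \<Rightarrow> (nat \<times> nat \<Rightarrow> real) \<Rightarrow> (nat \<Rightarrow> nat \<Rightarrow> int) \<Rightarrow> nat \<Rightarrow> real" where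
  "T_k S N \<beta> D hf g \<tau> k = (1 / real N) * (\<Sum>i\<in>{1..N}.
      (of_int (\<tau> k i) - bmag S N \<beta> D hf g i) * bmag S N \<beta> D hf g i)"

definition T_glob ::
  "nat \<Rightarrow> nat \<Rightarrow> real \<Rightarrow> real \<Rightarrow> real \<Rightarrow> real \<Rightarrow> (nat \<times> nat \<Rightarrow> real) \<Rightarrow> real" where
  "T_glob S N \<beta> D hf q g = (1 / real N) * (\<Sum>i\<in>{1..N}. (bmag S N \<beta> D hf g i)^2) - q"

definition S_k ::
  "nat \<Rightarrow> nat \<Rightarrow> real \<Rightarrow> real \<Rightarrow> real \<Rightarrow> (nat \<times> nat \<Rightarrow> real) \<Rightarrow> (nat \<Rightarrow> nat \<Rightarrow> int) \<Rightarrow> nat \<Rightarrow> real" where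
  "S_k S N \<beta> D hf g \<tau> k = (1 / real N) * (\<Sum>i\<in>{1..N}.
      ((of_int (\<tau> k i))^2 - bsq S N \<beta> D hf g i))"

definition S_glob ::
  "nat \<Rightarrow> nat \<Rightarrow> real \<Rightarrow> real \<Rightarrow> real \<Rightarrow> real \<Rightarrow> (nat \<times> nat \<Rightarrow> real) \<Rightarrow> real" where
  "S_glob S N \<beta> D hf p g = (1 / real N) * (\<Sum>i\<in>{1..N}. bsq S N \<beta> D hf g i) - p"

definition wgt :: "real \<Rightarrow> real \<Rightarrow> real \<Rightarrow> real \<Rightarrow> real \<Rightarrow> real \<Rightarrow> real \<Rightarrow> real" where
  "wgt \<beta> D hf p q \<eta> s =
     exp (\<beta> * sqrt q * \<eta> * s + hf * s + (D + \<beta>^2 / 2 * (p - q)) * s^2)"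

definition eta_avg ::
  "nat \<Rightarrow> real \<Rightarrow> real \<Rightarrow> real \<Rightarrow> real \<Rightarrow> real \<Rightarrow> real \<Rightarrow> (real \<Rightarrow> real) \<Rightarrow> real" where
  "eta_avg S \<beta> D hf p q \<eta> \<phi> =
     (\<Sum>s\<in>spins S. \<phi> (of_int s) * wgt \<beta> D hf p q \<eta> (of_int s))
       / (\<Sum>s\<in>spins S. wgt \<beta> D hf p q \<eta> (of_int s))"

definition is_pq :: "nat \<Rightarrow> real \<Rightarrow> real \<Rightarrow> real \<Rightarrow> real \<Rightarrow> real \<Rightarrow> bool" where
  "is_pq S \<beta> D hf p q \<longleftrightarrow>
     q = integral\<^sup>L std_normal_measure (\<lambda>\<eta>. (eta_avg S \<beta> D hf p q \<eta> (\<lambda>s. s))^2) \<and>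
     p = integral\<^sup>L std_normal_measure (\<lambda>\<eta>. eta_avg S \<beta> D hf p q \<eta> (\<lambda>s. s^2))"

definition A_const :: "nat \<Rightarrow> real \<Rightarrow> real \<Rightarrow> real \<Rightarrow> real \<Rightarrow> real \<Rightarrow> real" where
  "A_const S \<beta> D hf p q = integral\<^sup>L std_normal_measure (\<lambda>\<eta>.
     (eta_avg S \<beta> D hf p q \<eta> (\<lambda>s. s^2) - (eta_avg S \<beta> D hf p q \<eta> (\<lambda>s. s))^2)^2)"

definition A2sq :: "nat \<Rightarrow> nat \<Rightarrow> real \<Rightarrow> real \<Rightarrow> real \<Rightarrow> real \<Rightarrow> real \<Rightarrow> real" where
  "A2sq S N \<beta> D hf p q =
     A_const S \<beta> D hf p q / (real N * (1 - \<beta>^2 * A_const S \<beta> D hf p q))"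

definition gauss_moment :: "nat \<Rightarrow> real" where
  "gauss_moment x = integral\<^sup>L std_normal_measure (\<lambda>t. t ^ x)"

end

theory Submission
  imports Defs
begin

text \<open>Every \<open>b_i\<close> is the Gibbs average of the spin of a fresh replica, so each moment becomes an average of a
  product of centred overlaps. Fix a site \<open>m\<close> and interpolate between the model and the one in which
  \<open>m\<close> is decoupled and feels a Gaussian field instead; by Gaussian integration by parts the derivative
  of an average along this path is of relative size \<open>\<beta>\<^sup>2 / \<surd>N\<close> and inserts a centred overlap.
  To first order, and since the decoupled centred spin products have mean zero by the equations for \<open>p\<close> and \<open>q\<close>,
  the moments of \<open>\<surd>N\<close> times the overlaps satisfy a contraction for small \<open>\<beta>\<close>, hence are bounded.
  To second order, with one factor \<open>T_{k,l}\<close> written as a sum over the sites \<open>m\<close>, the symmetry under exchanging \<open>k\<close>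
  (or \<open>l\<close>) with its fresh copy kills all terms except two: the drift reproduces the product with weight \<open>\<beta>\<^sup>2 A\<close>,
  and the contraction with another factor \<open>T_{k,l}\<close> removes both with weight \<open>A / N\<close>. This is the recursion
  \<open>a(x) = (x - 1) a(x - 2)\<close> of the Gaussian moments with variance \<open>A / (N (1 - \<beta>\<^sup>2 A))\<close>.\<close>

section \<open>Replica averages\<close>

text \<open>The bound on \<open>\<beta>\<close> is fixed before the exponents are known, so the
  contraction must not degrade with the order of the moments. A Gronwall comparison moves overlap
  moments from any point of the path to its end; it is always applied with two replicas, so its loss
  is the fixed factor \<open>exp (96 * real S ^ 4)\<close>. Passing between overlaps with and
  without site \<open>m\<close> costs a factor 2 on the leading term, whatever the exponent.
  Everything that does depend on the order goes into additive constants.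

  The path is parametrised by an angle because \<open>sin\<close> and \<open>cos\<close> are smooth
  at both ends, where the square roots of \<open>t\<close> and \<open>1 - t\<close> are not. Since
  squared spins are not constant, self-overlaps have their own limit \<open>p\<close>, while the
  replacing field has covariance \<open>q\<close> for every replica pair; a quadratic term
  proportional to \<open>p - q\<close>, switched off along the path, centres the diagonal pairs.

  Exchangeability of the sites is never invoked: every site has its own path, and all these paths
  end in the same model.\<close>

definition avg :: "'c set \<Rightarrow> ('c \<Rightarrow> real) \<Rightarrow> nat \<Rightarrow> ((nat \<Rightarrow> 'c) \<Rightarrow> real) \<Rightarrow> real" where
  "avg C G n f = (\<Sum>\<tau>\<in>PiE {1..n} (\<lambda>_. C). f \<tau> * (\<Prod>k\<in>{1..n}. G (\<tau> k)))"

text \<open>Tuples in \<open>PiE\<close> are \<open>undefined\<close> outside \<open>{1..n}\<close>.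
  A function may be averaged over more replicas, or over relabelled ones, only if it never looks
  there.\<close>

definition dep :: "nat \<Rightarrow> ((nat \<Rightarrow> 'c) \<Rightarrow> 'd) \<Rightarrow> bool" where
  "dep n f \<longleftrightarrow> (\<forall>\<tau> \<tau>'. (\<forall>k\<in>{1..n}. \<tau> k = \<tau>' k) \<longrightarrow> f \<tau> = f \<tau>')"

lemma depD: "dep n f \<Longrightarrow> (\<And>k. k \<in> {1..n} \<Longrightarrow> \<tau> k = \<tau>' k) \<Longrightarrow> f \<tau> = f \<tau>'"
  unfolding dep_def by blast

lemma dep_mono: "dep n f \<Longrightarrow> n \<le> n' \<Longrightarrow> dep n' f"
  unfolding dep_def by (meson atLeastAtMost_iff le_trans)

lemma dep_const [intro]: "dep n (\<lambda>_. c)"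
  by (simp add: dep_def)

lemma dep_coord [intro]: "1 \<le> k \<Longrightarrow> k \<le> n \<Longrightarrow> dep n (\<lambda>\<tau>. h (\<tau> k))"
  by (simp add: dep_def)

lemma dep_comp [intro]: "dep n f \<Longrightarrow> dep n (\<lambda>\<tau>. h (f \<tau>))"
  unfolding dep_def by metis

lemma dep_binop: "dep n f \<Longrightarrow> dep n g \<Longrightarrow> dep n (\<lambda>\<tau>. h (f \<tau>) (g \<tau>))"
  unfolding dep_def by metis

lemmas dep_diff [intro] = dep_binop[of _ _ _ "(-)"]
lemmas dep_mult [intro] = dep_binop[of _ _ _ "(*)"]

lemma dep_sum [intro]: "(\<And>i. i \<in> I \<Longrightarrow> dep n (\<lambda>\<tau>. f i \<tau>)) \<Longrightarrow> dep n (\<lambda>\<tau>. \<Sum>i\<in>I. f i \<tau>)"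
  unfolding dep_def by (auto intro!: sum.cong)

lemma dep_prod [intro]: "(\<And>i. i \<in> I \<Longrightarrow> dep n (\<lambda>\<tau>. f i \<tau>)) \<Longrightarrow> dep n (\<lambda>\<tau>. \<Prod>i\<in>I. f i \<tau>)"
  unfolding dep_def by (auto intro!: prod.cong)

lemma dep_site [intro]: "dep n \<phi> \<Longrightarrow> dep n (\<lambda>\<tau>. \<phi> (\<lambda>k. \<tau> k i))"
  unfolding dep_def by metis

lemma avg_cong: "(\<And>\<tau>. \<tau> \<in> PiE {1..n} (\<lambda>_. C) \<Longrightarrow> f \<tau> = f' \<tau>) \<Longrightarrow> avg C G n f = avg C G n f'"
  by (simp add: avg_def)

lemma avg_add: "avg C G n (\<lambda>\<tau>. f \<tau> + g \<tau>) = avg C G n f + avg C G n g"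
  by (simp add: avg_def algebra_simps sum.distrib)

lemma avg_diff: "avg C G n (\<lambda>\<tau>. f \<tau> - g \<tau>) = avg C G n f - avg C G n g"
  by (simp add: avg_def algebra_simps sum_subtractf)

lemma avg_cmult: "avg C G n (\<lambda>\<tau>. c * f \<tau>) = c * avg C G n f"
  by (simp add: avg_def algebra_simps sum_distrib_left)

lemma avg_sum: "avg C G n (\<lambda>\<tau>. \<Sum>i\<in>I. f i \<tau>) = (\<Sum>i\<in>I. avg C G n (f i))"
  unfolding avg_def by (subst sum.swap) (simp add: sum_distrib_right)

lemma avg_prod_coords:
  assumes "finite C"
  shows "avg C G n (\<lambda>\<tau>. \<Prod>k\<in>{1..n}. h k (\<tau> k)) = (\<Prod>k\<in>{1..n}. \<Sum>x\<in>C. h k x * G x)"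
  using prod_sum_PiE[of "{1..n}" "\<lambda>_. C" "\<lambda>k x. h k x * G x"] assms
  by (simp add: avg_def prod.distrib)

lemma avg_mono:
  assumes "\<And>x. x \<in> C \<Longrightarrow> G x \<ge> 0" "\<And>\<tau>. \<tau> \<in> PiE {1..n} (\<lambda>_. C) \<Longrightarrow> f \<tau> \<le> f' \<tau>"
  shows "avg C G n f \<le> avg C G n f'"
  unfolding avg_def
  by (intro sum_mono mult_right_mono prod_nonneg ballI assms) (auto intro!: assms)

text \<open>Marginalisation: the replicas outside the image of \<open>\<pi>\<close> sum out to 1
  because \<open>G\<close> is normalised, and injectivity keeps the retained ones
  independent.\<close>

lemma avg_reindex:
  assumes C: "finite C" and G: "(\<Sum>x\<in>C. G x) = 1" and \<pi>: "inj_on \<pi> {1..n'}" "\<pi> ` {1..n'} \<subseteq> {1..n}"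
    and f: "dep n' f"
  shows "avg C G n (\<lambda>\<tau>. f (\<lambda>k. \<tau> (\<pi> k))) = avg C G n' f"
proof -
  define r where "r = (\<lambda>\<tau>::nat \<Rightarrow> 'a. \<lambda>k\<in>{1..n'}. \<tau> (\<pi> k))"
  define A where "A = PiE {1..n} (\<lambda>_. C)"
  define A' where "A' = PiE {1..n'} (\<lambda>_. C)"
  have fin: "finite A" "finite A'" unfolding A_def A'_def using C by (auto intro!: finite_PiE)
  have rA: "r ` A \<subseteq> A'"
    using \<pi>(2) unfolding A_def A'_def r_def by (auto simp: PiE_iff)
  have "(\<Sum>\<tau>\<in>{\<tau>\<in>A. r \<tau> = \<tau>0}. \<Prod>k\<in>{1..n}. G (\<tau> k)) = (\<Prod>k\<in>{1..n'}. G (\<tau>0 k))"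
    if \<tau>0: "\<tau>0 \<in> A'" for \<tau>0
  proof -
    \<comment> \<open>The fibre of the restriction map over \<open>\<tau>0\<close> is a box: a
      singleton at each coordinate in the image of \<open>\<pi>\<close>, all of \<open>C\<close>
      elsewhere. Its weight is therefore a product of one-coordinate sums.\<close>
    define B where "B = (\<lambda>j. if j \<in> \<pi> ` {1..n'} then {\<tau>0 (the_inv_into {1..n'} \<pi> j)} else C)"
    have "{\<tau>\<in>A. r \<tau> = \<tau>0} = PiE {1..n} B"
    proof (intro equalityI subsetI)
      fix \<tau> assume t: "\<tau> \<in> {\<tau>\<in>A. r \<tau> = \<tau>0}"
      then have "\<tau> (\<pi> k) = \<tau>0 k" if "k \<in> {1..n'}" for k
        using that t by (auto simp: r_def)
      then show "\<tau> \<in> PiE {1..n} B"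
        using t \<pi> by (auto simp: A_def PiE_iff B_def the_inv_into_f_f)
    next
      fix \<tau> assume t: "\<tau> \<in> PiE {1..n} B"
      have B: "\<tau> (\<pi> k) = \<tau>0 k" if "k \<in> {1..n'}" for k
      proof -
        have "\<pi> k \<in> {1..n}" using \<pi>(2) that by blast
        then have "\<tau> (\<pi> k) \<in> B (\<pi> k)" using t by (auto simp: PiE_iff)
        then show ?thesis using that \<pi>(1) by (simp add: B_def the_inv_into_f_f)
      qed
      have "r \<tau> = \<tau>0"
        using B \<tau>0 by (auto simp: r_def A'_def fun_eq_iff PiE_iff extensional_def)
      moreover have "\<tau> \<in> A"
        unfolding A_def
      proof (intro PiE_I)
        fix j assume j: "j \<in> {1..n}"
        show "\<tau> j \<in> C"
        proof (cases "j \<in> \<pi> ` {1..n'}")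
          case True
          then show ?thesis using B \<tau>0 by (auto simp: A'_def PiE_iff)
        next
          case False
          have "\<tau> j \<in> B j" using PiE_mem[OF t j] .
          then show ?thesis using False by (simp add: B_def)
        qed
      qed (use t in \<open>auto simp: PiE_iff extensional_def\<close>)
      ultimately show "\<tau> \<in> {\<tau>\<in>A. r \<tau> = \<tau>0}" by simp
    qed
    then have "(\<Sum>\<tau>\<in>{\<tau>\<in>A. r \<tau> = \<tau>0}. \<Prod>k\<in>{1..n}. G (\<tau> k)) = (\<Prod>j\<in>{1..n}. \<Sum>x\<in>B j. G x)"
      using prod_sum_PiE[of "{1..n}" B "\<lambda>_. G"] C by (simp add: B_def)
    also have "\<dots> = (\<Prod>j\<in>\<pi> ` {1..n'}. \<Sum>x\<in>B j. G x)"
      by (rule prod.mono_neutral_right) (use \<pi> G in \<open>auto simp: B_def\<close>)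
    also have "\<dots> = (\<Prod>k\<in>{1..n'}. \<Sum>x\<in>B (\<pi> k). G x)"
      by (rule prod.reindex_cong[OF \<pi>(1)]) auto
    also have "\<dots> = (\<Prod>k\<in>{1..n'}. G (\<tau>0 k))"
      by (rule prod.cong) (use \<pi>(1) in \<open>auto simp: B_def the_inv_into_f_f\<close>)
    finally show ?thesis .
  qed
  note inner = this
  have "avg C G n (\<lambda>\<tau>. f (\<lambda>k. \<tau> (\<pi> k))) = (\<Sum>\<tau>\<in>A. f (r \<tau>) * (\<Prod>k\<in>{1..n}. G (\<tau> k)))"
    unfolding avg_def A_def[symmetric]
    by (intro sum.cong refl arg_cong2[of _ _ _ _ "(*)"] depD[OF f]) (auto simp: r_def)
  also have "\<dots> = (\<Sum>\<tau>0\<in>A'. \<Sum>\<tau>\<in>{\<tau>\<in>A. r \<tau> = \<tau>0}. f (r \<tau>) * (\<Prod>k\<in>{1..n}. G (\<tau> k)))"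
    by (rule sum.group[OF fin rA, symmetric])
  also have "\<dots> = (\<Sum>\<tau>0\<in>A'. f \<tau>0 * (\<Sum>\<tau>\<in>{\<tau>\<in>A. r \<tau> = \<tau>0}. \<Prod>k\<in>{1..n}. G (\<tau> k)))"
    by (intro sum.cong refl) (simp add: sum_distrib_left)
  also have "\<dots> = avg C G n' f"
    unfolding avg_def A'_def[symmetric] using inner by (intro sum.cong refl) simp
  finally show ?thesis .
qed

lemma avg_more_replicas:
  assumes "finite C" "(\<Sum>x\<in>C. G x) = 1" "dep n f" "n \<le> n'"
  shows "avg C G n' f = avg C G n f"
  using avg_reindex[OF assms(1,2), of "\<lambda>k. k" n n' f] assms by simp

lemma avg_const:
  assumes "finite C" "(\<Sum>x\<in>C. G x) = 1"
  shows "avg C G n (\<lambda>_. c) = c"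
  using avg_more_replicas[OF assms, of 0 "\<lambda>_. c" n] by (simp add: dep_def avg_def)

lemma avg_Suc:
  assumes "finite C"
  shows "avg C G (Suc n) f = avg C G n (\<lambda>\<tau>. \<Sum>x\<in>C. f (\<tau>(Suc n := x)) * G x)"
proof -
  have ins: "{1..Suc n} = insert (Suc n) {1..n}" by auto
  have inj: "inj_on (\<lambda>(y, g). g(Suc n := y)) (C \<times> PiE {1..n} (\<lambda>_. C))"
  proof (rule inj_onI, clarify)
    fix y g y' g' assume *: "g \<in> PiE {1..n} (\<lambda>_. C)" "g' \<in> PiE {1..n} (\<lambda>_. C)"
      "g(Suc n := y) = (g'(Suc n := y') :: nat \<Rightarrow> 'a)"
    have "y = y'" using fun_cong[OF *(3), of "Suc n"] by simp
    moreover have "g k = g' k" for k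
      using fun_cong[OF *(3), of k] *(1,2) by (cases "k = Suc n") (auto simp: PiE_iff extensional_def)
    ultimately show "y = y' \<and> g = g'" by auto
  qed
  have "avg C G (Suc n) f = (\<Sum>(y, g)\<in>C \<times> PiE {1..n} (\<lambda>_. C).
      f (g(Suc n := y)) * (\<Prod>k\<in>{1..Suc n}. G ((g(Suc n := y)) k)))"
    unfolding avg_def ins PiE_insert_eq by (subst sum.reindex[OF inj]) (simp add: case_prod_beta o_def)
  also have "\<dots> = (\<Sum>(y, g)\<in>C \<times> PiE {1..n} (\<lambda>_. C).
      f (g(Suc n := y)) * G y * (\<Prod>k\<in>{1..n}. G (g k)))"
    unfolding ins by (intro sum.cong refl) (auto intro!: prod.cong)
  also have "\<dots> = (\<Sum>y\<in>C. \<Sum>g\<in>PiE {1..n} (\<lambda>_. C). f (g(Suc n := y)) * G y * (\<Prod>k\<in>{1..n}. G (g k)))"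
    by (simp add: sum.cartesian_product)
  also have "\<dots> = avg C G n (\<lambda>\<tau>. \<Sum>x\<in>C. f (\<tau>(Suc n := x)) * G x)"
    unfolding avg_def by (subst sum.swap) (simp add: sum_distrib_right)
  finally show ?thesis .
qed

section \<open>Boltzmann weights and their dependence on a parameter\<close>

definition boltzmann :: "'c set \<Rightarrow> ('c \<Rightarrow> real) \<Rightarrow> 'c \<Rightarrow> real" where
  "boltzmann C H x = exp (H x) / (\<Sum>y\<in>C. exp (H y))"

lemma boltzmann_pos: "finite C \<Longrightarrow> C \<noteq> {} \<Longrightarrow> 0 < boltzmann C H x"
  unfolding boltzmann_def by (intro divide_pos_pos sum_pos) auto

lemma boltzmann_nonneg: "0 \<le> boltzmann C H x"
  unfolding boltzmann_def by (intro divide_nonneg_nonneg sum_nonneg) auto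

lemma boltzmann_sum: "finite C \<Longrightarrow> C \<noteq> {} \<Longrightarrow> (\<Sum>x\<in>C. boltzmann C H x) = 1"
  unfolding boltzmann_def sum_divide_distrib[symmetric]
  by (rule divide_self) (use sum_pos[of C "\<lambda>y. exp (H y)"] in auto)

lemma boltzmann_has_deriv:
  assumes C: "finite C" "C \<noteq> {}" and "x \<in> C"
    and H: "\<And>y. y \<in> C \<Longrightarrow> ((\<lambda>t. H t y) has_real_derivative H' y) (at t)"
  shows "((\<lambda>t. boltzmann C (H t) x) has_real_derivative
    boltzmann C (H t) x * (H' x - (\<Sum>y\<in>C. boltzmann C (H t) y * H' y))) (at t)"
proof -
  define Z where "Z = (\<Sum>y\<in>C. exp (H t y))"
  have Z: "Z > 0" unfolding Z_def using C by (intro sum_pos) auto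
  have 1: "((\<lambda>t. exp (H t x) / (\<Sum>y\<in>C. exp (H t y))) has_real_derivative
      ((exp (H t x) * H' x) * Z - exp (H t x) * (\<Sum>y\<in>C. exp (H t y) * H' y)) / (Z * Z)) (at t)"
    unfolding Z_def
    by (rule DERIV_divide DERIV_sum DERIV_fun_exp H assms)+ (use Z Z_def in auto)
  have "((exp (H t x) * H' x) * Z - exp (H t x) * (\<Sum>y\<in>C. exp (H t y) * H' y)) / (Z * Z)
     = exp (H t x) / Z * (H' x - (\<Sum>y\<in>C. exp (H t y) * H' y) / Z)"
    using Z by (simp add: field_simps)
  also have "(\<Sum>y\<in>C. exp (H t y) * H' y) / Z = (\<Sum>y\<in>C. exp (H t y) / Z * H' y)"
    by (simp add: sum_divide_distrib)
  finally show ?thesis using 1 unfolding boltzmann_def Z_def by simp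
qed

text \<open>Differentiating the normalisation costs one additional replica.\<close>

definition replica_diff :: "('c \<Rightarrow> real) \<Rightarrow> nat \<Rightarrow> ((nat \<Rightarrow> 'c) \<Rightarrow> real) \<Rightarrow> (nat \<Rightarrow> 'c) \<Rightarrow> real" where
  "replica_diff u n f \<tau> = f \<tau> * ((\<Sum>k\<in>{1..n}. u (\<tau> k)) - real n * u (\<tau> (Suc n)))"

lemma dep_replica_diff [intro]: "dep n f \<Longrightarrow> dep (Suc n) (replica_diff u n f)"
  unfolding replica_diff_def[abs_def] by (intro dep_mult dep_diff dep_sum) (auto intro: dep_mono)

text \<open>The logarithmic derivative of the product weight is the sum of \<open>H'\<close> over
  the replicas minus \<open>n\<close> times its Gibbs mean. Reading the mean off replica
  \<open>n + 1\<close> makes the result an average of the same kind, so that differentiation can be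
  repeated.\<close>

lemma avg_boltzmann_has_deriv:
  assumes C: "finite C" "C \<noteq> {}" and f: "dep n f"
    and H: "\<And>y. y \<in> C \<Longrightarrow> ((\<lambda>t. H t y) has_real_derivative H' y) (at t)"
  shows "((\<lambda>t. avg C (boltzmann C (H t)) n f) has_real_derivative
    avg C (boltzmann C (H t)) (Suc n) (replica_diff H' n f)) (at t)"
proof -
  define G where "G = boltzmann C (H t)"
  define m where "m = (\<Sum>y\<in>C. G y * H' y)"
  have G: "(\<Sum>x\<in>C. G x) = 1" using C by (simp add: G_def boltzmann_sum)
  have "((\<lambda>t. \<Prod>k\<in>{1..n}. boltzmann C (H t) (\<tau> k)) has_real_derivative
     (\<Prod>k\<in>{1..n}. G (\<tau> k)) * ((\<Sum>k\<in>{1..n}. H' (\<tau> k)) - real n * m)) (at t)"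
    if \<tau>: "\<tau> \<in> PiE {1..n} (\<lambda>_. C)" for \<tau>
  proof -
    have "((\<lambda>t. \<Prod>k\<in>{1..n}. boltzmann C (H t) (\<tau> k)) has_real_derivative
       (\<Prod>k\<in>{1..n}. boltzmann C (H t) (\<tau> k)) * (\<Sum>k\<in>{1..n}. (G (\<tau> k) * (H' (\<tau> k) - m)) / boltzmann C (H t) (\<tau> k))) (at t)"
      unfolding G_def m_def
    proof (rule has_field_derivative_prod')
      fix k assume k: "k \<in> {1..n}"
      then have "\<tau> k \<in> C" using \<tau> by auto
      then show "((\<lambda>t. boltzmann C (H t) (\<tau> k)) has_real_derivative
         boltzmann C (H t) (\<tau> k) * (H' (\<tau> k) - (\<Sum>y\<in>C. boltzmann C (H t) y * H' y))) (at t)"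
        using C H by (intro boltzmann_has_deriv)
      show "boltzmann C (H t) (\<tau> k) \<noteq> 0" using boltzmann_pos[OF C, of "H t" "\<tau> k"] by simp
    qed
    also have "(\<Sum>k\<in>{1..n}. (G (\<tau> k) * (H' (\<tau> k) - m)) / boltzmann C (H t) (\<tau> k)) = (\<Sum>k\<in>{1..n}. H' (\<tau> k) - m)"
      by (intro sum.cong refl) (use boltzmann_pos[OF C, of "H t"] in \<open>simp add: G_def less_imp_neq[symmetric]\<close>)
    finally show ?thesis by (simp add: G_def sum_subtractf)
  qed
  then have "((\<lambda>t. avg C (boltzmann C (H t)) n f) has_real_derivative
     (\<Sum>\<tau>\<in>PiE {1..n} (\<lambda>_. C). f \<tau> * ((\<Prod>k\<in>{1..n}. G (\<tau> k)) * ((\<Sum>k\<in>{1..n}. H' (\<tau> k)) - real n * m)))) (at t)"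
    unfolding avg_def by (intro DERIV_sum DERIV_cmult)
  also have "(\<Sum>\<tau>\<in>PiE {1..n} (\<lambda>_. C). f \<tau> * ((\<Prod>k\<in>{1..n}. G (\<tau> k)) * ((\<Sum>k\<in>{1..n}. H' (\<tau> k)) - real n * m)))
      = avg C G n (\<lambda>\<tau>. f \<tau> * ((\<Sum>k\<in>{1..n}. H' (\<tau> k)) - real n * m))"
    unfolding avg_def by (intro sum.cong refl) simp
  also have "\<dots> = avg C G (Suc n) (replica_diff H' n f)"
    unfolding avg_Suc[OF C(1)]
  proof (rule avg_cong)
    fix \<tau>
    have [simp]: "f (\<tau>(Suc n := x)) = f \<tau>" for x by (rule depD[OF f]) auto
    have "(\<Sum>x\<in>C. replica_diff H' n f (\<tau>(Suc n := x)) * G x)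
       = f \<tau> * (\<Sum>x\<in>C. ((\<Sum>k\<in>{1..n}. H' (\<tau> k)) * G x - real n * (G x * H' x)))"
      unfolding replica_diff_def sum_distrib_left by (intro sum.cong refl) (simp add: algebra_simps)
    also have "\<dots> = f \<tau> * ((\<Sum>k\<in>{1..n}. H' (\<tau> k)) - real n * m)"
      by (simp add: sum_subtractf sum_distrib_left[symmetric] G m_def)
    finally show "f \<tau> * ((\<Sum>k\<in>{1..n}. H' (\<tau> k)) - real n * m) = (\<Sum>x\<in>C. replica_diff H' n f (\<tau>(Suc n := x)) * G x)" ..
  qed
  finally show ?thesis unfolding G_def .
qed

section \<open>Gaussian disorder\<close>

text \<open>The mean value inequality bounds every difference quotient by \<open>B\<close>, and
  dominated convergence applies along an arbitrary null sequence. A bound at all \<open>t\<close> is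
  available later because the couplings are trigonometric in \<open>t\<close>.\<close>

lemma has_derivative_integral_dominated:
  fixes f :: "real \<Rightarrow> 'a \<Rightarrow> real"
  assumes int: "\<And>t. integrable M (f t)" and meas: "f' t0 \<in> borel_measurable M"
    and deriv: "\<And>t x. x \<in> space M \<Longrightarrow> ((\<lambda>t. f t x) has_real_derivative f' t x) (at t)"
    and bound: "\<And>t x. x \<in> space M \<Longrightarrow> \<bar>f' t x\<bar> \<le> B x" and B: "integrable M B"
  shows "((\<lambda>t. \<integral>x. f t x \<partial>M) has_real_derivative (\<integral>x. f' t0 x \<partial>M)) (at t0)"
  unfolding DERIV_def tendsto_at_iff_sequentially
proof (intro allI impI)
  fix h :: "nat \<Rightarrow> real" assume h: "\<forall>i. h i \<in> UNIV - {0}" "h \<longlonglongrightarrow> 0"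
  have nz: "h i \<noteq> 0" for i using h(1) by auto
  have "(\<lambda>i. \<integral>x. (f (t0 + h i) x - f t0 x) / h i \<partial>M) \<longlonglongrightarrow> (\<integral>x. f' t0 x \<partial>M)"
  proof (rule integral_dominated_convergence[where w = B])
    show "(\<lambda>x. (f (t0 + h i) x - f t0 x) / h i) \<in> borel_measurable M" for i
      using int[THEN borel_measurable_integrable] by measurable
    show "AE x in M. (\<lambda>i. (f (t0 + h i) x - f t0 x) / h i) \<longlonglongrightarrow> f' t0 x"
    proof (rule AE_I2)
      fix x assume x: "x \<in> space M"
      have "((\<lambda>h. (f (t0 + h) x - f t0 x) / h) \<longlongrightarrow> f' t0 x) (at 0)"
        using deriv[OF x, of t0] unfolding DERIV_def .
      then show "(\<lambda>i. (f (t0 + h i) x - f t0 x) / h i) \<longlonglongrightarrow> f' t0 x"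
        unfolding tendsto_at_iff_sequentially using h by (auto simp: o_def)
    qed
    show "AE x in M. norm ((f (t0 + h i) x - f t0 x) / h i) \<le> B x" for i
    proof (rule AE_I2)
      fix x assume x: "x \<in> space M"
      have "norm (f (t0 + h i) x - f t0 x) \<le> B x * norm (t0 + h i - t0)"
        by (rule field_differentiable_bound[of UNIV "\<lambda>t. f t x" "\<lambda>t. f' t x"])
          (use deriv[OF x] bound[OF x] in auto)
      then show "norm ((f (t0 + h i) x - f t0 x) / h i) \<le> B x"
        using nz[of i] by (simp add: divide_le_eq)
    qed
  qed (use meas B in auto)
  moreover have "(\<integral>x. (f (t0 + h i) x - f t0 x) / h i \<partial>M) = ((\<integral>x. f (t0 + h i) x \<partial>M) - (\<integral>x. f t0 x \<partial>M)) / h i" for i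
    using int nz[of i] by simp
  ultimately show "((\<lambda>h. ((\<integral>x. f (t0 + h) x \<partial>M) - (\<integral>x. f t0 x \<partial>M)) / h) \<circ> h) \<longlonglongrightarrow> (\<integral>x. f' t0 x \<partial>M)"
    by (simp only: o_def)
qed

lemma prob_space_std_normal: "prob_space std_normal_measure"
  unfolding std_normal_measure_def by (rule prob_space_normal_density) simp

lemma sets_std_normal [measurable_cong, simp]: "sets std_normal_measure = sets borel"
  by (simp add: std_normal_measure_def)

lemma space_std_normal [simp]: "space std_normal_measure = UNIV"
  by (simp add: std_normal_measure_def)

lemma integrable_std_normal_bounded:
  assumes "f \<in> borel_measurable borel" "\<And>x. \<bar>f x\<bar> \<le> B"
  shows "integrable std_normal_measure (f :: real \<Rightarrow> real)"
proof -
  interpret prob_space std_normal_measure by (rule prob_space_std_normal)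
  show ?thesis by (rule integrable_const_bound[of _ B]) (use assms in auto)
qed

lemma integrable_std_normal_times_bounded:
  assumes [measurable]: "f \<in> borel_measurable borel" and "\<And>x. \<bar>f x\<bar> \<le> B"
  shows "integrable std_normal_measure (\<lambda>x. x * f x :: real)"
proof (rule Bochner_Integration.integrable_bound)
  show "integrable std_normal_measure (\<lambda>x. B * \<bar>x\<bar>)"
    using integrable_std_normal_distribution_moment[of 1]
    unfolding std_normal_measure_def by (intro integrable_mult_right integrable_abs) simp
  have "B \<ge> 0" using assms(2)[of 0] by linarith
  then show "AE x in std_normal_measure. norm (x * f x) \<le> norm (B * \<bar>x\<bar>)"
    using assms(2) by (intro AE_I2) (simp add: abs_mult mult.commute[of B] mult_left_mono)
qed measurable

lemma std_normal_density_has_deriv: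
  "(std_normal_density has_real_derivative (- x * std_normal_density x)) (at x)"
proof -
  have "((\<lambda>x. exp (- x\<^sup>2 / 2)) has_real_derivative exp (- x\<^sup>2 / 2) * - x) (at x)"
    by (auto intro!: derivative_eq_intros)
  from DERIV_cmult[OF this, of "1 / sqrt (2 * pi)"] show ?thesis
    unfolding std_normal_density_def[abs_def] by (simp add: mult_ac)
qed

lemma std_normal_density_tendsto_0:
  "(std_normal_density \<longlongrightarrow> 0) at_top" "(std_normal_density \<longlongrightarrow> 0) at_bot"
  unfolding std_normal_density_def[abs_def] by real_asymp+

text \<open>Stein's identity: \<open>F' x - x * F x\<close> times the density is the derivative of
  \<open>F\<close> times the density, which vanishes at both infinities because \<open>F\<close> is
  bounded.\<close>

lemma std_normal_integration_by_parts:
  fixes F F' :: "real \<Rightarrow> real"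
  assumes F: "\<And>x. (F has_real_derivative F' x) (at x)" "\<And>x. \<bar>F x\<bar> \<le> B"
    and F': "\<And>x. isCont F' x" "\<And>x. \<bar>F' x\<bar> \<le> B'"
  shows "(\<integral>x. x * F x \<partial>std_normal_measure) = (\<integral>x. F' x \<partial>std_normal_measure)"
proof -
  have Fm [measurable]: "F \<in> borel_measurable borel"
    by (rule borel_measurable_continuous_onI) (use F(1) in \<open>auto intro!: continuous_at_imp_continuous_on DERIV_isCont\<close>)
  have F'm [measurable]: "F' \<in> borel_measurable borel"
    by (rule borel_measurable_continuous_onI) (use F'(1) in \<open>auto intro!: continuous_at_imp_continuous_on\<close>)
  have i1: "integrable std_normal_measure (\<lambda>x. x * F x)" by (rule integrable_std_normal_times_bounded[OF Fm F(2)])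
  have i2: "integrable std_normal_measure F'" by (rule integrable_std_normal_bounded[OF F'm F'(2)])
  let ?f = "\<lambda>x. (F' x - x * F x) * std_normal_density x"
  have int: "integrable lborel ?f"
    using Bochner_Integration.integrable_diff[OF i2 i1] unfolding std_normal_measure_def
    by (subst (asm) integrable_real_density) (auto simp: mult.commute)
  have lim: "((\<lambda>x. F x * std_normal_density x) \<longlongrightarrow> 0) G" if "(std_normal_density \<longlongrightarrow> 0) G" for G
  proof (rule Lim_null_comparison)
    show "\<forall>\<^sub>F x in G. norm (F x * std_normal_density x) \<le> B * std_normal_density x"
      using F(2) by (intro always_eventually allI) (simp add: abs_mult mult_right_mono)
    show "((\<lambda>x. B * std_normal_density x) \<longlongrightarrow> 0) G" using tendsto_mult_right_zero[OF that] .
  qed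
  have "(LBINT x=-\<infinity>..\<infinity>. ?f x) = 0 - 0"
  proof (rule interval_integral_FTC_integrable[where F = "\<lambda>x. F x * std_normal_density x"])
    fix x :: real
    show "((\<lambda>x. F x * std_normal_density x) has_vector_derivative ?f x) (at x)"
      unfolding has_real_derivative_iff_has_vector_derivative[symmetric]
      by (rule derivative_eq_intros F std_normal_density_has_deriv)+ (simp add: algebra_simps)
    show "isCont ?f x"
      using F'(1) DERIV_isCont[OF F(1)] DERIV_isCont[OF std_normal_density_has_deriv] by (intro continuous_intros) auto
  next
    show "set_integrable lborel (einterval (-\<infinity>) \<infinity>) ?f"
      using int by (simp add: set_integrable_def)
    show "(((\<lambda>x. F x * std_normal_density x) \<circ> real_of_ereal) \<longlongrightarrow> 0) (at_right (-\<infinity>))"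
      "(((\<lambda>x. F x * std_normal_density x) \<circ> real_of_ereal) \<longlongrightarrow> 0) (at_left \<infinity>)"
      unfolding ereal_tendsto_simps1 by (intro lim std_normal_density_tendsto_0)+
  qed simp
  then have "(\<integral>x. ?f x \<partial>lborel) = 0"
    by (simp add: interval_lebesgue_integral_def set_lebesgue_integral_def)
  also have "(\<integral>x. ?f x \<partial>lborel) = (\<integral>x. F' x - x * F x \<partial>std_normal_measure)"
    unfolding std_normal_measure_def by (subst integral_real_density) (auto simp: mult.commute)
  finally show ?thesis using i1 i2 by simp
qed

section \<open>Families of independent Gaussian couplings and quenched averages\<close>

abbreviation gauss :: "'e set \<Rightarrow> ('e \<Rightarrow> real) measure" where
  "gauss E \<equiv> PiM E (\<lambda>_. std_normal_measure)"

lemma prob_space_gauss: "prob_space (gauss E)"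
  by (rule prob_space_PiM) (rule prob_space_std_normal)

lemma product_sigma_finite_std_normal: "product_sigma_finite (\<lambda>_. std_normal_measure)"
  by (simp add: product_sigma_finite_def prob_space_std_normal prob_space_imp_sigma_finite)

lemma integrable_gauss_bounded:
  assumes "f \<in> borel_measurable (gauss E)" "\<And>g. \<bar>f g\<bar> \<le> B"
  shows "integrable (gauss E) (f :: _ \<Rightarrow> real)"
proof -
  interpret prob_space "gauss E" by (rule prob_space_gauss)
  show ?thesis by (rule integrable_const_bound[of _ B]) (use assms in auto)
qed

lemma integrable_gauss_abs_coord:
  assumes "e \<in> E" shows "integrable (gauss E) (\<lambda>g. \<bar>g e\<bar>)"
proof -
  have "distr (gauss E) std_normal_measure (\<lambda>g. g e) = std_normal_measure"
    by (rule distr_PiM_component) (use assms prob_space_std_normal in auto)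
  moreover have "integrable std_normal_measure (\<lambda>x::real. \<bar>x\<bar>)"
    using integrable_std_normal_distribution_moment[of 1] unfolding std_normal_measure_def
    by (intro integrable_abs) simp
  ultimately have "integrable (distr (gauss E) std_normal_measure (\<lambda>g. g e)) (\<lambda>x::real. \<bar>x\<bar>)" by simp
  then show ?thesis
    by (subst (asm) integrable_distr_eq) (use assms in auto)
qed

lemma integrable_gauss_coord_times_bounded:
  assumes "e \<in> E" and [measurable]: "f \<in> borel_measurable (gauss E)" and B: "\<And>g. \<bar>f g\<bar> \<le> B"
  shows "integrable (gauss E) (\<lambda>g. g e * f g :: real)"
proof (rule Bochner_Integration.integrable_bound)
  show "integrable (gauss E) (\<lambda>g. B * \<bar>g e\<bar>)" using integrable_gauss_abs_coord[OF assms(1)] by simp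
  show "(\<lambda>g. g e * f g) \<in> borel_measurable (gauss E)" using assms(1) by measurable
  have "B \<ge> 0" using B[of undefined] by linarith
  then show "AE g in gauss E. norm (g e * f g) \<le> norm (B * \<bar>g e\<bar>)"
    using B by (intro AE_I2) (simp add: abs_mult mult.commute[of B] mult_left_mono)
qed

text \<open>The amplitudes \<open>a\<close> are kept apart from the standard disorder
  \<open>g\<close>: an interpolation moves only \<open>a\<close> and \<open>K\<close>, and the
  probability space stays fixed.\<close>

definition gaussian_energy ::
  "'e set \<Rightarrow> ('e \<Rightarrow> real) \<Rightarrow> ('e \<Rightarrow> 'c \<Rightarrow> real) \<Rightarrow> ('c \<Rightarrow> real) \<Rightarrow> ('e \<Rightarrow> real) \<Rightarrow> 'c \<Rightarrow> real" where
  "gaussian_energy E a X K g \<sigma> = (\<Sum>e\<in>E. a e * g e * X e \<sigma>) + K \<sigma>"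

definition quenched ::
  "'e set \<Rightarrow> ('e \<Rightarrow> real) \<Rightarrow> ('e \<Rightarrow> 'c \<Rightarrow> real) \<Rightarrow> ('c \<Rightarrow> real) \<Rightarrow> 'c set \<Rightarrow> nat \<Rightarrow> ((nat \<Rightarrow> 'c) \<Rightarrow> real) \<Rightarrow> real" where
  "quenched E a X K C n f = (\<integral>g. avg C (boltzmann C (gaussian_energy E a X K g)) n f \<partial>gauss E)"

text \<open>The bound is crude, but it is uniform in \<open>H\<close> and hence in the disorder,
  which is what integrability and domination ask for.\<close>

lemma avg_boltzmann_abs_le:
  assumes C: "finite C" "C \<noteq> {}"
  shows "\<bar>avg C (boltzmann C H) n f\<bar> \<le> (\<Sum>\<tau>\<in>PiE {1..n} (\<lambda>_. C). \<bar>f \<tau>\<bar>)"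
proof -
  have le1: "boltzmann C H x \<le> 1" if "x \<in> C" for x
    using member_le_sum[OF that, of "boltzmann C H"] C boltzmann_nonneg[of C H] by (simp add: boltzmann_sum)
  have "\<bar>avg C (boltzmann C H) n f\<bar> \<le> (\<Sum>\<tau>\<in>PiE {1..n} (\<lambda>_. C). \<bar>f \<tau> * (\<Prod>k\<in>{1..n}. boltzmann C H (\<tau> k))\<bar>)"
    unfolding avg_def by (rule sum_abs)
  also have "\<dots> \<le> (\<Sum>\<tau>\<in>PiE {1..n} (\<lambda>_. C). \<bar>f \<tau>\<bar>)"
  proof (rule sum_mono)
    fix \<tau> assume \<tau>: "\<tau> \<in> PiE {1..n} (\<lambda>_. C)"
    have "(\<Prod>k\<in>{1..n}. boltzmann C H (\<tau> k)) \<le> 1"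
      by (rule prod_le_1) (use PiE_mem[OF \<tau>] le1 boltzmann_nonneg[of C H] in auto)
    moreover have "(\<Prod>k\<in>{1..n}. boltzmann C H (\<tau> k)) \<ge> 0"
      by (rule prod_nonneg) (use boltzmann_nonneg[of C H] in auto)
    ultimately show "\<bar>f \<tau> * (\<Prod>k\<in>{1..n}. boltzmann C H (\<tau> k))\<bar> \<le> \<bar>f \<tau>\<bar>"
      by (simp add: abs_mult mult_left_le)
  qed
  finally show ?thesis .
qed

lemma measurable_avg_boltzmann:
  "(\<lambda>g. avg C (boltzmann C (gaussian_energy E a X K g)) n f) \<in> borel_measurable (gauss E)"
proof -
  have [measurable]: "(\<lambda>g. gaussian_energy E a X K g \<sigma>) \<in> borel_measurable (gauss E)" for \<sigma>
    unfolding gaussian_energy_def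
    by (intro borel_measurable_add borel_measurable_sum borel_measurable_times) auto
  show ?thesis unfolding avg_def boltzmann_def by measurable
qed

lemma integrable_avg_boltzmann:
  assumes "finite C" "C \<noteq> {}"
  shows "integrable (gauss E) (\<lambda>g. avg C (boltzmann C (gaussian_energy E a X K g)) n f)"
  by (rule integrable_gauss_bounded[OF measurable_avg_boltzmann avg_boltzmann_abs_le[OF assms]])

text \<open>Fubini isolates the coordinate \<open>e\<close>. As a function of \<open>g e\<close>
  alone the energy is affine with slope \<open>a e * X e\<close>, so Stein's identity turns the
  factor \<open>g e\<close> into a derivative of the Gibbs weights, that is, into a
  \<open>replica_diff\<close>.\<close>

lemma quenched_integration_by_parts:
  assumes E: "finite E" "e \<in> E" and C: "finite C" "C \<noteq> {}" and f: "dep n f"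
  shows "(\<integral>g. g e * avg C (boltzmann C (gaussian_energy E a X K g)) n f \<partial>gauss E)
    = a e * quenched E a X K C (Suc n) (replica_diff (X e) n f)"
proof -
  interpret product_sigma_finite "\<lambda>_. std_normal_measure" by (rule product_sigma_finite_std_normal)
  define J where "J = E - {e}"
  have J: "E = insert e J" "finite J" "e \<notin> J" using E by (auto simp: J_def)
  let ?H = "gaussian_energy E a X K"
  have deriv: "((\<lambda>y. avg C (boltzmann C (?H (x(e := y)))) n f) has_real_derivative
      avg C (boltzmann C (?H (x(e := y)))) (Suc n) (replica_diff (\<lambda>\<sigma>. a e * X e \<sigma>) n f)) (at y)"
    if "dep n f" for n f x y
  proof (rule avg_boltzmann_has_deriv[OF C that])
    fix \<sigma>
    have "?H (x(e := y)) \<sigma> = a e * y * X e \<sigma> + ((\<Sum>e\<in>J. a e * x e * X e \<sigma>) + K \<sigma>)" for y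
      using J by (simp add: gaussian_energy_def) (auto intro!: sum.cong)
    then show "((\<lambda>y. ?H (x(e := y)) \<sigma>) has_real_derivative a e * X e \<sigma>) (at y)"
      by (auto intro!: derivative_eq_intros)
  qed
  have ibp: "(\<integral>y. y * avg C (boltzmann C (?H (x(e := y)))) n f \<partial>std_normal_measure)
     = (\<integral>y. avg C (boltzmann C (?H (x(e := y)))) (Suc n) (replica_diff (\<lambda>\<sigma>. a e * X e \<sigma>) n f) \<partial>std_normal_measure)" for x
    by (rule std_normal_integration_by_parts[OF deriv[OF f] avg_boltzmann_abs_le[OF C]
          DERIV_isCont[OF deriv[OF dep_replica_diff[OF f]]] avg_boltzmann_abs_le[OF C]])
  have "(\<integral>g. g e * avg C (boltzmann C (?H g)) n f \<partial>gauss E)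
     = (\<integral>x. \<integral>y. y * avg C (boltzmann C (?H (x(e := y)))) n f \<partial>std_normal_measure \<partial>gauss J)"
    using product_integral_insert[OF J(2,3), of "\<lambda>g. g e * avg C (boltzmann C (?H g)) n f"]
      integrable_gauss_coord_times_bounded[OF E(2) measurable_avg_boltzmann[of C E a X K n f] avg_boltzmann_abs_le[OF C]] J(1)
    by simp
  also have "\<dots> = (\<integral>x. \<integral>y. avg C (boltzmann C (?H (x(e := y)))) (Suc n) (replica_diff (\<lambda>\<sigma>. a e * X e \<sigma>) n f) \<partial>std_normal_measure \<partial>gauss J)"
    by (simp only: ibp)
  also have "\<dots> = quenched E a X K C (Suc n) (replica_diff (\<lambda>\<sigma>. a e * X e \<sigma>) n f)"
    unfolding quenched_def
    using product_integral_insert[OF J(2,3), of "\<lambda>g. avg C (boltzmann C (?H g)) (Suc n) (replica_diff (\<lambda>\<sigma>. a e * X e \<sigma>) n f)"]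
      integrable_avg_boltzmann[OF C, of E a X K "Suc n" "replica_diff (\<lambda>\<sigma>. a e * X e \<sigma>) n f"] J(1)
    by simp
  also have "replica_diff (\<lambda>\<sigma>. a e * X e \<sigma>) n f = (\<lambda>\<tau>. a e * replica_diff (X e) n f \<tau>)"
    by (simp add: replica_diff_def fun_eq_iff sum_distrib_left algebra_simps)
  also have "quenched E a X K C (Suc n) (\<lambda>\<tau>. a e * replica_diff (X e) n f \<tau>)
     = a e * quenched E a X K C (Suc n) (replica_diff (X e) n f)"
    unfolding quenched_def avg_cmult by simp
  finally show ?thesis .
qed

lemma replica_diff_energy:
  "replica_diff (\<lambda>\<sigma>. gaussian_energy E a X K g \<sigma>) n f \<tau>
    = (\<Sum>e\<in>E. a e * (g e * replica_diff (X e) n f \<tau>)) + replica_diff K n f \<tau>"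
proof -
  have "(\<Sum>k\<in>{1..n}. \<Sum>e\<in>E. a e * g e * X e (\<tau> k)) = (\<Sum>e\<in>E. a e * g e * (\<Sum>k\<in>{1..n}. X e (\<tau> k)))"
    by (subst sum.swap) (simp add: sum_distrib_left)
  then show ?thesis
    unfolding replica_diff_def gaussian_energy_def
    by (simp add: sum.distrib sum_distrib_left sum_subtractf algebra_simps)
qed

text \<open>Differentiating the energy produces factors \<open>g e\<close>, and integration by parts
  trades each of them for \<open>a t e\<close> and a second \<open>replica_diff\<close>. The
  coefficient \<open>a' * a\<close> is half the derivative of the variance of the coupling.\<close>

lemma quenched_has_deriv:
  assumes E: "finite E" and C: "finite C" "C \<noteq> {}" and f: "dep n f"
    and a: "\<And>t e. e \<in> E \<Longrightarrow> ((\<lambda>t. a t e) has_real_derivative a' t e) (at t)"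
    and K: "\<And>t \<sigma>. \<sigma> \<in> C \<Longrightarrow> ((\<lambda>t. K t \<sigma>) has_real_derivative K' t \<sigma>) (at t)"
    and a'b: "\<And>t e. e \<in> E \<Longrightarrow> \<bar>a' t e\<bar> \<le> b"
    and K'b: "\<And>t \<sigma>. \<sigma> \<in> C \<Longrightarrow> \<bar>K' t \<sigma>\<bar> \<le> b"
  shows "((\<lambda>t. quenched E (a t) X (K t) C n f) has_real_derivative
    (\<Sum>e\<in>E. a' t e * a t e * quenched E (a t) X (K t) C (Suc (Suc n)) (replica_diff (X e) (Suc n) (replica_diff (X e) n f)))
    + quenched E (a t) X (K t) C (Suc n) (replica_diff (K' t) n f)) (at t)"
proof -
  let ?A = "\<lambda>t g n f. avg C (boltzmann C (gaussian_energy E (a t) X (K t) g)) n f"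
  let ?D = "\<lambda>e. replica_diff (X e) n f"
  have Deq: "?A t g (Suc n) (replica_diff (\<lambda>\<sigma>. gaussian_energy E (a' t) X (K' t) g \<sigma>) n f)
     = (\<Sum>e\<in>E. a' t e * (g e * ?A t g (Suc n) (?D e))) + ?A t g (Suc n) (replica_diff (K' t) n f)" for t g
    unfolding replica_diff_energy avg_add avg_sum avg_cmult ..
  \<comment> \<open>\<open>B\<close> sums over all couplings so that one constant serves every
    \<open>e\<close>; in \<open>B'\<close> the two terms \<open>real n * b\<close> bound the
    \<open>n\<close> replicas and the \<open>n\<close>-fold weight of the additional one.\<close>
  define B where "B = (\<Sum>e\<in>E. \<Sum>\<tau>\<in>PiE {1..Suc n} (\<lambda>_. C). \<bar>?D e \<tau>\<bar>)"
  define B' where "B' = (\<Sum>\<tau>\<in>PiE {1..Suc n} (\<lambda>_. C). \<bar>f \<tau>\<bar> * (real n * b + real n * b))"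
  have D: "((\<lambda>t. quenched E (a t) X (K t) C n f) has_real_derivative
    (\<integral>g. ?A t g (Suc n) (replica_diff (\<lambda>\<sigma>. gaussian_energy E (a' t) X (K' t) g \<sigma>) n f) \<partial>gauss E)) (at t)"
    unfolding quenched_def
  proof (rule has_derivative_integral_dominated[where B = "\<lambda>g. (\<Sum>e\<in>E. b * (\<bar>g e\<bar> * B)) + B'"])
    show "integrable (gauss E) (\<lambda>g. ?A t g n f)" for t
      by (rule integrable_avg_boltzmann[OF C])
    have m [measurable]: "(\<lambda>g. ?A t g n f) \<in> borel_measurable (gauss E)" for n f
      by (rule measurable_avg_boltzmann)
    have [measurable]: "(\<lambda>g. g e) \<in> borel_measurable (gauss E)" if "e \<in> E" for e
      using that by measurable
    show "(\<lambda>g. ?A t g (Suc n) (replica_diff (\<lambda>\<sigma>. gaussian_energy E (a' t) X (K' t) g \<sigma>) n f)) \<in> borel_measurable (gauss E)"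
      unfolding Deq by measurable
    show "((\<lambda>t. ?A t g n f) has_real_derivative
       ?A t g (Suc n) (replica_diff (\<lambda>\<sigma>. gaussian_energy E (a' t) X (K' t) g \<sigma>) n f)) (at t)" for t g
    proof (rule avg_boltzmann_has_deriv[OF C f])
      fix \<sigma> assume "\<sigma> \<in> C"
      then show "((\<lambda>t. gaussian_energy E (a t) X (K t) g \<sigma>) has_real_derivative gaussian_energy E (a' t) X (K' t) g \<sigma>) (at t)"
        unfolding gaussian_energy_def by (intro DERIV_add DERIV_sum DERIV_cmult_right a K)
    qed
    show "\<bar>?A t g (Suc n) (replica_diff (\<lambda>\<sigma>. gaussian_energy E (a' t) X (K' t) g \<sigma>) n f)\<bar>
       \<le> (\<Sum>e\<in>E. b * (\<bar>g e\<bar> * B)) + B'" for t g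
      unfolding Deq
    proof (intro order_trans[OF abs_triangle_ineq] add_mono order_trans[OF sum_abs] sum_mono)
      fix e assume e: "e \<in> E"
      have "\<bar>?A t g (Suc n) (?D e)\<bar> \<le> (\<Sum>\<tau>\<in>PiE {1..Suc n} (\<lambda>_. C). \<bar>?D e \<tau>\<bar>)"
        by (rule avg_boltzmann_abs_le[OF C])
      also have "\<dots> \<le> B" unfolding B_def using e E
        by (intro member_le_sum[of e E "\<lambda>e. \<Sum>\<tau>\<in>PiE {1..Suc n} (\<lambda>_. C). \<bar>?D e \<tau>\<bar>"]) (auto intro!: sum_nonneg)
      finally show "\<bar>a' t e * (g e * ?A t g (Suc n) (?D e))\<bar> \<le> b * (\<bar>g e\<bar> * B)"
        using a'b[OF e, of t] by (auto simp: abs_mult intro!: mult_mono)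
    next
      have "\<bar>?A t g (Suc n) (replica_diff (K' t) n f)\<bar> \<le> (\<Sum>\<tau>\<in>PiE {1..Suc n} (\<lambda>_. C). \<bar>replica_diff (K' t) n f \<tau>\<bar>)"
        by (rule avg_boltzmann_abs_le[OF C])
      also have "\<dots> \<le> B'" unfolding B'_def
      proof (rule sum_mono)
        fix \<tau> assume "\<tau> \<in> PiE {1..Suc n} (\<lambda>_. C)"
        then have \<tau>: "\<tau> k \<in> C" if "k \<in> {1..Suc n}" for k using that by auto
        have "\<bar>\<Sum>k\<in>{1..n}. K' t (\<tau> k)\<bar> \<le> real n * b"
          using sum_bounded_above[of "{1..n}" "\<lambda>k. \<bar>K' t (\<tau> k)\<bar>" b] K'b \<tau>
          by (intro order_trans[OF sum_abs]) auto
        moreover have "\<bar>real n * K' t (\<tau> (Suc n))\<bar> \<le> real n * b"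
          using K'b[OF \<tau>[of "Suc n"]] by (simp add: abs_mult mult_left_mono)
        ultimately have "\<bar>(\<Sum>k\<in>{1..n}. K' t (\<tau> k)) - real n * K' t (\<tau> (Suc n))\<bar> \<le> real n * b + real n * b"
          by linarith
        then show "\<bar>replica_diff (K' t) n f \<tau>\<bar> \<le> \<bar>f \<tau>\<bar> * (real n * b + real n * b)"
          unfolding replica_diff_def abs_mult by (intro mult_left_mono) auto
      qed
      finally show "\<bar>?A t g (Suc n) (replica_diff (K' t) n f)\<bar> \<le> B'" .
    qed
    show "integrable (gauss E) (\<lambda>g. (\<Sum>e\<in>E. b * (\<bar>g e\<bar> * B)) + B')"
    proof -
      interpret prob_space "gauss E" by (rule prob_space_gauss)
      show ?thesis
        by (intro Bochner_Integration.integrable_add Bochner_Integration.integrable_sum integrable_mult_right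
            integrable_mult_left integrable_gauss_abs_coord) auto
    qed
  qed
  have int1: "integrable (gauss E) (\<lambda>g. g e * ?A t g (Suc n) (?D e))" if "e \<in> E" for e
    by (rule integrable_gauss_coord_times_bounded[OF that measurable_avg_boltzmann avg_boltzmann_abs_le[OF C]])
  have "(\<integral>g. ?A t g (Suc n) (replica_diff (\<lambda>\<sigma>. gaussian_energy E (a' t) X (K' t) g \<sigma>) n f) \<partial>gauss E)
     = (\<Sum>e\<in>E. a' t e * (\<integral>g. g e * ?A t g (Suc n) (?D e) \<partial>gauss E)) + quenched E (a t) X (K t) C (Suc n) (replica_diff (K' t) n f)"
    unfolding Deq quenched_def
    by (subst Bochner_Integration.integral_add)
      (auto intro!: Bochner_Integration.integrable_sum integrable_mult_right int1 integrable_avg_boltzmann[OF C]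
        simp: Bochner_Integration.integral_sum int1)
  also have "(\<Sum>e\<in>E. a' t e * (\<integral>g. g e * ?A t g (Suc n) (?D e) \<partial>gauss E)) =
     (\<Sum>e\<in>E. a' t e * a t e * quenched E (a t) X (K t) C (Suc (Suc n)) (replica_diff (X e) (Suc n) (?D e)))"
    using quenched_integration_by_parts[OF E _ C dep_replica_diff[OF f]]
    by (intro sum.cong refl) (simp add: mult.assoc)
  finally show ?thesis using D by simp
qed

section \<open>Interpolation along the cavity path\<close>

context
  fixes E :: "'e set" and a :: "'e \<Rightarrow> real" and X :: "'e \<Rightarrow> 'c \<Rightarrow> real" and K :: "'c \<Rightarrow> real" and C :: "'c set"
  assumes C: "finite C" "C \<noteq> {}"
begin

lemma quenched_cong:
  "(\<And>\<tau>. \<tau> \<in> PiE {1..n} (\<lambda>_. C) \<Longrightarrow> f \<tau> = f' \<tau>) \<Longrightarrow> quenched E a X K C n f = quenched E a X K C n f'"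
  unfolding quenched_def by (intro Bochner_Integration.integral_cong refl avg_cong)

lemma quenched_add:
  "quenched E a X K C n (\<lambda>\<tau>. f \<tau> + g \<tau>) = quenched E a X K C n f + quenched E a X K C n g"
  unfolding quenched_def avg_add by (intro Bochner_Integration.integral_add integrable_avg_boltzmann C)

lemma quenched_diff:
  "quenched E a X K C n (\<lambda>\<tau>. f \<tau> - g \<tau>) = quenched E a X K C n f - quenched E a X K C n g"
  unfolding quenched_def avg_diff by (intro Bochner_Integration.integral_diff integrable_avg_boltzmann C)

lemma quenched_cmult: "quenched E a X K C n (\<lambda>\<tau>. c * f \<tau>) = c * quenched E a X K C n f"
  unfolding quenched_def avg_cmult by simp

lemma quenched_sum:
  "quenched E a X K C n (\<lambda>\<tau>. \<Sum>i\<in>I. f i \<tau>) = (\<Sum>i\<in>I. quenched E a X K C n (f i))"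
  unfolding quenched_def avg_sum by (intro Bochner_Integration.integral_sum integrable_avg_boltzmann C)

lemma quenched_mono:
  "(\<And>\<tau>. \<tau> \<in> PiE {1..n} (\<lambda>_. C) \<Longrightarrow> f \<tau> \<le> f' \<tau>) \<Longrightarrow> quenched E a X K C n f \<le> quenched E a X K C n f'"
  unfolding quenched_def by (intro integral_mono integrable_avg_boltzmann C avg_mono boltzmann_nonneg)

lemma quenched_const: "quenched E a X K C n (\<lambda>_. c) = c"
proof -
  interpret prob_space "gauss E" by (rule prob_space_gauss)
  show ?thesis unfolding quenched_def
    by (simp add: avg_const[OF C(1) boltzmann_sum[OF C]] prob_space)
qed

lemma quenched_reindex:
  assumes "inj_on \<pi> {1..n'}" "\<pi> ` {1..n'} \<subseteq> {1..n}" "dep n' f"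
  shows "quenched E a X K C n (\<lambda>\<tau>. f (\<lambda>k. \<tau> (\<pi> k))) = quenched E a X K C n' f"
  unfolding quenched_def
  by (intro Bochner_Integration.integral_cong refl avg_reindex[OF C(1) boltzmann_sum[OF C] assms])

lemma quenched_more_replicas:
  assumes "dep n f" "n \<le> n'"
  shows "quenched E a X K C n' f = quenched E a X K C n f"
  using quenched_reindex[of "\<lambda>k. k" n n' f] assms by simp

end

text \<open>Signed weights, of total zero over \<open>{1..Suc n}\<close>, that write
  \<open>replica_diff\<close> as a single sum; two nested ones give the double sum in
  \<open>drift\<close>.\<close>

definition contrast :: "nat \<Rightarrow> nat \<Rightarrow> real" where
  "contrast n l = (if l \<le> n then 1 else - real n)"

lemma replica_diff_contrast:
  "replica_diff u n f \<tau> = f \<tau> * (\<Sum>l\<in>{1..Suc n}. contrast n l * u (\<tau> l))"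
proof -
  have "{1..Suc n} = insert (Suc n) {1..n}" by auto
  then show ?thesis by (simp add: replica_diff_def contrast_def)
qed

section \<open>Configurations and the interpolating model\<close>

definition pairs :: "nat \<Rightarrow> (nat \<times> nat) set" where
  "pairs N = {(i,j). 1 \<le> i \<and> i < j \<and> j \<le> N}"

lemma finite_pairs [simp]: "finite (pairs N)"
  by (rule finite_subset[of _ "{1..N} \<times> {1..N}"]) (auto simp: pairs_def)

lemma zero_notin_pairs [simp]: "(0,0) \<notin> pairs N"
  by (simp add: pairs_def)

lemma sum_pairs_containing:
  fixes f :: "nat \<Rightarrow> real"
  assumes m: "m \<in> {1..N}"
  shows "(\<Sum>e\<in>{e \<in> pairs N. fst e = m \<or> snd e = m}. f (fst e) * f (snd e)) = f m * (\<Sum>i\<in>{1..N}-{m}. f i)"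
proof -
  \<comment> \<open>A site \<open>i\<close> other than \<open>m\<close> corresponds to the pair it
    forms with \<open>m\<close>, put in increasing order.\<close>
  have "(\<Sum>i\<in>{1..N}-{m}. f m * f i) = (\<Sum>e\<in>{e \<in> pairs N. fst e = m \<or> snd e = m}. f (fst e) * f (snd e))"
    by (rule sum.reindex_bij_witness[where i = "\<lambda>e. if fst e = m then snd e else fst e" and j = "\<lambda>i. (min i m, max i m)"])
      (use m in \<open>auto simp: pairs_def min_def max_def\<close>)
  then show ?thesis by (simp add: sum_distrib_left)
qed

lemma finite_spins [simp]: "finite (spins S)" and spins_nonempty [simp]: "spins S \<noteq> {}"
  by (auto simp: spins_def)

lemma finite_configs [simp]: "finite (configs S N)"
  unfolding configs_def by (intro finite_PiE) auto

lemma configs_nonempty [simp]: "configs S N \<noteq> {}"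
  unfolding configs_def by (simp add: PiE_eq_empty_iff)

lemma abs_spin_le: "x \<in> spins S \<Longrightarrow> \<bar>real_of_int x\<bar> \<le> real S"
  unfolding spins_def by (auto simp: abs_le_iff)

lemma configs_spin: "\<sigma> \<in> configs S N \<Longrightarrow> i \<in> {1..N} \<Longrightarrow> \<sigma> i \<in> spins S"
  unfolding configs_def by auto

text \<open>The bound \<open>\<beta> \<le> 1\<close> frees the comparison constants along the path
  from \<open>\<beta>\<close>, so that smallness can be imposed afterwards in terms of them.\<close>

locale sk_model =
  fixes S :: nat and \<beta> D hf p q :: real
  assumes \<beta>_pos: "0 < \<beta>" and \<beta>_le_1: "\<beta> \<le> 1" and pq: "is_pq S \<beta> D hf p q"
begin

lemma q_nonneg: "0 \<le> q"
  using pq unfolding is_pq_def by (metis Bochner_Integration.integral_nonneg zero_le_power2)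

text \<open>The coupling indexed by \<open>(0, 0)\<close> is the Gaussian field that replaces, at the cavity site \<open>m\<close>,
  the interaction with the other sites; the path runs from \<open>\<theta> = 0\<close> (decoupled) to \<open>\<theta> = \<pi> / 2\<close>.\<close>

definition coupling :: "nat \<Rightarrow> nat \<Rightarrow> real \<Rightarrow> nat \<times> nat \<Rightarrow> real" where
  "coupling N m \<theta> e = (if e = (0,0) then cos \<theta> * (\<beta> * sqrt q)
     else if fst e = m \<or> snd e = m then sin \<theta> * (\<beta> / sqrt (real N)) else \<beta> / sqrt (real N))"

definition coupled_spins :: "nat \<Rightarrow> nat \<times> nat \<Rightarrow> (nat \<Rightarrow> int) \<Rightarrow> real" where
  "coupled_spins m e \<sigma> = (if e = (0,0) then of_int (\<sigma> m) else of_int (\<sigma> (fst e)) * of_int (\<sigma> (snd e)))"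

text \<open>The last term completes the one-site weight of the limiting model at
  \<open>\<theta> = 0\<close> and is absent at \<open>\<theta> = pi / 2\<close>. Its derivative
  supplies the correction \<open>p - q\<close> for pairs formed by a replica with itself.\<close>

definition external :: "nat \<Rightarrow> nat \<Rightarrow> real \<Rightarrow> (nat \<Rightarrow> int) \<Rightarrow> real" where
  "external N m \<theta> \<sigma> = D * (\<Sum>i\<in>{1..N}. (of_int (\<sigma> i))\<^sup>2) + hf * (\<Sum>i\<in>{1..N}. of_int (\<sigma> i))
     + (cos \<theta>)\<^sup>2 * (\<beta>\<^sup>2 / 2 * (p - q) * (of_int (\<sigma> m))\<^sup>2)"

text \<open>The disorder contains the coordinate \<open>(0,0)\<close> even where its coupling
  vanishes, so the whole path lives on one probability space.\<close>

definition ev :: "nat \<Rightarrow> nat \<Rightarrow> real \<Rightarrow> nat \<Rightarrow> ((nat \<Rightarrow> nat \<Rightarrow> int) \<Rightarrow> real) \<Rightarrow> real" where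
  "ev N m \<theta> n f = quenched (insert (0,0) (pairs N)) (coupling N m \<theta>) (coupled_spins m) (external N m \<theta>) (configs S N) n f"

lemma
  shows ev_add: "ev N m \<theta> n (\<lambda>\<tau>. f \<tau> + g \<tau>) = ev N m \<theta> n f + ev N m \<theta> n g"
    and ev_diff: "ev N m \<theta> n (\<lambda>\<tau>. f \<tau> - g \<tau>) = ev N m \<theta> n f - ev N m \<theta> n g"
    and ev_cmult: "ev N m \<theta> n (\<lambda>\<tau>. c * f \<tau>) = c * ev N m \<theta> n f"
    and ev_sum: "ev N m \<theta> n (\<lambda>\<tau>. \<Sum>i\<in>I. h i \<tau>) = (\<Sum>i\<in>I. ev N m \<theta> n (h i))"
    and ev_const: "ev N m \<theta> n (\<lambda>_. c) = c"
    and ev_mono: "(\<And>\<tau>. \<tau> \<in> PiE {1..n} (\<lambda>_. configs S N) \<Longrightarrow> f \<tau> \<le> g \<tau>) \<Longrightarrow> ev N m \<theta> n f \<le> ev N m \<theta> n g"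
    and ev_cong: "(\<And>\<tau>. \<tau> \<in> PiE {1..n} (\<lambda>_. configs S N) \<Longrightarrow> f \<tau> = g \<tau>) \<Longrightarrow> ev N m \<theta> n f = ev N m \<theta> n g"
    and ev_reindex: "inj_on \<pi> {1..n'} \<Longrightarrow> \<pi> ` {1..n'} \<subseteq> {1..n} \<Longrightarrow> dep n' f \<Longrightarrow>
      ev N m \<theta> n (\<lambda>\<tau>. f (\<lambda>k. \<tau> (\<pi> k))) = ev N m \<theta> n' f"
    and ev_more_replicas: "dep n f \<Longrightarrow> n \<le> n' \<Longrightarrow> ev N m \<theta> n' f = ev N m \<theta> n f"
  unfolding ev_def
  by (rule quenched_add quenched_diff quenched_cmult quenched_sum quenched_const quenched_mono quenched_cong
      quenched_reindex quenched_more_replicas; simp)+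

definition overlap_const :: "nat \<Rightarrow> nat \<Rightarrow> real" where
  "overlap_const a b = (if a = b then p else q)"

text \<open>The fluctuation of an overlap around its limit on the scale where it is of order one.
  Site \<open>m\<close> is left out of the sum but the normalisation stays \<open>N\<close>, so the
  full overlap exceeds it by exactly one term of order \<open>1 / sqrt N\<close>.\<close>

definition cavity_overlap :: "nat \<Rightarrow> nat \<Rightarrow> nat \<Rightarrow> nat \<Rightarrow> (nat \<Rightarrow> nat \<Rightarrow> int) \<Rightarrow> real" where
  "cavity_overlap N m a b \<tau> = 1 / sqrt (real N) * (\<Sum>i\<in>{1..N}-{m}. of_int (\<tau> a i) * of_int (\<tau> b i))
     - sqrt (real N) * overlap_const a b"

definition drift :: "nat \<Rightarrow> nat \<Rightarrow> nat \<Rightarrow> (nat \<Rightarrow> nat \<Rightarrow> int) \<Rightarrow> real" where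
  "drift N m n \<tau> = (\<Sum>l\<in>{1..Suc n}. \<Sum>l'\<in>{1..Suc (Suc n)}. contrast n l * contrast (Suc n) l'
     * (of_int (\<tau> l m) * of_int (\<tau> l' m)) * cavity_overlap N m l l' \<tau>)"

text \<open>For replicas \<open>l\<close> and \<open>l'\<close>, the interactions of site
  \<open>m\<close> contribute the empirical overlap, the field subtracts \<open>q\<close>, and the
  quadratic term subtracts \<open>p - q\<close> when \<open>l = l'\<close>. Together these are the
  centred overlap, and one factor \<open>sqrt N\<close> is taken out to bring it to unit
  scale.\<close>

lemma drift_identity:
  assumes m: "m \<in> {1..N}"
    and a': "a' = (\<lambda>e. if e = (0,0) then - sin \<theta> * (\<beta> * sqrt q)
     else if fst e = m \<or> snd e = m then cos \<theta> * (\<beta> / sqrt (real N)) else 0)"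
    and K': "K' = (\<lambda>\<sigma>. - 2 * cos \<theta> * sin \<theta> * (\<beta>\<^sup>2 / 2 * (p - q) * (of_int (\<sigma> m))\<^sup>2))"
  shows "(\<Sum>e\<in>insert (0,0) (pairs N). a' e * coupling N m \<theta> e *
        replica_diff (coupled_spins m e) (Suc n) (replica_diff (coupled_spins m e) n f) \<tau>)
      + replica_diff K' n f \<tau>
    = sin \<theta> * cos \<theta> * (\<beta>\<^sup>2 / sqrt (real N)) * (f \<tau> * drift N m n \<tau>)"
proof -
  have N: "real N > 0" using m by auto
  define w where "w = (\<lambda>l l'. contrast n l * contrast (Suc n) l')"
  let ?L = "{1..Suc n}" and ?L' = "{1..Suc (Suc n)}"
  let ?sc = "sin \<theta> * cos \<theta>"
  define R where "R = (\<lambda>l l'. \<Sum>i\<in>{1..N}-{m}. real_of_int (\<tau> l i) * of_int (\<tau> l' i))"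
  define x where "x = (\<lambda>l. real_of_int (\<tau> l m))"
  have rd2: "replica_diff u (Suc n) (replica_diff u n f) \<tau> = (\<Sum>l\<in>?L. \<Sum>l'\<in>?L'. f \<tau> * w l l' * (u (\<tau> l) * u (\<tau> l')))" for u
  proof -
    have "replica_diff u (Suc n) (replica_diff u n f) \<tau>
      = f \<tau> * ((\<Sum>l\<in>?L. contrast n l * u (\<tau> l)) * (\<Sum>l'\<in>?L'. contrast (Suc n) l' * u (\<tau> l')))"
      by (simp only: replica_diff_contrast mult.assoc)
    also have "\<dots> = (\<Sum>l\<in>?L. \<Sum>l'\<in>?L'. f \<tau> * w l l' * (u (\<tau> l) * u (\<tau> l')))"
      unfolding sum_product unfolding sum_distrib_left w_def by (intro sum.cong refl) (simp add: mult_ac)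
    finally show ?thesis .
  qed
  \<comment> \<open>The product of coupling and derivative is
    \<open>sin \<theta> * cos \<theta>\<close> times a variance, with a plus sign for the
    interactions of \<open>m\<close> and a minus sign for the field; couplings away from
    \<open>m\<close> are constant and drop out.\<close>
  have cov: "(\<Sum>e\<in>insert (0,0) (pairs N). a' e * coupling N m \<theta> e * (coupled_spins m e (\<tau> l) * coupled_spins m e (\<tau> l')))
     = ?sc * \<beta>\<^sup>2 * (x l * x l') * (R l l' / real N - q)" for l l'
  proof -
    have "(\<Sum>e\<in>pairs N. a' e * coupling N m \<theta> e * (coupled_spins m e (\<tau> l) * coupled_spins m e (\<tau> l')))
       = (\<Sum>e\<in>pairs N. if fst e = m \<or> snd e = m then ?sc * (\<beta>\<^sup>2 / real N) *
         ((of_int (\<tau> l (fst e)) * of_int (\<tau> l' (fst e))) * (of_int (\<tau> l (snd e)) * of_int (\<tau> l' (snd e)))) else 0)"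
    proof (rule sum.cong[OF refl])
      fix e assume "e \<in> pairs N"
      then have "e \<noteq> (0,0)" by auto
      then show "a' e * coupling N m \<theta> e * (coupled_spins m e (\<tau> l) * coupled_spins m e (\<tau> l'))
         = (if fst e = m \<or> snd e = m then ?sc * (\<beta>\<^sup>2 / real N) *
         ((of_int (\<tau> l (fst e)) * of_int (\<tau> l' (fst e))) * (of_int (\<tau> l (snd e)) * of_int (\<tau> l' (snd e)))) else 0)"
        using N by (simp add: a' coupling_def coupled_spins_def power2_eq_square)
    qed
    also have "\<dots> = ?sc * (\<beta>\<^sup>2 / real N) * (\<Sum>e\<in>{e \<in> pairs N. fst e = m \<or> snd e = m}.
         ((of_int (\<tau> l (fst e)) * of_int (\<tau> l' (fst e))) * (of_int (\<tau> l (snd e)) * of_int (\<tau> l' (snd e)))))"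
      by (subst sum.inter_filter[symmetric]) (simp_all add: sum_distrib_left)
    also have "\<dots> = ?sc * (\<beta>\<^sup>2 / real N) * (x l * x l' * R l l')"
      by (subst sum_pairs_containing[OF m, of "\<lambda>i. of_int (\<tau> l i) * of_int (\<tau> l' i)"]) (simp add: x_def R_def)
    finally show ?thesis
      using q_nonneg N by (simp add: a' coupling_def coupled_spins_def x_def power2_eq_square field_simps)
  qed
  have "(\<Sum>e\<in>insert (0,0) (pairs N). a' e * coupling N m \<theta> e *
        replica_diff (coupled_spins m e) (Suc n) (replica_diff (coupled_spins m e) n f) \<tau>)
     = (\<Sum>l\<in>?L. \<Sum>l'\<in>?L'. f \<tau> * w l l' * (\<Sum>e\<in>insert (0,0) (pairs N). a' e * coupling N m \<theta> e * (coupled_spins m e (\<tau> l) * coupled_spins m e (\<tau> l'))))"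
    unfolding rd2 sum_distrib_left
    by (subst sum.swap, rule sum.cong[OF refl], subst sum.swap) (simp add: mult_ac)
  also have "\<dots> = (\<Sum>l\<in>?L. \<Sum>l'\<in>?L'. f \<tau> * w l l' * (?sc * \<beta>\<^sup>2 * (x l * x l') * (R l l' / real N - q)))"
    by (simp only: cov)
  finally have 1: "(\<Sum>e\<in>insert (0,0) (pairs N). a' e * coupling N m \<theta> e *
        replica_diff (coupled_spins m e) (Suc n) (replica_diff (coupled_spins m e) n f) \<tau>)
     = (\<Sum>l\<in>?L. \<Sum>l'\<in>?L'. f \<tau> * w l l' * (?sc * \<beta>\<^sup>2 * (x l * x l') * (R l l' / real N - q)))" .
  \<comment> \<open>On the diagonal \<open>l' = l \<le> Suc n\<close>, hence
    \<open>contrast (Suc n) l' = 1\<close>, and the double weight reduces to the single weight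
    \<open>contrast n l\<close> found in the quadratic term.\<close>
  have "(\<Sum>l'\<in>?L'. f \<tau> * w l l' * (?sc * \<beta>\<^sup>2 * (x l * x l') * (if l = l' then p - q else 0)))
     = f \<tau> * (contrast n l * (?sc * \<beta>\<^sup>2 * (p - q) * (x l)\<^sup>2))" if "l \<in> ?L" for l
  proof -
    have "(\<Sum>l'\<in>?L'. f \<tau> * w l l' * (?sc * \<beta>\<^sup>2 * (x l * x l') * (if l = l' then p - q else 0)))
      = (\<Sum>l'\<in>?L'. if l' = l then f \<tau> * w l l' * (?sc * \<beta>\<^sup>2 * (x l * x l') * (p - q)) else 0)"
      by (intro sum.cong) auto
    also have "\<dots> = f \<tau> * w l l * (?sc * \<beta>\<^sup>2 * (x l * x l) * (p - q))"
      using that by (subst sum.delta) auto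
    finally show ?thesis using that by (simp add: w_def contrast_def power2_eq_square mult_ac)
  qed
  note diag = this
  have 2: "replica_diff K' n f \<tau> = - (\<Sum>l\<in>?L. \<Sum>l'\<in>?L'. f \<tau> * w l l' * (?sc * \<beta>\<^sup>2 * (x l * x l') * (if l = l' then p - q else 0)))"
  proof -
    have "replica_diff K' n f \<tau> = (\<Sum>l\<in>?L. - (f \<tau> * (contrast n l * (?sc * \<beta>\<^sup>2 * (p - q) * (x l)\<^sup>2))))"
      unfolding replica_diff_contrast sum_distrib_left by (intro sum.cong refl) (simp add: K' x_def)
    also have "\<dots> = - (\<Sum>l\<in>?L. \<Sum>l'\<in>?L'. f \<tau> * w l l' * (?sc * \<beta>\<^sup>2 * (x l * x l') * (if l = l' then p - q else 0)))"
      unfolding sum_negf by (intro arg_cong[where f = uminus] sum.cong refl diag[symmetric])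
    finally show ?thesis .
  qed
  have "(\<Sum>l\<in>?L. \<Sum>l'\<in>?L'. f \<tau> * w l l' * (?sc * \<beta>\<^sup>2 * (x l * x l') * (R l l' / real N - q)))
     - (\<Sum>l\<in>?L. \<Sum>l'\<in>?L'. f \<tau> * w l l' * (?sc * \<beta>\<^sup>2 * (x l * x l') * (if l = l' then p - q else 0)))
    = (\<Sum>l\<in>?L. \<Sum>l'\<in>?L'. ?sc * (\<beta>\<^sup>2 / sqrt (real N)) * (f \<tau> * (w l l' * (x l * x l') * cavity_overlap N m l l' \<tau>)))"
    unfolding sum_subtractf[symmetric]
  proof (intro sum.cong refl)
    fix l l'
    have "cavity_overlap N m l l' \<tau> / sqrt (real N) = R l l' / real N - overlap_const l l'"
      using N by (simp add: cavity_overlap_def R_def diff_divide_distrib)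
    then have "cavity_overlap N m l l' \<tau> = sqrt (real N) * (R l l' / real N - overlap_const l l')"
      using N by (simp add: field_simps)
    then show "f \<tau> * w l l' * (?sc * \<beta>\<^sup>2 * (x l * x l') * (R l l' / real N - q))
       - f \<tau> * w l l' * (?sc * \<beta>\<^sup>2 * (x l * x l') * (if l = l' then p - q else 0))
      = ?sc * (\<beta>\<^sup>2 / sqrt (real N)) * (f \<tau> * (w l l' * (x l * x l') * cavity_overlap N m l l' \<tau>))"
      using N by (simp add: overlap_const_def) (simp add: algebra_simps)
  qed
  also have "\<dots> = ?sc * (\<beta>\<^sup>2 / sqrt (real N)) * (f \<tau> * drift N m n \<tau>)"
    unfolding drift_def w_def x_def by (simp only: sum_distrib_left)
  finally show ?thesis unfolding 1 2 by simp
qed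

lemma ev_has_deriv:
  assumes m: "m \<in> {1..N}" and f: "dep n f"
  shows "((\<lambda>\<theta>. ev N m \<theta> n f) has_real_derivative
    sin \<theta> * cos \<theta> * (\<beta>\<^sup>2 / sqrt (real N)) * ev N m \<theta> (Suc (Suc n)) (\<lambda>\<tau>. f \<tau> * drift N m n \<tau>)) (at \<theta>)"
proof -
  define a' where "a' = (\<lambda>\<theta> e. if e = (0::nat,0::nat) then - sin \<theta> * (\<beta> * sqrt q)
     else if fst e = m \<or> snd e = m then cos \<theta> * (\<beta> / sqrt (real N)) else 0)"
  define K' where "K' = (\<lambda>\<theta>. \<lambda>\<sigma>::nat \<Rightarrow> int. - 2 * cos \<theta> * sin \<theta> * (\<beta>\<^sup>2 / 2 * (p - q) * (of_int (\<sigma> m))\<^sup>2))"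
  \<comment> \<open>A sum of bounds for the field, the interactions of \<open>m\<close> and the
    quadratic term, so that one constant dominates all derivatives at every angle.\<close>
  define b where "b = \<beta> * sqrt q + \<beta> / sqrt (real N) + \<bar>\<beta>\<^sup>2 / 2 * (p - q)\<bar> * (2 * (real S)\<^sup>2)"
  let ?E = "insert (0,0) (pairs N)"
  have pos: "\<beta> * sqrt q \<ge> 0" "\<beta> / sqrt (real N) \<ge> 0" "\<bar>\<beta>\<^sup>2 / 2 * (p - q)\<bar> * (2 * (real S)\<^sup>2) \<ge> 0"
    using \<beta>_pos q_nonneg by auto
  have "((\<lambda>\<theta>. ev N m \<theta> n f) has_real_derivative
    (\<Sum>e\<in>?E. a' \<theta> e * coupling N m \<theta> e * ev N m \<theta> (Suc (Suc n)) (replica_diff (coupled_spins m e) (Suc n) (replica_diff (coupled_spins m e) n f)))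
    + ev N m \<theta> (Suc n) (replica_diff (K' \<theta>) n f)) (at \<theta>)"
    unfolding ev_def
  proof (rule quenched_has_deriv[OF _ finite_configs configs_nonempty f, where b = b])
    show "((\<lambda>\<theta>. coupling N m \<theta> e) has_real_derivative a' \<theta> e) (at \<theta>)" for \<theta> e
      unfolding coupling_def a'_def using DERIV_cmult_right[OF DERIV_cos] DERIV_cmult_right[OF DERIV_sin]
      by (cases "e = (0,0)"; cases "fst e = m \<or> snd e = m") (simp_all only: if_True if_False simp_thms DERIV_const)
    show "((\<lambda>\<theta>. external N m \<theta> \<sigma>) has_real_derivative K' \<theta> \<sigma>) (at \<theta>)" for \<theta> \<sigma>
      unfolding external_def K'_def by (auto intro!: derivative_eq_intros)
    show "\<bar>a' \<theta> e\<bar> \<le> b" for \<theta> e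
    proof -
      have "\<bar>- sin \<theta> * (\<beta> * sqrt q)\<bar> \<le> \<beta> * sqrt q" "\<bar>cos \<theta> * (\<beta> / sqrt (real N))\<bar> \<le> \<beta> / sqrt (real N)"
        unfolding abs_mult[of "- sin \<theta>"] abs_mult[of "cos \<theta>"] abs_minus_cancel abs_of_nonneg[OF pos(1)] abs_of_nonneg[OF pos(2)]
        by (intro mult_left_le_one_le pos abs_sin_le_one abs_cos_le_one abs_ge_zero)+
      with pos have "\<bar>a' \<theta> e\<bar> \<le> \<beta> * sqrt q + \<beta> / sqrt (real N)"
        unfolding a'_def by (simp only: abs_zero split: if_split) linarith
      then show ?thesis using pos(3) unfolding b_def by linarith
    qed
    show "\<bar>K' \<theta> \<sigma>\<bar> \<le> b" if "\<sigma> \<in> configs S N" for \<theta> \<sigma>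
    proof -
      have s: "(real_of_int (\<sigma> m))\<^sup>2 \<le> (real S)\<^sup>2"
        using power_mono[OF abs_spin_le[OF configs_spin[OF that m]], of 2] by simp
      have "\<bar>cos \<theta> * sin \<theta>\<bar> \<le> 1"
        using mult_mono[OF abs_cos_le_one[of \<theta>] abs_sin_le_one[of \<theta>]] by (simp add: abs_mult)
      then have "2 * (\<bar>cos \<theta> * sin \<theta>\<bar> * (\<bar>\<beta>\<^sup>2 / 2 * (p - q)\<bar> * (real_of_int (\<sigma> m))\<^sup>2))
          \<le> 2 * (1 * (\<bar>\<beta>\<^sup>2 / 2 * (p - q)\<bar> * (real S)\<^sup>2))"
        by (intro mult_mono s) auto
      moreover have "\<bar>K' \<theta> \<sigma>\<bar> = 2 * (\<bar>cos \<theta> * sin \<theta>\<bar> * (\<bar>\<beta>\<^sup>2 / 2 * (p - q)\<bar> * (real_of_int (\<sigma> m))\<^sup>2))"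
        unfolding K'_def by (simp add: abs_mult)
      ultimately have "\<bar>K' \<theta> \<sigma>\<bar> \<le> \<bar>\<beta>\<^sup>2 / 2 * (p - q)\<bar> * (2 * (real S)\<^sup>2)"
        by (simp only: mult.commute mult.left_commute mult_1)
      then show ?thesis using pos(1,2) unfolding b_def by linarith
    qed
  qed auto
  also have "ev N m \<theta> (Suc n) (replica_diff (K' \<theta>) n f) = ev N m \<theta> (Suc (Suc n)) (replica_diff (K' \<theta>) n f)"
    by (rule ev_more_replicas[symmetric]) (use f in auto)
  also have "(\<Sum>e\<in>?E. a' \<theta> e * coupling N m \<theta> e * ev N m \<theta> (Suc (Suc n)) (replica_diff (coupled_spins m e) (Suc n) (replica_diff (coupled_spins m e) n f))) + \<dots>
    = ev N m \<theta> (Suc (Suc n)) (\<lambda>\<tau>. (\<Sum>e\<in>?E. a' \<theta> e * coupling N m \<theta> e *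
        replica_diff (coupled_spins m e) (Suc n) (replica_diff (coupled_spins m e) n f) \<tau>) + replica_diff (K' \<theta>) n f \<tau>)"
    unfolding ev_add ev_sum ev_cmult ..
  also have "\<dots> = ev N m \<theta> (Suc (Suc n)) (\<lambda>\<tau>. sin \<theta> * cos \<theta> * (\<beta>\<^sup>2 / sqrt (real N)) * (f \<tau> * drift N m n \<tau>))"
    by (simp only: drift_identity[OF m fun_cong[OF a'_def] fun_cong[OF K'_def]])
  finally show ?thesis unfolding ev_cmult .
qed

end

section \<open>Factorisation over a product state space and the two ends of the path\<close>

lemma avg_product:
  assumes bij: "bij_betw (\<lambda>(x, y). b x y) (A \<times> B) C"
    and G: "\<And>x y. x \<in> A \<Longrightarrow> y \<in> B \<Longrightarrow> G (b x y) = G1 x * G2 y"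
    and f: "\<And>x y. x \<in> PiE {1..n} (\<lambda>_. A) \<Longrightarrow> y \<in> PiE {1..n} (\<lambda>_. B) \<Longrightarrow>
      f (\<lambda>k\<in>{1..n}. b (x k) (y k)) = \<phi> x * F y"
  shows "avg C G n f = avg A G1 n \<phi> * avg B G2 n F"
proof -
  let ?PA = "PiE {1..n} (\<lambda>_. A)" and ?PB = "PiE {1..n} (\<lambda>_. B)" and ?PC = "PiE {1..n} (\<lambda>_. C)"
  define \<Phi> where "\<Phi> = (\<lambda>(x, y). \<lambda>k\<in>{1..n}. b (x k) (y k))"
  have bC: "b x y \<in> C" if "x \<in> A" "y \<in> B" for x y
    using bij that by (auto simp: bij_betw_def)
  have bi: "x = x' \<and> y = y'" if "b x y = b x' y'" "x \<in> A" "y \<in> B" "x' \<in> A" "y' \<in> B" for x y x' y'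
    using bij that by (auto simp: bij_betw_def inj_on_def)
  have bs: "\<exists>x y. x \<in> A \<and> y \<in> B \<and> c = b x y" if "c \<in> C" for c
    using bij that unfolding bij_betw_def by force
  have "bij_betw \<Phi> (?PA \<times> ?PB) ?PC"
    unfolding bij_betw_def
  proof (intro conjI inj_onI equalityI subsetI)
    fix u v assume uv: "u \<in> ?PA \<times> ?PB" "v \<in> ?PA \<times> ?PB" "\<Phi> u = \<Phi> v"
    obtain x y x' y' where u: "u = (x, y)" "v = (x', y')" by (cases u, cases v)
    have "x k = x' k \<and> y k = y' k" for k
    proof (cases "k \<in> {1..n}")
      case True
      then have "b (x k) (y k) = b (x' k) (y' k)"
        using fun_cong[OF uv(3), of k] by (simp add: u \<Phi>_def)
      then show ?thesis using bi uv(1,2) True by (auto simp: u PiE_iff)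
    next
      case False
      then show ?thesis using uv(1,2) by (auto simp: u PiE_iff extensional_def)
    qed
    then show "u = v" by (auto simp: u fun_eq_iff)
  next
    fix \<tau> assume "\<tau> \<in> \<Phi> ` (?PA \<times> ?PB)"
    then show "\<tau> \<in> ?PC" using bC by (auto simp: \<Phi>_def PiE_iff)
  next
    fix \<tau> assume \<tau>: "\<tau> \<in> ?PC"
    then have "\<forall>k. \<exists>x y. k \<in> {1..n} \<longrightarrow> x \<in> A \<and> y \<in> B \<and> \<tau> k = b x y"
      using bs by (metis PiE_mem)
    then obtain x y where xy: "\<And>k. k \<in> {1..n} \<Longrightarrow> x k \<in> A \<and> y k \<in> B \<and> \<tau> k = b (x k) (y k)"
      by metis
    then have "\<tau> = \<Phi> (restrict x {1..n}, restrict y {1..n})"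
      using \<tau> by (auto simp: \<Phi>_def fun_eq_iff PiE_iff extensional_def)
    moreover have "(restrict x {1..n}, restrict y {1..n}) \<in> ?PA \<times> ?PB" using xy by auto
    ultimately show "\<tau> \<in> \<Phi> ` (?PA \<times> ?PB)" by (rule image_eqI)
  qed
  then have "avg C G n f = (\<Sum>u\<in>?PA \<times> ?PB. f (\<Phi> u) * (\<Prod>k\<in>{1..n}. G (\<Phi> u k)))"
    unfolding avg_def by (rule sum.reindex_bij_betw[symmetric])
  also have "\<dots> = (\<Sum>(x, y)\<in>?PA \<times> ?PB. (\<phi> x * (\<Prod>k\<in>{1..n}. G1 (x k))) * (F y * (\<Prod>k\<in>{1..n}. G2 (y k))))"
  proof (intro sum.cong refl, clarify)
    fix x y assume xy: "x \<in> ?PA" "y \<in> ?PB"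
    have "(\<Prod>k\<in>{1..n}. G (\<Phi> (x, y) k)) = (\<Prod>k\<in>{1..n}. G1 (x k) * G2 (y k))"
      by (intro prod.cong refl) (use xy G in \<open>auto simp: \<Phi>_def PiE_iff\<close>)
    then show "f (\<Phi> (x, y)) * (\<Prod>k\<in>{1..n}. G (\<Phi> (x, y) k))
       = \<phi> x * (\<Prod>k\<in>{1..n}. G1 (x k)) * (F y * (\<Prod>k\<in>{1..n}. G2 (y k)))"
      using f[OF xy] by (simp add: \<Phi>_def prod.distrib)
  qed
  also have "\<dots> = avg A G1 n \<phi> * avg B G2 n F"
    unfolding avg_def sum_product by (simp add: sum.cartesian_product)
  finally show ?thesis .
qed

lemma boltzmann_product:
  assumes bij: "bij_betw (\<lambda>(x, y). b x y) (A \<times> B) C"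
    and H: "\<And>x y. x \<in> A \<Longrightarrow> y \<in> B \<Longrightarrow> H (b x y) = h1 x + h2 y"
    and "x \<in> A" "y \<in> B"
  shows "boltzmann C H (b x y) = boltzmann A h1 x * boltzmann B h2 y"
proof -
  have "(\<Sum>c\<in>C. exp (H c)) = (\<Sum>(x, y)\<in>A \<times> B. exp (H (b x y)))"
    using sum.reindex_bij_betw[OF bij, of "\<lambda>c. exp (H c)"] by (simp add: case_prod_beta)
  also have "\<dots> = (\<Sum>(x, y)\<in>A \<times> B. exp (h1 x) * exp (h2 y))"
    by (intro sum.cong refl) (auto simp: H exp_add)
  also have "\<dots> = (\<Sum>x\<in>A. exp (h1 x)) * (\<Sum>y\<in>B. exp (h2 y))"
    unfolding sum_product by (simp add: sum.cartesian_product)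
  finally show ?thesis using assms by (simp add: boltzmann_def H exp_add)
qed

lemma configs_split_bij:
  assumes m: "m \<in> {1..N}"
  shows "bij_betw (\<lambda>(s, y). y(m := s)) (spins S \<times> PiE ({1..N} - {m}) (\<lambda>_. spins S)) (configs S N)"
\<comment> \<open>The inverse resets site \<open>m\<close> to \<open>undefined\<close>, as
  membership in the extensional functions on the remaining sites requires.\<close>
proof (rule bij_betwI[where g = "\<lambda>\<sigma>. (\<sigma> m, \<sigma>(m := undefined))"])
  have ins: "{1..N} = insert m ({1..N} - {m})" using m by auto
  show "(\<lambda>(s, y). y(m := s)) \<in> spins S \<times> PiE ({1..N} - {m}) (\<lambda>_. spins S) \<rightarrow> configs S N"
    unfolding configs_def by (subst (2) ins) (auto simp del: insert_Diff_single intro!: PiE_fun_upd)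
  show "(\<lambda>\<sigma>. (\<sigma> m, \<sigma>(m := undefined))) \<in> configs S N \<rightarrow> spins S \<times> PiE ({1..N} - {m}) (\<lambda>_. spins S)"
  proof (intro funcsetI SigmaI)
    fix \<sigma> assume \<sigma>: "\<sigma> \<in> configs S N"
    show "\<sigma> m \<in> spins S" by (rule configs_spin[OF \<sigma> m])
    show "\<sigma>(m := undefined) \<in> PiE ({1..N} - {m}) (\<lambda>_. spins S)"
      by (rule fun_upd_in_PiE) (use \<sigma> ins in \<open>auto simp: configs_def\<close>)
  qed
  show "(\<lambda>\<sigma>. (\<sigma> m, \<sigma>(m := undefined))) ((\<lambda>(s, y). y(m := s)) u) = u"
    if "u \<in> spins S \<times> PiE ({1..N} - {m}) (\<lambda>_. spins S)" for u
  proof -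
    have "snd u \<in> PiE ({1..N} - {m}) (\<lambda>_. spins S)" using that by (simp only: mem_Times_iff)
    then have "snd u m = undefined" by (rule PiE_arb) simp
    then show ?thesis by (cases u) (simp add: fun_upd_idem)
  qed
  show "(\<lambda>(s, y). y(m := s)) ((\<lambda>\<sigma>. (\<sigma> m, \<sigma>(m := undefined))) \<sigma>) = \<sigma>" if "\<sigma> \<in> configs S N" for \<sigma>
    by simp
qed

definition avoids :: "nat \<Rightarrow> ((nat \<Rightarrow> nat \<Rightarrow> int) \<Rightarrow> 'd) \<Rightarrow> bool" where
  "avoids m F \<longleftrightarrow> (\<forall>\<tau> \<tau>'. (\<forall>k i. i \<noteq> m \<longrightarrow> \<tau> k i = \<tau>' k i) \<longrightarrow> F \<tau> = F \<tau>')"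

lemma avoids_const [intro]: "avoids m (\<lambda>_. c)"
  by (simp add: avoids_def)

lemma avoids_mult [intro]: "avoids m f \<Longrightarrow> avoids m g \<Longrightarrow> avoids m (\<lambda>\<tau>. f \<tau> * g \<tau>)"
  unfolding avoids_def by metis

lemma avoids_power [intro]: "avoids m f \<Longrightarrow> avoids m (\<lambda>\<tau>. f \<tau> ^ k)"
  unfolding avoids_def by metis

lemma avoids_prod [intro]: "(\<And>i. i \<in> I \<Longrightarrow> avoids m (f i)) \<Longrightarrow> avoids m (\<lambda>\<tau>. \<Prod>i\<in>I. f i \<tau>)"
  unfolding avoids_def by (auto intro!: prod.cong)

context sk_model
begin

lemma ev_avg_eq_integral:
  "ev N m \<theta> n f = (\<integral>g. avg (configs S N) (boltzmann (configs S N)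
     (gaussian_energy (insert (0,0) (pairs N)) (coupling N m \<theta>) (coupled_spins m) (external N m \<theta>) g)) n f
     \<partial>gauss (insert (0,0) (pairs N)))"
  unfolding ev_def quenched_def ..

text \<open>At both ends of the path the field coordinate separates from the interactions: at
  \<open>\<theta> = pi / 2\<close> its factor is trivial, at \<open>\<theta> = 0\<close> it carries
  the whole dependence on site \<open>m\<close>.\<close>

lemma ev_iterated_integral:
  assumes "integrable (gauss (insert (0,0) (pairs N))) (h :: _ \<Rightarrow> real)"
    and "\<And>x y. h (x((0,0) := y)) = u y * v x"
  shows "(\<integral>g. h g \<partial>gauss (insert (0,0) (pairs N))) = (\<integral>y. u y \<partial>std_normal_measure) * (\<integral>x. v x \<partial>gauss (pairs N))"
proof -
  interpret product_sigma_finite "\<lambda>_. std_normal_measure" by (rule product_sigma_finite_std_normal)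
  show ?thesis
    by (subst product_integral_insert[OF _ _ assms(1)]) (simp_all add: assms(2))
qed

text \<open>Here \<open>cos\<close> vanishes and \<open>sin\<close> is 1, so field and quadratic
  term disappear and the original Hamiltonian is left. The right-hand side no longer mentions
  \<open>m\<close>.\<close>

lemma ev_end:
  assumes m: "m \<in> {1..N}"
  shows "ev N m (pi / 2) n f = (\<integral>g. avg (configs S N) (gibbs S N \<beta> D hf g) n f \<partial>disorder_measure N)"
proof -
  let ?H = "\<lambda>g. gaussian_energy (insert (0,0) (pairs N)) (coupling N m (pi/2)) (coupled_spins m) (external N m (pi/2)) g"
  have H: "?H (x((0,0) := y)) = hamiltonian N \<beta> D hf x" for x y
  proof
    fix \<sigma> :: "nat \<Rightarrow> int"
    have P: "pairs N = Sigma {1..N} (\<lambda>i. {i<..N})" by (auto simp: pairs_def)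
    have "(\<Sum>e\<in>pairs N. coupling N m (pi/2) e * (x((0,0) := y)) e * coupled_spins m e \<sigma>)
      = (\<Sum>e\<in>pairs N. \<beta> / sqrt (real N) * (x e * of_int (\<sigma> (fst e)) * of_int (\<sigma> (snd e))))"
    proof (intro sum.cong refl)
      fix e assume "e \<in> pairs N"
      then have "e \<noteq> (0,0)" by auto
      then show "coupling N m (pi/2) e * (x((0,0) := y)) e * coupled_spins m e \<sigma> =
         \<beta> / sqrt (real N) * (x e * of_int (\<sigma> (fst e)) * of_int (\<sigma> (snd e)))"
        by (simp add: coupling_def coupled_spins_def)
    qed
    also have "\<dots> = \<beta> / sqrt (real N) * (\<Sum>i\<in>{1..N}. \<Sum>j\<in>{i<..N}. x (i,j) * of_int (\<sigma> i) * of_int (\<sigma> j))"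
      unfolding P sum_distrib_left[symmetric] by (subst sum.Sigma) (auto simp: case_prod_beta)
    finally show "?H (x((0,0) := y)) \<sigma> = hamiltonian N \<beta> D hf x \<sigma>"
      by (simp add: gaussian_energy_def coupling_def external_def hamiltonian_def)
  qed
  have G: "boltzmann (configs S N) (hamiltonian N \<beta> D hf x) = gibbs S N \<beta> D hf x" for x
    by (simp add: boltzmann_def gibbs_def fun_eq_iff)
  have "ev N m (pi / 2) n f = (\<integral>y. 1 \<partial>std_normal_measure) * (\<integral>x. avg (configs S N) (gibbs S N \<beta> D hf x) n f \<partial>gauss (pairs N))"
    unfolding ev_avg_eq_integral
    by (rule ev_iterated_integral[OF integrable_avg_boltzmann]) (simp_all only: H G finite_configs configs_nonempty mult_1 not_False_eq_True)
  then show ?thesis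
    using prob_space.prob_space[OF prob_space_std_normal] by (simp add: disorder_measure_def pairs_def)
qed

definition site_energy :: "real \<Rightarrow> int \<Rightarrow> real" where
  "site_energy \<eta> s = \<beta> * sqrt q * \<eta> * of_int s + hf * of_int s + (D + \<beta>\<^sup>2 / 2 * (p - q)) * (of_int s)\<^sup>2"

text \<open>All replicas share one field \<open>\<eta>\<close>: they are independent given
  \<open>\<eta>\<close> and correlated after integration over it.\<close>

definition site_avg :: "nat \<Rightarrow> ((nat \<Rightarrow> int) \<Rightarrow> real) \<Rightarrow> real" where
  "site_avg n \<phi> = (\<integral>\<eta>. avg (spins S) (boltzmann (spins S) (site_energy \<eta>)) n \<phi> \<partial>std_normal_measure)"

text \<open>Here \<open>sin\<close> removes every coupling that touches \<open>m\<close>, so the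
  energy splits into a one-site part driven by the field and a part for the other sites, with
  independent disorder.\<close>

lemma ev_start:
  assumes m: "m \<in> {1..N}" and \<phi>: "dep n \<phi>" and F: "avoids m F"
  shows "ev N m 0 n (\<lambda>\<tau>. \<phi> (\<lambda>k. \<tau> k m) * F \<tau>) = site_avg n \<phi> * ev N m 0 n F"
proof -
  let ?B = "PiE ({1..N} - {m}) (\<lambda>_. spins S)"
  let ?H = "\<lambda>g. gaussian_energy (insert (0,0) (pairs N)) (coupling N m 0) (coupled_spins m) (external N m 0) g"
  let ?P = "{e \<in> pairs N. \<not> (fst e = m \<or> snd e = m)}"
  define h2 where "h2 = (\<lambda>g \<sigma>. (\<Sum>e\<in>?P. \<beta> / sqrt (real N) * g e * (of_int (\<sigma> (fst e)) * of_int (\<sigma> (snd e))))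
     + D * (\<Sum>i\<in>{1..N}-{m}. (of_int (\<sigma> i))\<^sup>2) + hf * (\<Sum>i\<in>{1..N}-{m}. real_of_int (\<sigma> i)))"
  have H: "?H (x((0,0) := y)) (\<sigma>(m := s)) = site_energy y s + h2 x \<sigma>" for x y \<sigma> s
  proof -
    have "(\<Sum>e\<in>pairs N. coupling N m 0 e * (x((0,0) := y)) e * coupled_spins m e (\<sigma>(m := s)))
      = (\<Sum>e\<in>?P. \<beta> / sqrt (real N) * x e * (of_int (\<sigma> (fst e)) * of_int (\<sigma> (snd e))))"
    proof (intro sum.mono_neutral_cong_right ballI)
      fix e assume "e \<in> pairs N - ?P"
      then have "e \<noteq> (0,0)" "fst e = m \<or> snd e = m" by auto
      then show "coupling N m 0 e * (x((0,0) := y)) e * coupled_spins m e (\<sigma>(m := s)) = 0"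
        by (simp add: coupling_def)
    next
      fix e assume e: "e \<in> ?P"
      then have "e \<noteq> (0,0)" by auto
      with e show "coupling N m 0 e * (x((0,0) := y)) e * coupled_spins m e (\<sigma>(m := s))
         = \<beta> / sqrt (real N) * x e * (of_int (\<sigma> (fst e)) * of_int (\<sigma> (snd e)))"
        by (auto simp: coupling_def coupled_spins_def)
    qed auto
    moreover have "(\<Sum>i\<in>{1..N}. (real_of_int ((\<sigma>(m := s)) i))\<^sup>2) = (of_int s)\<^sup>2 + (\<Sum>i\<in>{1..N}-{m}. (of_int (\<sigma> i))\<^sup>2)"
      "(\<Sum>i\<in>{1..N}. real_of_int ((\<sigma>(m := s)) i)) = of_int s + (\<Sum>i\<in>{1..N}-{m}. of_int (\<sigma> i))"
      using m by (subst sum.remove[of _ m]; auto intro!: sum.cong)+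
    ultimately show ?thesis
      by (simp add: gaussian_energy_def external_def site_energy_def h2_def coupling_def coupled_spins_def algebra_simps)
  qed
  have fact: "avg (configs S N) (boltzmann (configs S N) (?H (x((0,0) := y)))) n (\<lambda>\<tau>. \<psi> (\<lambda>k. \<tau> k m) * F \<tau>)
     = avg (spins S) (boltzmann (spins S) (site_energy y)) n \<psi> * avg ?B (boltzmann ?B (h2 x)) n F"
    if \<psi>: "dep n \<psi>" for x y \<psi>
  proof (rule avg_product[OF configs_split_bij[OF m]])
    show "boltzmann (configs S N) (?H (x((0,0) := y))) (\<sigma>(m := s)) = boltzmann (spins S) (site_energy y) s * boltzmann ?B (h2 x) \<sigma>"
      if "s \<in> spins S" "\<sigma> \<in> ?B" for s \<sigma>
      by (rule boltzmann_product[where b = "\<lambda>s \<sigma>. \<sigma>(m := s)" and H = "?H (x((0,0) := y))", OF configs_split_bij[OF m] _ that]) (rule H)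
    fix u v assume uv: "u \<in> PiE {1..n} (\<lambda>_. spins S)" "v \<in> PiE {1..n} (\<lambda>_. ?B)"
    have "\<psi> (\<lambda>k. (\<lambda>k\<in>{1..n}. (v k)(m := u k)) k m) = \<psi> u"
      by (rule depD[OF \<psi>]) simp
    moreover have "(\<lambda>k\<in>{1..n}. (v k)(m := u k)) k i = v k i" if "i \<noteq> m" for k i
      using that uv(2) by (cases "k \<in> {1..n}") (auto simp: PiE_iff extensional_def)
    then have "F (\<lambda>k\<in>{1..n}. (v k)(m := u k)) = F v"
      using F unfolding avoids_def by blast
    ultimately show "\<psi> (\<lambda>k. (\<lambda>k\<in>{1..n}. (v k)(m := u k)) k m) * F (\<lambda>k\<in>{1..n}. (v k)(m := u k)) = \<psi> u * F v"
      by simp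
  qed
  have int: "integrable (gauss (insert (0,0) (pairs N))) (\<lambda>g. avg (configs S N) (boltzmann (configs S N) (?H g)) n f)" for f
    by (rule integrable_avg_boltzmann) auto
  have "ev N m 0 n (\<lambda>\<tau>. \<psi> (\<lambda>k. \<tau> k m) * F \<tau>) = site_avg n \<psi> * (\<integral>x. avg ?B (boltzmann ?B (h2 x)) n F \<partial>gauss (pairs N))"
    if "dep n \<psi>" for \<psi>
    unfolding ev_avg_eq_integral site_avg_def by (rule ev_iterated_integral[OF int fact[OF that]])
  \<comment> \<open>The choice of the constant 1 identifies the second factor as the average of
    \<open>F\<close> itself.\<close>
  from this[OF \<phi>] this[of "\<lambda>_. 1"] show ?thesis
    using prob_space.prob_space[OF prob_space_std_normal] by (simp add: dep_const site_avg_def avg_const boltzmann_sum)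
qed

lemma site_avg_add: "site_avg n (\<lambda>s. \<phi> s + \<psi> s) = site_avg n \<phi> + site_avg n \<psi>"
  and site_avg_diff: "site_avg n (\<lambda>s. \<phi> s - \<psi> s) = site_avg n \<phi> - site_avg n \<psi>"
  and site_avg_cmult: "site_avg n (\<lambda>s. c * \<phi> s) = c * site_avg n \<phi>"
  and site_avg_const: "site_avg n (\<lambda>_. c) = c"
  and site_avg_reindex: "inj_on \<pi> {1..n'} \<Longrightarrow> \<pi> ` {1..n'} \<subseteq> {1..n} \<Longrightarrow> dep n' \<phi> \<Longrightarrow>
      site_avg n (\<lambda>s. \<phi> (\<lambda>k. s (\<pi> k))) = site_avg n' \<phi>"
proof -
  have e: "gaussian_energy {()} (\<lambda>_. 1) (\<lambda>_ s. \<beta> * sqrt q * of_int s)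
     (\<lambda>s. hf * of_int s + (D + \<beta>\<^sup>2 / 2 * (p - q)) * (of_int s)\<^sup>2) (\<lambda>_. \<eta>) = site_energy \<eta>" for \<eta>
    by (simp add: gaussian_energy_def site_energy_def fun_eq_iff algebra_simps)
  have m: "(\<lambda>\<eta>. avg (spins S) (boltzmann (spins S) (site_energy \<eta>)) n \<phi>) \<in> borel_measurable borel" for n \<phi>
    unfolding avg_def boltzmann_def site_energy_def by measurable
  have int: "integrable std_normal_measure (\<lambda>\<eta>. avg (spins S) (boltzmann (spins S) (site_energy \<eta>)) n \<phi>)" for n \<phi>
    by (rule integrable_std_normal_bounded[OF m avg_boltzmann_abs_le]) auto
  show "site_avg n (\<lambda>s. \<phi> s + \<psi> s) = site_avg n \<phi> + site_avg n \<psi>"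
    "site_avg n (\<lambda>s. \<phi> s - \<psi> s) = site_avg n \<phi> - site_avg n \<psi>"
    "site_avg n (\<lambda>s. c * \<phi> s) = c * site_avg n \<phi>"
    unfolding site_avg_def avg_add avg_diff avg_cmult using int by simp_all
  show "site_avg n (\<lambda>_. c) = c"
    using prob_space.prob_space[OF prob_space_std_normal] by (simp add: site_avg_def avg_const boltzmann_sum)
  show "site_avg n (\<lambda>s. \<phi> (\<lambda>k. s (\<pi> k))) = site_avg n' \<phi>"
    if "inj_on \<pi> {1..n'}" "\<pi> ` {1..n'} \<subseteq> {1..n}" "dep n' \<phi>"
    unfolding site_avg_def
    by (intro Bochner_Integration.integral_cong refl avg_reindex[OF finite_spins boltzmann_sum that]) auto
qed

lemma eta_avg_boltzmann:
  "eta_avg S \<beta> D hf p q \<eta> \<phi> = (\<Sum>s\<in>spins S. \<phi> (of_int s) * boltzmann (spins S) (site_energy \<eta>) s)"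
  by (simp add: eta_avg_def boltzmann_def site_energy_def wgt_def sum_divide_distrib)

lemma site_avg_prod:
  "site_avg n (\<lambda>s. \<Prod>k\<in>{1..n}. h k (of_int (s k)))
    = (\<integral>\<eta>. (\<Prod>k\<in>{1..n}. eta_avg S \<beta> D hf p q \<eta> (h k)) \<partial>std_normal_measure)"
  unfolding site_avg_def eta_avg_boltzmann
  by (simp only: avg_prod_coords[OF finite_spins, where h = "\<lambda>k s. h k (of_int s)"])

end

section \<open>Elementary inequalities and a priori bounds along the path\<close>

lemma sum_abs_contrast: "(\<Sum>l\<in>{1..Suc n}. \<bar>contrast n l\<bar>) = 2 * real n"
proof -
  have "{1..Suc n} = insert (Suc n) {1..n}" by auto
  then show ?thesis by (simp add: contrast_def)
qed

lemma abs_power_diff_le: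
  fixes a b M :: real
  assumes "\<bar>a\<bar> \<le> M" "\<bar>b\<bar> \<le> M"
  shows "\<bar>a ^ Suc n - b ^ Suc n\<bar> \<le> real (Suc n) * \<bar>a - b\<bar> * M ^ n"
proof (induction n)
  case (Suc n)
  have M: "M \<ge> 0" using assms by linarith
  have "a ^ Suc (Suc n) - b ^ Suc (Suc n) = a * (a ^ Suc n - b ^ Suc n) + (a - b) * b ^ Suc n"
    by (simp add: algebra_simps)
  then have "\<bar>a ^ Suc (Suc n) - b ^ Suc (Suc n)\<bar> \<le> \<bar>a\<bar> * \<bar>a ^ Suc n - b ^ Suc n\<bar> + \<bar>a - b\<bar> * \<bar>b\<bar> ^ Suc n"
    by (metis abs_mult abs_triangle_ineq power_abs)
  also have "\<dots> \<le> M * (real (Suc n) * \<bar>a - b\<bar> * M ^ n) + \<bar>a - b\<bar> * M ^ Suc n"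
    using assms M Suc by (intro add_mono mult_mono power_mono) auto
  also have "\<dots> = real (Suc (Suc n)) * \<bar>a - b\<bar> * M ^ Suc n"
    by (simp add: algebra_simps)
  finally show ?case .
qed simp

lemma abs_add_power_le:
  fixes a b :: real
  shows "\<bar>a + b\<bar> ^ n \<le> 2 ^ n * (\<bar>a\<bar> ^ n + \<bar>b\<bar> ^ n)"
proof -
  have "\<bar>a + b\<bar> ^ n \<le> (2 * max \<bar>a\<bar> \<bar>b\<bar>) ^ n" by (intro power_mono) auto
  also have "\<dots> = 2 ^ n * max \<bar>a\<bar> \<bar>b\<bar> ^ n" by (simp add: power_mult_distrib)
  also have "max \<bar>a\<bar> \<bar>b\<bar> ^ n \<le> \<bar>a\<bar> ^ n + \<bar>b\<bar> ^ n" by (simp add: max_def)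
  finally show ?thesis by simp
qed

text \<open>A comparison with the larger of the two numbers gives constant 1 for every
  \<open>n\<close>; this uniformity passes to the smallness condition on
  \<open>\<beta>\<close>.\<close>

lemma young_power:
  fixes a b :: real
  shows "\<bar>a\<bar> ^ n * \<bar>b\<bar> \<le> \<bar>a\<bar> ^ Suc n + \<bar>b\<bar> ^ Suc n"
proof (cases "\<bar>a\<bar> \<le> \<bar>b\<bar>")
  case True
  then have "\<bar>a\<bar> ^ n * \<bar>b\<bar> \<le> \<bar>b\<bar> ^ n * \<bar>b\<bar>" by (intro mult_right_mono power_mono) auto
  then show ?thesis by (simp add: mult.commute add_increasing)
next
  case False
  then have "\<bar>a\<bar> ^ n * \<bar>b\<bar> \<le> \<bar>a\<bar> ^ n * \<bar>a\<bar>" by (intro mult_left_mono) auto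
  then show ?thesis by (simp add: mult.commute add_increasing2)
qed

text \<open>The factor 2, independent of the exponent, is what makes the smallness condition on \<open>\<beta>\<close>
  uniform in the order of the moments.\<close>

lemma add_power_le_twice:
  "\<exists>K\<ge>0. \<forall>a b::real. \<bar>b\<bar> \<le> B \<longrightarrow> \<bar>a + b\<bar> ^ n \<le> 2 * \<bar>a\<bar> ^ n + K"
proof -
  have "((\<lambda>x::real. (1 + x) ^ n) \<longlongrightarrow> (1 + 0) ^ n) (at_right 0)"
    by (intro tendsto_intros)
  then have "eventually (\<lambda>x::real. (1 + x) ^ n < 2) (at_right 0)"
    by (rule order_tendstoD) simp
  then obtain d where d: "d > 0" "(1 + d) ^ n < (2::real)"
    unfolding eventually_at_right_field by (metis dense)
  define K where "K = (\<bar>B\<bar> / d + \<bar>B\<bar>) ^ n"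
  have "\<bar>a + b\<bar> ^ n \<le> 2 * \<bar>a\<bar> ^ n + K" if b: "\<bar>b\<bar> \<le> B" for a b :: real
  proof (cases "\<bar>b\<bar> \<le> d * \<bar>a\<bar>")
    case True
    then have "\<bar>a + b\<bar> ^ n \<le> ((1 + d) * \<bar>a\<bar>) ^ n"
      by (intro power_mono) (auto simp: algebra_simps)
    also have "\<dots> \<le> 2 * \<bar>a\<bar> ^ n"
      unfolding power_mult_distrib using d by (intro mult_right_mono) auto
    moreover have "K \<ge> 0" unfolding K_def using d by simp
    ultimately show ?thesis by simp
  next
    case False
    then have "\<bar>a\<bar> \<le> \<bar>B\<bar> / d" using d b by (simp add: field_simps)
    then have "\<bar>a + b\<bar> ^ n \<le> K" unfolding K_def using b by (intro power_mono) auto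
    then show ?thesis by (simp add: add_increasing)
  qed
  moreover have "K \<ge> 0" unfolding K_def using d by simp
  ultimately show ?thesis by blast
qed

lemma avg_boltzmann_abs_le_const:
  assumes C: "finite C" "C \<noteq> {}" and f: "\<And>\<tau>. \<tau> \<in> PiE {1..n} (\<lambda>_. C) \<Longrightarrow> \<bar>f \<tau>\<bar> \<le> B"
  shows "\<bar>avg C (boltzmann C H) n f\<bar> \<le> B"
proof -
  have le: "f \<tau> \<le> B" "- B \<le> f \<tau>" if "\<tau> \<in> PiE {1..n} (\<lambda>_. C)" for \<tau>
    using f[OF that] by auto
  show ?thesis
    using avg_mono[of C "boltzmann C H" n f "\<lambda>_. B", OF boltzmann_nonneg le(1)]
      avg_mono[of C "boltzmann C H" n "\<lambda>_. - B" f, OF boltzmann_nonneg le(2)]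
    by (simp add: avg_const boltzmann_sum C abs_le_iff)
qed

context sk_model
begin

lemma abs_ev_le: "\<bar>ev N m \<theta> n f\<bar> \<le> ev N m \<theta> n (\<lambda>\<tau>. \<bar>f \<tau>\<bar>)"
  using ev_mono[of n N f "\<lambda>\<tau>. \<bar>f \<tau>\<bar>" m \<theta>] ev_mono[of n N "\<lambda>\<tau>. - f \<tau>" "\<lambda>\<tau>. \<bar>f \<tau>\<bar>" m \<theta>]
    ev_cmult[of N m \<theta> n "-1" f] by (simp add: abs_le_iff)

lemma ev_nonneg: "(\<And>\<tau>. f \<tau> \<ge> 0) \<Longrightarrow> ev N m \<theta> n f \<ge> 0"
  using ev_mono[of n N "\<lambda>_. 0" f m \<theta>] by (simp add: ev_const)

lemma eta_avg_bounds:
  assumes "\<And>s. s \<in> spins S \<Longrightarrow> \<bar>\<phi> (of_int s)\<bar> \<le> B"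
  shows "\<bar>eta_avg S \<beta> D hf p q \<eta> \<phi>\<bar> \<le> B"
proof -
  let ?G = "boltzmann (spins S) (site_energy \<eta>)"
  have "\<bar>eta_avg S \<beta> D hf p q \<eta> \<phi>\<bar> \<le> (\<Sum>s\<in>spins S. \<bar>\<phi> (of_int s)\<bar> * ?G s)"
    unfolding eta_avg_boltzmann by (intro order_trans[OF sum_abs] sum_mono) (simp add: abs_mult boltzmann_nonneg)
  also have "\<dots> \<le> (\<Sum>s\<in>spins S. B * ?G s)"
    by (intro sum_mono mult_right_mono assms boltzmann_nonneg)
  also have "\<dots> = B" by (simp add: sum_distrib_left[symmetric] boltzmann_sum)
  finally show ?thesis .
qed

lemma site_avg_abs_le:
  assumes "\<And>s. s \<in> PiE {1..n} (\<lambda>_. spins S) \<Longrightarrow> \<bar>\<phi> s\<bar> \<le> B"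
  shows "\<bar>site_avg n \<phi>\<bar> \<le> B"
proof -
  interpret prob_space std_normal_measure by (rule prob_space_std_normal)
  have m: "(\<lambda>\<eta>. avg (spins S) (boltzmann (spins S) (site_energy \<eta>)) n \<phi>) \<in> borel_measurable borel"
    unfolding avg_def boltzmann_def site_energy_def by measurable
  have b: "\<bar>avg (spins S) (boltzmann (spins S) (site_energy \<eta>)) n \<phi>\<bar> \<le> B" for \<eta>
    by (rule avg_boltzmann_abs_le_const) (use assms in auto)
  have "\<bar>site_avg n \<phi>\<bar> \<le> (\<integral>\<eta>. B \<partial>std_normal_measure)"
    unfolding site_avg_def
    by (intro order_trans[OF integral_abs_bound] integral_mono integrable_abs integrable_std_normal_bounded[OF m b])
      (use b in auto)
  then show ?thesis by (simp add: prob_space[simplified])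
qed

text \<open>The fixed-point equations for \<open>p\<close> and \<open>q\<close> enter as centring:
  by conditional independence given \<open>\<eta>\<close>, distinct replicas contribute a squared
  mean and equal ones a second moment. Centred spin products therefore vanish at the decoupled
  end.\<close>

lemma site_avg_pair:
  assumes "a \<in> {1..n}" "b \<in> {1..n}"
  shows "site_avg n (\<lambda>s. of_int (s a) * of_int (s b)) = overlap_const a b"
proof (cases "a = b")
  case True
  have "dep 1 (\<lambda>s::nat \<Rightarrow> int. \<Prod>k\<in>{1..1}. (real_of_int (s k))^2)"
    by (intro dep_prod dep_coord) auto
  then have "site_avg n (\<lambda>s. of_int (s a) * of_int (s b)) = site_avg 1 (\<lambda>s. \<Prod>k\<in>{1..1}. (\<lambda>s. s^2) (of_int (s k)))"
    using site_avg_reindex[of "\<lambda>_. a" 1 n "\<lambda>s. \<Prod>k\<in>{1..1}. (of_int (s k))^2"] assms True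
    by (simp add: power2_eq_square)
  also have "\<dots> = p"
    using site_avg_prod[of 1 "\<lambda>_ s. s^2"] pq by (simp add: is_pq_def)
  finally show ?thesis by (simp add: True overlap_const_def)
next
  case False
  have e: "{1..2::nat} = {1,2}" by auto
  have "dep 2 (\<lambda>s::nat \<Rightarrow> int. \<Prod>k\<in>{1..2}. real_of_int (s k))"
    by (intro dep_prod dep_coord) auto
  then have "site_avg n (\<lambda>s. of_int (s a) * of_int (s b)) = site_avg 2 (\<lambda>s. \<Prod>k\<in>{1..2}. (\<lambda>s. s) (of_int (s k)))"
    using site_avg_reindex[of "\<lambda>k. if k = 1 then a else b" 2 n "\<lambda>s. \<Prod>k\<in>{1..2}. of_int (s k)"] assms False
    unfolding e by (auto simp: inj_on_def)
  also have "\<dots> = q"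
    using site_avg_prod[of 2 "\<lambda>_ s. s"] pq unfolding e by (simp add: is_pq_def power2_eq_square)
  finally show ?thesis by (simp add: False overlap_const_def)
qed

lemma abs_spin_prod_le:
  assumes "x \<in> spins S" "y \<in> spins S"
  shows "\<bar>real_of_int x * of_int y\<bar> \<le> (real S)\<^sup>2"
  unfolding abs_mult power2_eq_square using abs_spin_le assms by (intro mult_mono) auto

lemma abs_overlap_const_le: "\<bar>overlap_const a b\<bar> \<le> (real S)\<^sup>2"
proof -
  have *: "\<bar>overlap_const a b\<bar> \<le> (real S)\<^sup>2" if "a \<in> {1..2}" "b \<in> {1..2}" for a b
    unfolding site_avg_pair[OF that, symmetric]
    by (rule site_avg_abs_le) (use that in \<open>auto intro!: abs_spin_prod_le\<close>)
  show ?thesis using *[of 1 1] *[of 1 2] by (auto simp: overlap_const_def)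
qed

text \<open>The reference value \<open>v\<close> serves two expansions: \<open>v = 0\<close> gives
  the first order, and the value at angle 0 gives the second. The function
  \<open>(sin t)^2 / 2\<close> is the primitive of \<open>sin t * cos t\<close>, and the factor 2
  bounds the length \<open>pi / 2\<close> of the path.\<close>

lemma ev_taylor:
  assumes m: "m \<in> {1..N}" and f: "dep n f" and \<theta>: "\<theta> \<in> {0..pi/2}"
    and bound: "\<And>t. t \<in> {0..pi/2} \<Longrightarrow> \<bar>ev N m t (Suc (Suc n)) (\<lambda>\<tau>. f \<tau> * drift N m n \<tau>) - v\<bar> \<le> B"
  shows "\<bar>ev N m \<theta> n f - ev N m 0 n f - (sin \<theta>)\<^sup>2 / 2 * (\<beta>\<^sup>2 / sqrt (real N) * v)\<bar> \<le> 2 * (\<beta>\<^sup>2 / sqrt (real N)) * B"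
proof -
  let ?c = "\<beta>\<^sup>2 / sqrt (real N)"
  let ?\<psi> = "\<lambda>t. ev N m t n f - (sin t)\<^sup>2 / 2 * (?c * v)"
  have c: "?c \<ge> 0" by simp
  have B: "B \<ge> 0" using bound[of 0] pi_gt_zero by fastforce
  have "norm (?\<psi> \<theta> - ?\<psi> 0) \<le> ?c * B * norm (\<theta> - 0)"
  proof (rule field_differentiable_bound[of "{0..pi/2}"])
    fix t assume t: "t \<in> {0..pi/2}"
    let ?d = "ev N m t (Suc (Suc n)) (\<lambda>\<tau>. f \<tau> * drift N m n \<tau>)"
    have sq: "((\<lambda>t. (sin t)\<^sup>2 / 2 * w) has_real_derivative (2 * (sin t * cos t)) / 2 * w) (at t)" for w
      by (auto intro!: derivative_eq_intros simp: power2_eq_square)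
    have "(?\<psi> has_real_derivative sin t * cos t * ?c * ?d - (2 * (sin t * cos t)) / 2 * (?c * v)) (at t)"
      by (rule DERIV_diff[OF ev_has_deriv[OF m f] sq])
    then show "(?\<psi> has_real_derivative sin t * cos t * (?c * (?d - v))) (at t within {0..pi/2})"
      by (rule has_field_derivative_subset[OF _ subset_UNIV, THEN DERIV_cong]) (simp add: algebra_simps)
    have "\<bar>sin t * cos t\<bar> \<le> 1"
      using mult_mono[OF abs_sin_le_one[of t] abs_cos_le_one[of t]] by (simp add: abs_mult)
    then have "\<bar>sin t * cos t\<bar> * (?c * \<bar>?d - v\<bar>) \<le> 1 * (?c * B)"
      using bound[OF t] c by (intro mult_mono mult_left_mono) auto
    then show "norm (sin t * cos t * (?c * (?d - v))) \<le> ?c * B"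
      by (simp add: abs_mult)
  qed (use \<theta> in auto)
  also have "\<dots> \<le> ?c * B * 2"
    using c B \<theta> pi_half_less_two by (intro mult_left_mono) auto
  finally show ?thesis by (simp add: algebra_simps)
qed

lemma cavity_overlap_abs_le:
  assumes m: "m \<in> {1..N}" and \<tau>: "\<tau> \<in> PiE {1..n} (\<lambda>_. configs S N)" and ab: "a \<in> {1..n}" "b \<in> {1..n}"
  shows "\<bar>cavity_overlap N m a b \<tau>\<bar> \<le> sqrt (real N) * (2 * (real S)\<^sup>2)"
proof -
  have N: "real N > 0" using m by auto
  have "\<bar>\<Sum>i\<in>{1..N}-{m}. real_of_int (\<tau> a i) * of_int (\<tau> b i)\<bar> \<le> (\<Sum>i\<in>{1..N}-{m}. (real S)\<^sup>2)"
    by (intro order_trans[OF sum_abs] sum_mono abs_spin_prod_le configs_spin) (use \<tau> ab in auto)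
  also have "\<dots> \<le> real N * (real S)\<^sup>2"
    using m by (auto intro!: mult_right_mono)
  finally have "\<bar>1 / sqrt (real N) * (\<Sum>i\<in>{1..N}-{m}. real_of_int (\<tau> a i) * of_int (\<tau> b i))\<bar> \<le> 1 / sqrt (real N) * (real N * (real S)\<^sup>2)"
    unfolding abs_mult by (intro mult_mono) auto
  also have "\<dots> = sqrt (real N) * (real S)\<^sup>2" using N by (simp add: field_simps)
  finally have 1: "\<bar>1 / sqrt (real N) * (\<Sum>i\<in>{1..N}-{m}. real_of_int (\<tau> a i) * of_int (\<tau> b i))\<bar> \<le> sqrt (real N) * (real S)\<^sup>2" .
  have "\<bar>sqrt (real N) * overlap_const a b\<bar> \<le> sqrt (real N) * (real S)\<^sup>2"
    unfolding abs_mult using abs_overlap_const_le by (intro mult_mono) auto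
  with 1 show ?thesis unfolding cavity_overlap_def by (intro order_trans[OF abs_triangle_ineq4]) (simp add: algebra_simps)
qed

lemma drift_abs_le:
  assumes m: "m \<in> {1..N}" and \<tau>: "\<tau> \<in> PiE {1..Suc (Suc n)} (\<lambda>_. configs S N)"
  shows "\<bar>drift N m n \<tau>\<bar> \<le> (\<Sum>l\<in>{1..Suc n}. \<Sum>l'\<in>{1..Suc (Suc n)}.
    \<bar>contrast n l\<bar> * \<bar>contrast (Suc n) l'\<bar> * (real S)\<^sup>2 * \<bar>cavity_overlap N m l l' \<tau>\<bar>)"
  unfolding drift_def
proof (intro order_trans[OF sum_abs] sum_mono)
  fix l l' assume l: "l \<in> {1..Suc n}" "l' \<in> {1..Suc (Suc n)}"
  have "\<bar>real_of_int (\<tau> l m) * of_int (\<tau> l' m)\<bar> \<le> (real S)\<^sup>2"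
    by (intro abs_spin_prod_le configs_spin[OF _ m]) (use \<tau> l in auto)
  then show "\<bar>contrast n l * contrast (Suc n) l' * (real_of_int (\<tau> l m) * of_int (\<tau> l' m)) * cavity_overlap N m l l' \<tau>\<bar>
    \<le> \<bar>contrast n l\<bar> * \<bar>contrast (Suc n) l'\<bar> * (real S)\<^sup>2 * \<bar>cavity_overlap N m l l' \<tau>\<bar>"
    unfolding abs_mult[of _ "cavity_overlap N m l l' \<tau>"] abs_mult[of "contrast n l * contrast (Suc n) l'"]
      abs_mult[of "contrast n l"]
    by (intro mult_mono mult_left_mono) auto
qed

lemma sum_contrast_contrast:
  "(\<Sum>l\<in>{1..Suc n}. \<Sum>l'\<in>{1..Suc (Suc n)}. \<bar>contrast n l\<bar> * \<bar>contrast (Suc n) l'\<bar> * c) = 4 * real n * (real n + 1) * c"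
  using sum_abs_contrast[of n] sum_abs_contrast[of "Suc n"]
  by (simp only: sum_distrib_right[symmetric] sum_product[symmetric]) (simp add: algebra_simps)

text \<open>The weights contribute \<open>4 * n * (n + 1)\<close>, the spins at \<open>m\<close> a
  factor \<open>S^2\<close>, and the cavity overlap at most \<open>2 * S^2 * sqrt N\<close>.\<close>

lemma drift_abs_le_const:
  assumes m: "m \<in> {1..N}" and \<tau>: "\<tau> \<in> PiE {1..Suc (Suc n)} (\<lambda>_. configs S N)"
  shows "\<bar>drift N m n \<tau>\<bar> \<le> 8 * real n * (real n + 1) * real S ^ 4 * sqrt (real N)"
proof -
  have "\<bar>drift N m n \<tau>\<bar> \<le> (\<Sum>l\<in>{1..Suc n}. \<Sum>l'\<in>{1..Suc (Suc n)}.
    \<bar>contrast n l\<bar> * \<bar>contrast (Suc n) l'\<bar> * ((real S)\<^sup>2 * (sqrt (real N) * (2 * (real S)\<^sup>2))))"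
    unfolding mult.assoc[symmetric]
    unfolding mult.assoc[of _ "sqrt (real N)"] mult.assoc[of _ "sqrt (real N) * _"] mult.assoc[of _ 2]
    by (intro order_trans[OF drift_abs_le[OF m \<tau>]] sum_mono mult_left_mono
        order_trans[OF cavity_overlap_abs_le[OF m \<tau>]]) auto
  also have "\<dots> = 8 * real n * (real n + 1) * real S ^ 4 * sqrt (real N)"
    unfolding sum_contrast_contrast by (simp add: algebra_simps power2_eq_square power4_eq_xxxx)
  finally show ?thesis .
qed

text \<open>Gronwall: the prefactor \<open>\<beta>^2 / sqrt N\<close> cancels the trivial size
  \<open>sqrt N\<close> of the drift, so the logarithmic derivative is bounded independently of
  \<open>N\<close>. A nonnegative observable loses only a constant factor against the end of the
  path, where the sites can be summed.\<close>

lemma ev_le_end: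
  assumes m: "m \<in> {1..N}" and f: "dep n f" "\<And>\<tau>. f \<tau> \<ge> 0" and \<theta>: "\<theta> \<in> {0..pi/2}"
  shows "ev N m \<theta> n f \<le> exp (16 * real n * (real n + 1) * real S ^ 4) * ev N m (pi/2) n f"
proof -
  define K where "K = 8 * real n * (real n + 1) * real S ^ 4"
  have N: "sqrt (real N) > 0" using m by auto
  have K: "K \<ge> 0" by (simp add: K_def)
  \<comment> \<open>The integrating factor makes the function nondecreasing;
    \<open>pi / 2 < 2\<close> then yields the exponent \<open>2 * K\<close>.\<close>
  let ?g = "\<lambda>t. exp (K * t) * ev N m t n f"
  have "?g \<theta> \<le> ?g (pi/2)"
  proof (rule DERIV_nonneg_imp_nondecreasing[where f = ?g])
    fix t assume t: "\<theta> \<le> t" "t \<le> pi/2"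
    let ?d = "ev N m t (Suc (Suc n)) (\<lambda>\<tau>. f \<tau> * drift N m n \<tau>)"
    let ?D = "sin t * cos t * (\<beta>\<^sup>2 / sqrt (real N)) * ?d"
    have "(?g has_real_derivative exp (K * t) * (K * ev N m t n f + ?D)) (at t)"
      by (rule derivative_eq_intros ev_has_deriv[OF m f(1)] refl)+ (simp add: algebra_simps)
    moreover have "\<bar>?d\<bar> \<le> K * sqrt (real N) * ev N m t n f"
    proof -
      have "\<bar>?d\<bar> \<le> ev N m t (Suc (Suc n)) (\<lambda>\<tau>. \<bar>f \<tau> * drift N m n \<tau>\<bar>)" by (rule abs_ev_le)
      also have "\<dots> \<le> ev N m t (Suc (Suc n)) (\<lambda>\<tau>. K * sqrt (real N) * f \<tau>)"
      proof (rule ev_mono)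
        fix \<tau> assume "\<tau> \<in> PiE {1..Suc (Suc n)} (\<lambda>_. configs S N)"
        from drift_abs_le_const[OF m this] show "\<bar>f \<tau> * drift N m n \<tau>\<bar> \<le> K * sqrt (real N) * f \<tau>"
          using f(2)[of \<tau>] by (simp add: abs_mult K_def mult.commute[of "f \<tau>"] mult_right_mono)
      qed
      also have "\<dots> = K * sqrt (real N) * ev N m t n f"
        unfolding ev_cmult using ev_more_replicas[OF f(1), of "Suc (Suc n)" N m t] by simp
      finally show ?thesis .
    qed
    then have "\<bar>?D\<bar> \<le> K * ev N m t n f"
    proof -
      have b2: "\<beta>\<^sup>2 \<le> 1" using \<beta>_pos \<beta>_le_1 by (simp add: power_le_one)
      have "\<bar>sin t * cos t\<bar> \<le> 1"
        using mult_mono[OF abs_sin_le_one[of t] abs_cos_le_one[of t]] by (simp add: abs_mult)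
      then have "\<bar>sin t * cos t\<bar> * \<beta>\<^sup>2 \<le> 1" using b2 by (intro mult_le_one) auto
      then have "(\<bar>sin t * cos t\<bar> * \<beta>\<^sup>2) * (\<bar>?d\<bar> / sqrt (real N)) \<le> 1 * (\<bar>?d\<bar> / sqrt (real N))"
        using N by (intro mult_right_mono) auto
      also have "\<dots> \<le> K * ev N m t n f"
        using \<open>\<bar>?d\<bar> \<le> K * sqrt (real N) * ev N m t n f\<close> N by (simp add: divide_le_eq mult_ac)
      finally show ?thesis by (simp add: abs_mult mult_ac)
    qed
    then have "0 \<le> K * ev N m t n f + ?D" by linarith
    then have "0 \<le> exp (K * t) * (K * ev N m t n f + ?D)" by simp
    ultimately show "\<exists>y. (?g has_real_derivative y) (at t) \<and> 0 \<le> y"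
      by blast
  qed (use \<theta> in auto)
  moreover have "ev N m \<theta> n f \<le> ?g \<theta>"
    using ev_nonneg[of f N m \<theta> n] f(2) K \<theta> by (simp add: mult_le_cancel_right1)
  moreover have "?g (pi/2) \<le> exp (2 * K) * ev N m (pi/2) n f"
    using ev_nonneg[of f N m "pi/2" n] f(2) K mult_left_mono[OF less_imp_le[OF pi_half_less_two] K]
    by (intro mult_right_mono) (auto simp: mult.commute)
  ultimately have "ev N m \<theta> n f \<le> exp (2 * K) * ev N m (pi/2) n f" by linarith
  also have "2 * K = 16 * real n * (real n + 1) * real S ^ 4" by (simp add: K_def)
  finally show ?thesis .
qed

end

section \<open>Moments of the overlaps\<close>

context sk_model
begin

definition overlap :: "nat \<Rightarrow> nat \<Rightarrow> nat \<Rightarrow> (nat \<Rightarrow> nat \<Rightarrow> int) \<Rightarrow> real" where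
  "overlap N a b \<tau> = 1 / sqrt (real N) * (\<Sum>i\<in>{1..N}. of_int (\<tau> a i) * of_int (\<tau> b i))
     - sqrt (real N) * overlap_const a b"

lemma overlap_eq_cavity:
  assumes "m \<in> {1..N}"
  shows "overlap N a b \<tau> = cavity_overlap N m a b \<tau> + 1 / sqrt (real N) * (of_int (\<tau> a m) * of_int (\<tau> b m))"
proof -
  have "(\<Sum>i\<in>{1..N}. real_of_int (\<tau> a i) * of_int (\<tau> b i))
      = of_int (\<tau> a m) * of_int (\<tau> b m) + (\<Sum>i\<in>{1..N}-{m}. of_int (\<tau> a i) * of_int (\<tau> b i))"
    using assms by (intro sum.remove) auto
  then show ?thesis unfolding overlap_def cavity_overlap_def by (simp only: distrib_left)
qed

lemma overlap_eq_sum: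
  assumes "N > 0"
  shows "overlap N a b \<tau> = 1 / sqrt (real N) * (\<Sum>i\<in>{1..N}. of_int (\<tau> a i) * of_int (\<tau> b i) - overlap_const a b)"
proof -
  have "sqrt (real N) = 1 / sqrt (real N) * real N" using assms by (simp add: real_div_sqrt)
  then have "sqrt (real N) * overlap_const a b = 1 / sqrt (real N) * (real N * overlap_const a b)"
    by (metis mult.assoc)
  then show ?thesis unfolding overlap_def by (simp only: sum_subtractf right_diff_distrib) simp
qed

lemma dep_cavity_overlap [intro]: "a \<in> {1..n} \<Longrightarrow> b \<in> {1..n} \<Longrightarrow> dep n (cavity_overlap N m a b)"
  unfolding cavity_overlap_def[abs_def]
  by (intro dep_diff dep_mult dep_const dep_sum dep_coord[where h = "\<lambda>x. real_of_int (x _)"]; simp)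

lemma avoids_cavity_overlap [intro]: "avoids m (cavity_overlap N m a b)"
  unfolding avoids_def cavity_overlap_def by (auto intro!: sum.cong)

text \<open>This stands in for symmetry between sites: after an overlap is expanded over the sites,
  each summand is analysed along the path of its own site.\<close>

lemma ev_end_indep:
  assumes "m \<in> {1..N}" "m' \<in> {1..N}"
  shows "ev N m (pi/2) n f = ev N m' (pi/2) n f"
  using assms by (simp only: ev_end)

lemma spin_pair_bounds:
  assumes "m \<in> {1..N}" "\<tau> \<in> PiE {1..n} (\<lambda>_. configs S N)" "a \<in> {1..n}" "b \<in> {1..n}"
  shows "\<bar>real_of_int (\<tau> a m) * of_int (\<tau> b m)\<bar> \<le> (real S)\<^sup>2"
    and "\<bar>real_of_int (\<tau> a m) * of_int (\<tau> b m) - overlap_const a b\<bar> \<le> 2 * (real S)\<^sup>2"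
    and "\<bar>1 / sqrt (real N) * (real_of_int (\<tau> a m) * of_int (\<tau> b m))\<bar> \<le> (real S)\<^sup>2 / sqrt (real N)"
    and "(real S)\<^sup>2 / sqrt (real N) \<le> (real S)\<^sup>2"
proof -
  show 1: "\<bar>real_of_int (\<tau> a m) * of_int (\<tau> b m)\<bar> \<le> (real S)\<^sup>2"
    by (intro abs_spin_prod_le configs_spin[OF _ assms(1)]) (use assms in auto)
  then show "\<bar>real_of_int (\<tau> a m) * of_int (\<tau> b m) - overlap_const a b\<bar> \<le> 2 * (real S)\<^sup>2"
    using abs_overlap_const_le[of a b] by linarith
  show "\<bar>1 / sqrt (real N) * (real_of_int (\<tau> a m) * of_int (\<tau> b m))\<bar> \<le> (real S)\<^sup>2 / sqrt (real N)"
    using 1 unfolding abs_mult[of "1 / _"] by (simp add: divide_right_mono)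
  have "sqrt (real N) \<ge> 1" using assms(1) by auto
  then show "(real S)\<^sup>2 / sqrt (real N) \<le> (real S)\<^sup>2"
    by (simp add: divide_le_eq mult_le_cancel_left1)
qed

lemma cavity_overlap_moment_le:
  assumes m: "m \<in> {1..N}" and cd: "c \<in> {1..2}" "d \<in> {1..2}"
    and K: "\<And>a b::real. \<bar>b\<bar> \<le> (real S)\<^sup>2 \<Longrightarrow> \<bar>a + b\<bar> ^ j \<le> 2 * \<bar>a\<bar> ^ j + K"
  shows "ev N m (pi/2) 2 (\<lambda>\<tau>. \<bar>cavity_overlap N m c d \<tau>\<bar> ^ j) \<le> 2 * ev N m (pi/2) 2 (\<lambda>\<tau>. \<bar>overlap N c d \<tau>\<bar> ^ j) + K"
proof -
  have "ev N m (pi/2) 2 (\<lambda>\<tau>. \<bar>cavity_overlap N m c d \<tau>\<bar> ^ j) \<le> ev N m (pi/2) 2 (\<lambda>\<tau>. 2 * \<bar>overlap N c d \<tau>\<bar> ^ j + K)"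
  proof (rule ev_mono)
    fix \<tau> :: "nat \<Rightarrow> nat \<Rightarrow> int" assume \<tau>: "\<tau> \<in> PiE {1..2} (\<lambda>_. configs S N)"
    have "\<bar>- (1 / sqrt (real N) * (real_of_int (\<tau> c m) * of_int (\<tau> d m)))\<bar> \<le> (real S)\<^sup>2"
      using spin_pair_bounds(3,4)[OF m \<tau> cd] by simp
    from K[OF this, of "overlap N c d \<tau>"]
    show "\<bar>cavity_overlap N m c d \<tau>\<bar> ^ j \<le> 2 * \<bar>overlap N c d \<tau>\<bar> ^ j + K"
      by (simp add: overlap_eq_cavity[OF m])
  qed
  then show ?thesis by (simp add: ev_add ev_cmult ev_const)
qed

text \<open>Relabelling brings any pair of replicas to \<open>(1, 2)\<close> or
  \<open>(1, 1)\<close> before the comparison with the end of the path. It is then made with two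
  replicas, and \<open>16 * 2 * 3 = 96\<close> replaces a constant that would grow with
  \<open>n\<close>.\<close>

lemma ev_cavity_overlap_le:
  assumes m: "m \<in> {1..N}" and \<theta>: "\<theta> \<in> {0..pi/2}" and ab: "a \<in> {1..n}" "b \<in> {1..n}"
  shows "ev N m \<theta> n (\<lambda>\<tau>. \<bar>cavity_overlap N m a b \<tau>\<bar> ^ j) \<le> exp (96 * real S ^ 4) *
    (ev N m (pi/2) 2 (\<lambda>\<tau>. \<bar>cavity_overlap N m 1 2 \<tau>\<bar> ^ j) + ev N m (pi/2) 2 (\<lambda>\<tau>. \<bar>cavity_overlap N m 1 1 \<tau>\<bar> ^ j))"
proof -
  have le: "ev N m \<theta> 2 (\<lambda>\<tau>. \<bar>cavity_overlap N m c d \<tau>\<bar> ^ j)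
      \<le> exp (96 * real S ^ 4) * ev N m (pi/2) 2 (\<lambda>\<tau>. \<bar>cavity_overlap N m c d \<tau>\<bar> ^ j)"
    if "c \<in> {1..2}" "d \<in> {1..2}" for c d
    using ev_le_end[OF m dep_comp[OF dep_cavity_overlap[OF that], of "\<lambda>x. \<bar>x\<bar> ^ j"] _ \<theta>] by simp
  have nn: "ev N m (pi/2) 2 (\<lambda>\<tau>. \<bar>cavity_overlap N m c d \<tau>\<bar> ^ j) \<ge> 0" for c d
    by (rule ev_nonneg) simp
  show ?thesis
  proof (cases "a = b")
    case True
    have "ev N m \<theta> n (\<lambda>\<tau>. \<bar>cavity_overlap N m a b \<tau>\<bar> ^ j) = ev N m \<theta> 1 (\<lambda>\<tau>. \<bar>cavity_overlap N m 1 1 \<tau>\<bar> ^ j)"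
      using ev_reindex[OF _ _ dep_comp[OF dep_cavity_overlap[of 1 1 1 N m], of "\<lambda>x. \<bar>x\<bar> ^ j"], of "\<lambda>_. a" n N m \<theta>] ab True
      by (simp add: cavity_overlap_def overlap_const_def)
    \<comment> \<open>One replica would suffice for a self-overlap; the second is added to obtain
      the same constant in both cases.\<close>
    also have "\<dots> = ev N m \<theta> 2 (\<lambda>\<tau>. \<bar>cavity_overlap N m 1 1 \<tau>\<bar> ^ j)"
      by (rule ev_more_replicas[symmetric]) (auto intro!: dep_comp[where h = "\<lambda>x. \<bar>x\<bar> ^ j"] dep_cavity_overlap)
    also have "\<dots> \<le> exp (96 * real S ^ 4) * ev N m (pi/2) 2 (\<lambda>\<tau>. \<bar>cavity_overlap N m 1 1 \<tau>\<bar> ^ j)"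
      by (rule le) auto
    finally show ?thesis using nn by (simp add: distrib_left add_increasing)
  next
    case False
    let ?\<pi> = "\<lambda>k::nat. if k = 1 then a else b"
    have "inj_on ?\<pi> {1..2}" "?\<pi> ` {1..2} \<subseteq> {1..n}"
      using False ab by (auto simp: inj_on_def)
    moreover have "dep 2 (\<lambda>\<tau>. \<bar>cavity_overlap N m 1 2 \<tau>\<bar> ^ j)"
      by (rule dep_comp[OF dep_cavity_overlap]) auto
    ultimately have "ev N m \<theta> n (\<lambda>\<tau>. \<bar>cavity_overlap N m 1 2 (\<lambda>k. \<tau> (?\<pi> k))\<bar> ^ j) = ev N m \<theta> 2 (\<lambda>\<tau>. \<bar>cavity_overlap N m 1 2 \<tau>\<bar> ^ j)"
      by (rule ev_reindex)
    moreover have "cavity_overlap N m 1 2 (\<lambda>k. \<tau> (?\<pi> k)) = cavity_overlap N m a b \<tau>" for \<tau>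
      using False by (simp add: cavity_overlap_def overlap_const_def)
    ultimately have "ev N m \<theta> n (\<lambda>\<tau>. \<bar>cavity_overlap N m a b \<tau>\<bar> ^ j) = ev N m \<theta> 2 (\<lambda>\<tau>. \<bar>cavity_overlap N m 1 2 \<tau>\<bar> ^ j)"
      by simp
    also have "\<dots> \<le> exp (96 * real S ^ 4) * ev N m (pi/2) 2 (\<lambda>\<tau>. \<bar>cavity_overlap N m 1 2 \<tau>\<bar> ^ j)"
      by (rule le) auto
    finally show ?thesis using nn by (simp add: distrib_left add_increasing2)
  qed
qed

text \<open>At the decoupled end the centred spin product has mean zero, so only the drift remains.
  It raises the degree from \<open>j\<close> to \<open>j + 1\<close> in the overlaps, at a price
  proportional to \<open>\<beta>^2 / sqrt N\<close> with a constant independent of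
  \<open>j\<close>.\<close>

lemma centered_cavity_bound:
  fixes j :: nat
  assumes m: "m \<in> {1..N}" and ab: "a \<in> {1..2}" "b \<in> {1..2}"
  defines "L \<equiv> ev N m (pi/2) 2 (\<lambda>\<tau>. \<bar>cavity_overlap N m 1 2 \<tau>\<bar> ^ Suc j)
    + ev N m (pi/2) 2 (\<lambda>\<tau>. \<bar>cavity_overlap N m 1 1 \<tau>\<bar> ^ Suc j)"
  shows "\<bar>ev N m (pi/2) 2 (\<lambda>\<tau>. (of_int (\<tau> a m) * of_int (\<tau> b m) - overlap_const a b) * cavity_overlap N m a b \<tau> ^ j)\<bar>
    \<le> 192 * \<beta>\<^sup>2 * real S ^ 4 * exp (96 * real S ^ 4) * L / sqrt (real N)"
proof -
  define E where "E = exp (96 * real S ^ 4)"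
  define f where "f = (\<lambda>\<tau>::nat \<Rightarrow> nat \<Rightarrow> int. (of_int (\<tau> a m) * of_int (\<tau> b m) - overlap_const a b) * cavity_overlap N m a b \<tau> ^ j)"
  have f: "dep 2 f"
    unfolding f_def
    by (intro dep_diff dep_mult dep_const dep_coord[where h = "\<lambda>x. real_of_int (x _)"] dep_comp[where h = "\<lambda>x. x ^ j"] dep_cavity_overlap)
      (use ab in auto)
  have f0: "ev N m 0 2 f = 0"
  proof -
    define \<phi> where "\<phi> = (\<lambda>s::nat \<Rightarrow> int. real_of_int (s a) * of_int (s b) - overlap_const a b)"
    have "ev N m 0 2 f = ev N m 0 2 (\<lambda>\<tau>. \<phi> (\<lambda>k. \<tau> k m) * cavity_overlap N m a b \<tau> ^ j)"
      by (simp add: f_def \<phi>_def)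
    also have "\<dots> = site_avg 2 \<phi> * ev N m 0 2 (\<lambda>\<tau>. cavity_overlap N m a b \<tau> ^ j)"
    proof (rule ev_start[OF m])
      show "dep 2 \<phi>" unfolding \<phi>_def
        by (intro dep_diff dep_mult dep_const dep_coord[where h = real_of_int]) (use ab in auto)
    qed auto
    also have "site_avg 2 \<phi> = 0"
      using ab unfolding \<phi>_def by (simp only: site_avg_diff site_avg_const site_avg_pair diff_self)
    finally show ?thesis by simp
  qed
  have "\<bar>ev N m t 4 (\<lambda>\<tau>. f \<tau> * drift N m 2 \<tau>)\<bar> \<le> 96 * real S ^ 4 * E * L" if t: "t \<in> {0..pi/2}" for t
  proof -
    let ?r = "\<lambda>l l' \<tau>. \<bar>cavity_overlap N m l l' \<tau>\<bar> ^ Suc j"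
    have E: "ev N m t 4 (?r l l') \<le> E * L" if "l \<in> {1..4}" "l' \<in> {1..4}" for l l'
      using ev_cavity_overlap_le[OF m t that] unfolding L_def E_def .
    have "\<bar>ev N m t 4 (\<lambda>\<tau>. f \<tau> * drift N m 2 \<tau>)\<bar> \<le> ev N m t 4 (\<lambda>\<tau>. \<bar>f \<tau> * drift N m 2 \<tau>\<bar>)" by (rule abs_ev_le)
    also have "\<dots> \<le> ev N m t 4 (\<lambda>\<tau>. \<Sum>l\<in>{1..3}. \<Sum>l'\<in>{1..4}. \<bar>contrast 2 l\<bar> * \<bar>contrast 3 l'\<bar> * (2 * (real S)\<^sup>2 * (real S)\<^sup>2) * (?r a b \<tau> + ?r l l' \<tau>))"
    proof (rule ev_mono)
      fix \<tau> :: "nat \<Rightarrow> nat \<Rightarrow> int" assume \<tau>: "\<tau> \<in> PiE {1..4} (\<lambda>_. configs S N)"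
      have fb: "\<bar>f \<tau>\<bar> \<le> 2 * (real S)\<^sup>2 * \<bar>cavity_overlap N m a b \<tau>\<bar> ^ j"
        unfolding f_def abs_mult power_abs
        by (intro mult_right_mono spin_pair_bounds(2)[OF m \<tau>]) (use ab in auto)
      have db: "\<bar>drift N m 2 \<tau>\<bar> \<le> (\<Sum>l\<in>{1..3}. \<Sum>l'\<in>{1..4}. \<bar>contrast 2 l\<bar> * \<bar>contrast 3 l'\<bar> * (real S)\<^sup>2 * \<bar>cavity_overlap N m l l' \<tau>\<bar>)"
        using drift_abs_le[OF m, of \<tau> 2] \<tau> by (simp add: numeral_eq_Suc)
      have "\<bar>f \<tau> * drift N m 2 \<tau>\<bar> \<le> (2 * (real S)\<^sup>2 * \<bar>cavity_overlap N m a b \<tau>\<bar> ^ j) *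
         (\<Sum>l\<in>{1..3}. \<Sum>l'\<in>{1..4}. \<bar>contrast 2 l\<bar> * \<bar>contrast 3 l'\<bar> * (real S)\<^sup>2 * \<bar>cavity_overlap N m l l' \<tau>\<bar>)"
        unfolding abs_mult by (intro mult_mono fb db) auto
      also have "\<dots> = (\<Sum>l\<in>{1..3}. \<Sum>l'\<in>{1..4}. \<bar>contrast 2 l\<bar> * \<bar>contrast 3 l'\<bar> * (2 * (real S)\<^sup>2 * (real S)\<^sup>2) *
          (\<bar>cavity_overlap N m a b \<tau>\<bar> ^ j * \<bar>cavity_overlap N m l l' \<tau>\<bar>))"
        unfolding sum_distrib_left by (intro sum.cong refl) (simp add: mult_ac)
      also have "\<dots> \<le> (\<Sum>l\<in>{1..3}. \<Sum>l'\<in>{1..4}. \<bar>contrast 2 l\<bar> * \<bar>contrast 3 l'\<bar> * (2 * (real S)\<^sup>2 * (real S)\<^sup>2) * (?r a b \<tau> + ?r l l' \<tau>))"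
        by (intro sum_mono mult_left_mono young_power) auto
      finally show "\<bar>f \<tau> * drift N m 2 \<tau>\<bar> \<le> (\<Sum>l\<in>{1..3}. \<Sum>l'\<in>{1..4}. \<bar>contrast 2 l\<bar> * \<bar>contrast 3 l'\<bar> * (2 * (real S)\<^sup>2 * (real S)\<^sup>2) * (?r a b \<tau> + ?r l l' \<tau>))" .
    qed
    also have "\<dots> = (\<Sum>l\<in>{1..3}. \<Sum>l'\<in>{1..4}. \<bar>contrast 2 l\<bar> * \<bar>contrast 3 l'\<bar> * (2 * (real S)\<^sup>2 * (real S)\<^sup>2) * (ev N m t 4 (?r a b) + ev N m t 4 (?r l l')))"
      by (simp only: ev_sum ev_cmult ev_add)
    also have "\<dots> \<le> (\<Sum>l\<in>{1..3}. \<Sum>l'\<in>{1..4}. \<bar>contrast 2 l\<bar> * \<bar>contrast 3 l'\<bar> * (2 * (real S)\<^sup>2 * (real S)\<^sup>2) * (E * L + E * L))"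
      by (intro sum_mono mult_left_mono add_mono E) (use ab in auto)
    \<comment> \<open>The contrast weights for \<open>n = 2\<close> sum to 24, the spins give
      \<open>2 * S^4\<close>, and both overlap moments are bounded by \<open>E * L\<close>.\<close>
    also have "\<dots> = 96 * real S ^ 4 * E * L"
      using sum_contrast_contrast[of 2 "(2 * (real S)\<^sup>2 * (real S)\<^sup>2) * (E * L + E * L)"]
      by (simp only: numeral_eq_Suc One_nat_def pred_numeral_simps mult.assoc arith_simps numeral_One BitM.simps)
        (simp add: power2_eq_square power4_eq_xxxx algebra_simps numeral_eq_Suc)
    finally show ?thesis .
  qed
  then have "\<bar>ev N m (pi/2) 2 f - ev N m 0 2 f - (sin (pi/2))\<^sup>2 / 2 * (\<beta>\<^sup>2 / sqrt (real N) * 0)\<bar> \<le> 2 * (\<beta>\<^sup>2 / sqrt (real N)) * (96 * real S ^ 4 * E * L)"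
    by (intro ev_taylor[OF m f]) (auto simp: numeral_eq_Suc)
  then show ?thesis unfolding f0 by (simp add: f_def E_def mult_ac)
qed

end

text \<open>The number 1536 is 192 from the centred bound, times 2 for passing from cavity to full
  overlaps, times 2 for adding the two kinds of overlap, times 2 so that the contraction factor is
  at most one half. It is the same for all moments.\<close>

locale sk_small = sk_model +
  assumes small: "\<beta>\<^sup>2 * (1536 * real S ^ 4 * exp (96 * real S ^ 4)) \<le> 1"
begin

text \<open>Expanding one factor of the overlap over the sites bounds the moment of order \<open>2k + 2\<close> by a small multiple
  of itself plus a term controlled by the moment of order \<open>2k\<close>.\<close>

lemma overlap_moments:
  "\<exists>C. \<forall>N m. m \<in> {1..N} \<longrightarrow> ev N m (pi/2) 2 (\<lambda>\<tau>. \<bar>overlap N 1 2 \<tau>\<bar> ^ (2 * k)) \<le> C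
     \<and> ev N m (pi/2) 2 (\<lambda>\<tau>. \<bar>overlap N 1 1 \<tau>\<bar> ^ (2 * k)) \<le> C"
proof (induction k)
  case 0
  show ?case by (rule exI[of _ 1]) (simp add: ev_const)
next
  case (Suc k)
  then obtain C where C: "\<And>N m. m \<in> {1..N} \<Longrightarrow> ev N m (pi/2) 2 (\<lambda>\<tau>. \<bar>overlap N 1 2 \<tau>\<bar> ^ (2 * k)) \<le> C"
    "\<And>N m. m \<in> {1..N} \<Longrightarrow> ev N m (pi/2) 2 (\<lambda>\<tau>. \<bar>overlap N 1 1 \<tau>\<bar> ^ (2 * k)) \<le> C" by blast
  define J where "J = Suc (2 * k)"
  define E where "E = exp (96 * real S ^ 4)"
  define s2 where "s2 = (real S)\<^sup>2"
  obtain K where K: "K \<ge> 0" "\<And>a b::real. \<bar>b\<bar> \<le> s2 \<Longrightarrow> \<bar>a + b\<bar> ^ Suc J \<le> 2 * \<bar>a\<bar> ^ Suc J + K"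
    using add_power_le_twice[of s2 "Suc J"] by blast
  \<comment> \<open>The cost of replacing the overlap by the cavity overlap in the power
    \<open>J\<close>: a centred spin product, times the difference of order
    \<open>1 / sqrt N\<close>, times a power of degree \<open>2 * k\<close>, which the induction
    hypothesis controls.\<close>
  define C' where "C' = 2 * s2 * (real (Suc (2 * k)) * s2 * (2 ^ (2 * k) * (C + s2 ^ (2 * k))))"
  define A where "A = (\<lambda>N m. ev N m (pi/2) 2 (\<lambda>\<tau>. \<bar>overlap N 1 2 \<tau>\<bar> ^ Suc J) + ev N m (pi/2) 2 (\<lambda>\<tau>. \<bar>overlap N 1 1 \<tau>\<bar> ^ Suc J))"
  have s2: "s2 \<ge> 0" by (simp add: s2_def)
  have one: "ev N m0 (pi/2) 2 (\<lambda>\<tau>. \<bar>overlap N a b \<tau>\<bar> ^ Suc J) \<le> 192 * \<beta>\<^sup>2 * real S ^ 4 * E * (2 * A N m0 + 2 * K) + C'"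
    if m0: "m0 \<in> {1..N}" and ab: "(a, b) = (1, 2) \<or> (a, b) = (1, 1)" for N m0 a b
  proof -
    have N: "N > 0" "real N > 0" using m0 by auto
    have ab': "a \<in> {1..2}" "b \<in> {1..2}" using ab by auto
    define x where "x = (\<lambda>m \<tau>::nat \<Rightarrow> nat \<Rightarrow> int. real_of_int (\<tau> a m) * of_int (\<tau> b m) - overlap_const a b)"
    have step: "\<bar>ev N m (pi/2) 2 (\<lambda>\<tau>. x m \<tau> * overlap N a b \<tau> ^ J)\<bar>
       \<le> (192 * \<beta>\<^sup>2 * real S ^ 4 * E * (2 * A N m0 + 2 * K) + C') / sqrt (real N)" if m: "m \<in> {1..N}" for m
    proof -
      define L where "L = ev N m (pi/2) 2 (\<lambda>\<tau>. \<bar>cavity_overlap N m 1 2 \<tau>\<bar> ^ Suc J)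
        + ev N m (pi/2) 2 (\<lambda>\<tau>. \<bar>cavity_overlap N m 1 1 \<tau>\<bar> ^ Suc J)"
      note cav = cavity_overlap_moment_le[OF m _ _ K(2)[unfolded s2_def]]
      have "A N m = A N m0" unfolding A_def using ev_end_indep[OF m m0] by simp
      then have LA: "L \<le> 2 * A N m0 + 2 * K"
        using cav[of 1 2] cav[of 1 1] unfolding L_def A_def by simp
      have Cab: "ev N m (pi/2) 2 (\<lambda>\<tau>. \<bar>overlap N a b \<tau>\<bar> ^ (2 * k)) \<le> C" using C[OF m] ab by auto
      have "\<bar>ev N m (pi/2) 2 (\<lambda>\<tau>. x m \<tau> * overlap N a b \<tau> ^ J) - ev N m (pi/2) 2 (\<lambda>\<tau>. x m \<tau> * cavity_overlap N m a b \<tau> ^ J)\<bar>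
        \<le> ev N m (pi/2) 2 (\<lambda>\<tau>. \<bar>x m \<tau> * overlap N a b \<tau> ^ J - x m \<tau> * cavity_overlap N m a b \<tau> ^ J\<bar>)"
        unfolding ev_diff[symmetric] by (rule abs_ev_le)
      also have "\<dots> \<le> ev N m (pi/2) 2 (\<lambda>\<tau>. 2 * s2 * (real (Suc (2 * k)) * (s2 / sqrt (real N)) * (2 ^ (2 * k) * (\<bar>overlap N a b \<tau>\<bar> ^ (2 * k) + s2 ^ (2 * k)))))"
      proof (rule ev_mono)
        fix \<tau> :: "nat \<Rightarrow> nat \<Rightarrow> int" assume \<tau>: "\<tau> \<in> PiE {1..2} (\<lambda>_. configs S N)"
        let ?R = "overlap N a b \<tau>" and ?r = "cavity_overlap N m a b \<tau>"
        have d: "\<bar>?R - ?r\<bar> \<le> s2 / sqrt (real N)"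
          using spin_pair_bounds(3)[OF m \<tau> ab'] by (simp add: overlap_eq_cavity[OF m] s2_def)
        also have "\<dots> \<le> s2" using spin_pair_bounds(4)[OF m \<tau> ab'] by (simp add: s2_def)
        finally have d': "\<bar>?R - ?r\<bar> \<le> s2" .
        have "\<bar>?R ^ J - ?r ^ J\<bar> \<le> real (Suc (2 * k)) * \<bar>?R - ?r\<bar> * (\<bar>?R\<bar> + s2) ^ (2 * k)"
          unfolding J_def by (rule abs_power_diff_le) (use d' s2 in linarith)+
        also have "\<dots> \<le> real (Suc (2 * k)) * (s2 / sqrt (real N)) * (2 ^ (2 * k) * (\<bar>?R\<bar> ^ (2 * k) + s2 ^ (2 * k)))"
        proof (intro mult_mono mult_left_mono d)
          show "(\<bar>?R\<bar> + s2) ^ (2 * k) \<le> 2 ^ (2 * k) * (\<bar>?R\<bar> ^ (2 * k) + s2 ^ (2 * k))"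
            using abs_add_power_le[of "\<bar>?R\<bar>" s2 "2 * k"] s2 by simp
        qed (use s2 in auto)
        finally have "\<bar>?R ^ J - ?r ^ J\<bar> \<le> real (Suc (2 * k)) * (s2 / sqrt (real N)) * (2 ^ (2 * k) * (\<bar>?R\<bar> ^ (2 * k) + s2 ^ (2 * k)))" .
        then show "\<bar>x m \<tau> * ?R ^ J - x m \<tau> * ?r ^ J\<bar> \<le> 2 * s2 * (real (Suc (2 * k)) * (s2 / sqrt (real N)) * (2 ^ (2 * k) * (\<bar>?R\<bar> ^ (2 * k) + s2 ^ (2 * k))))"
          unfolding right_diff_distrib[symmetric] abs_mult
          using spin_pair_bounds(2)[OF m \<tau> ab'] by (intro mult_mono) (auto simp: x_def s2_def)
      qed
      also have "\<dots> = 2 * s2 * (real (Suc (2 * k)) * (s2 / sqrt (real N)) * (2 ^ (2 * k) * (ev N m (pi/2) 2 (\<lambda>\<tau>. \<bar>overlap N a b \<tau>\<bar> ^ (2 * k)) + s2 ^ (2 * k))))"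
        by (simp only: ev_cmult ev_add ev_const)
      also have "\<dots> \<le> 2 * s2 * (real (Suc (2 * k)) * (s2 / sqrt (real N)) * (2 ^ (2 * k) * (C + s2 ^ (2 * k))))"
        using s2 Cab by (intro mult_left_mono add_mono) auto
      also have "\<dots> = C' / sqrt (real N)" by (simp add: C'_def)
      finally have 1: "\<bar>ev N m (pi/2) 2 (\<lambda>\<tau>. x m \<tau> * overlap N a b \<tau> ^ J) - ev N m (pi/2) 2 (\<lambda>\<tau>. x m \<tau> * cavity_overlap N m a b \<tau> ^ J)\<bar> \<le> C' / sqrt (real N)" .
      have "\<bar>ev N m (pi/2) 2 (\<lambda>\<tau>. x m \<tau> * cavity_overlap N m a b \<tau> ^ J)\<bar> \<le> 192 * \<beta>\<^sup>2 * real S ^ 4 * E * L / sqrt (real N)"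
        unfolding x_def L_def E_def by (rule centered_cavity_bound[OF m ab'])
      also have "\<dots> \<le> 192 * \<beta>\<^sup>2 * real S ^ 4 * E * (2 * A N m0 + 2 * K) / sqrt (real N)"
        using LA by (intro divide_right_mono mult_left_mono) (auto simp: E_def)
      finally have 2: "\<bar>ev N m (pi/2) 2 (\<lambda>\<tau>. x m \<tau> * cavity_overlap N m a b \<tau> ^ J)\<bar> \<le> 192 * \<beta>\<^sup>2 * real S ^ 4 * E * (2 * A N m0 + 2 * K) / sqrt (real N)" .
      show ?thesis using 1 2 unfolding add_divide_distrib by linarith
    qed
    \<comment> \<open>Evenness removes the absolute value, so that one factor can be expanded
      linearly over the sites.\<close>
    have "even (Suc J)" by (simp add: J_def)
    have "ev N m0 (pi/2) 2 (\<lambda>\<tau>. \<bar>overlap N a b \<tau>\<bar> ^ Suc J) = ev N m0 (pi/2) 2 (\<lambda>\<tau>. overlap N a b \<tau> * overlap N a b \<tau> ^ J)"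
      unfolding power_even_abs[OF \<open>even (Suc J)\<close>] unfolding power_Suc ..
    also have "\<dots> = ev N m0 (pi/2) 2 (\<lambda>\<tau>. 1 / sqrt (real N) * (\<Sum>m\<in>{1..N}. x m \<tau> * overlap N a b \<tau> ^ J))"
      by (subst (1) overlap_eq_sum[OF N(1)]) (simp only: x_def sum_distrib_right mult.assoc)
    \<comment> \<open>Each summand is moved to the path of its own site. The \<open>N\<close>
      summands of size \<open>1 / sqrt N\<close> are compensated by the prefactor.\<close>
    also have "\<dots> = 1 / sqrt (real N) * (\<Sum>m\<in>{1..N}. ev N m (pi/2) 2 (\<lambda>\<tau>. x m \<tau> * overlap N a b \<tau> ^ J))"
      unfolding ev_cmult ev_sum using ev_end_indep[OF m0] by simp
    also have "\<dots> \<le> 1 / sqrt (real N) * (\<Sum>m\<in>{1..N}. (192 * \<beta>\<^sup>2 * real S ^ 4 * E * (2 * A N m0 + 2 * K) + C') / sqrt (real N))"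
      by (intro mult_left_mono sum_mono order_trans[OF abs_ge_self step]) auto
    also have "\<dots> = 192 * \<beta>\<^sup>2 * real S ^ 4 * E * (2 * A N m0 + 2 * K) + C'"
      using N by simp
    finally show ?thesis .
  qed
  define c where "c = \<beta>\<^sup>2 * (1536 * real S ^ 4 * E)"
  have c: "c \<le> 1" using small by (simp add: c_def E_def)
  have "A N m \<le> 2 * K + 4 * C'" if m: "m \<in> {1..N}" for N m
  proof -
    have A0: "A N m \<ge> 0" unfolding A_def by (intro add_nonneg_nonneg ev_nonneg) auto
    \<comment> \<open>Self-consistency: the finite quantity \<open>A N m\<close> is bounded by half
      of itself plus constants free of \<open>N\<close>, so it can be absorbed on the left.\<close>
    have "A N m \<le> 2 * (192 * \<beta>\<^sup>2 * real S ^ 4 * E * (2 * A N m + 2 * K) + C')"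
      using one[OF m, of 1 2] one[OF m, of 1 1] unfolding A_def by simp
    also have "\<dots> = c * (A N m / 2) + c * (K / 2) + 2 * C'"
      by (simp add: c_def algebra_simps)
    also have "\<dots> \<le> 1 * (A N m / 2) + 1 * (K / 2) + 2 * C'"
      using c A0 K(1) by (intro add_mono order_refl mult_right_mono) auto
    finally show ?thesis using K(1) by simp
  qed
  note A_le = this
  have "ev N m (pi/2) 2 (\<lambda>\<tau>. \<bar>overlap N 1 2 \<tau>\<bar> ^ Suc J) \<le> 2 * K + 4 * C'
     \<and> ev N m (pi/2) 2 (\<lambda>\<tau>. \<bar>overlap N 1 1 \<tau>\<bar> ^ Suc J) \<le> 2 * K + 4 * C'" if "m \<in> {1..N}" for N m
  proof -
    have "ev N m (pi/2) 2 (\<lambda>\<tau>. \<bar>overlap N a b \<tau>\<bar> ^ Suc J) \<ge> 0" for a b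
      by (rule ev_nonneg) simp
    from this[of 1 2] this[of 1 1] A_le[OF that] show ?thesis unfolding A_def by linarith
  qed
  then show ?case unfolding J_def by (intro exI[of _ "2 * K + 4 * C'"]) simp
qed

end

section \<open>Single-site averages of centred spin products\<close>

definition dlt :: "nat \<Rightarrow> nat \<Rightarrow> nat \<Rightarrow> real" where
  "dlt k k' a = (if a = k then 1 else 0) - (if a = k' then 1 else 0)"

lemma sum_dlt:
  assumes "finite I" "k \<in> I" "k' \<in> I"
  shows "(\<Sum>a\<in>I. dlt k k' a * x a) = x k - x k'"
  using assms by (simp add: dlt_def left_diff_distrib sum_subtractf if_distrib[of "\<lambda>y. y * _"] cong: if_cong)

context sk_model
begin

abbreviation A where "A \<equiv> A_const S \<beta> D hf p q"

lemma avg_four: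
  assumes "finite C"
  shows "avg C G 4 (\<lambda>s. h1 (s 1) * h2 (s 2) * h3 (s 3) * h4 (s 4))
    = (\<Sum>x\<in>C. h1 x * G x) * (\<Sum>x\<in>C. h2 x * G x) * (\<Sum>x\<in>C. h3 x * G x) * (\<Sum>x\<in>C. h4 x * G x)"
proof -
  have e: "{1..4::nat} = {1,2,3,4}" by auto
  define h where "h = (\<lambda>k::nat. if k = 1 then h1 else if k = 2 then h2 else if k = 3 then h3 else h4)"
  have "avg C G 4 (\<lambda>s. \<Prod>k\<in>{1..4}. h k (s k)) = (\<Prod>k\<in>{1..4}. \<Sum>x\<in>C. h k x * G x)"
    by (rule avg_prod_coords[OF assms])
  then show ?thesis unfolding e by (simp add: h_def mult.assoc)
qed

text \<open>Given \<open>\<eta>\<close> the replicas are independent, so the pair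
  \<open>k, k'\<close> and the pair \<open>l, l'\<close> each contribute the conditional variance of
  a spin; \<open>A\<close> is the mean of its square.\<close>

lemma site_avg_lead_base:
  assumes "distinct [k, k', l, l']" "set [k, k', l, l'] \<subseteq> {1..n}"
  shows "site_avg n (\<lambda>s. (of_int (s k) - of_int (s k')) * (of_int (s l) - of_int (s l')) * (of_int (s k) * of_int (s l))) = A"
proof -
  define \<pi> where "\<pi> = (\<lambda>i::nat. if i = 1 then k else if i = 2 then k' else if i = 3 then l else l')"
  \<comment> \<open>The factors 1 give every monomial the four-replica form that
    \<open>avg_four\<close> evaluates.\<close>
  define \<Phi> where "\<Phi> = (\<lambda>s::nat \<Rightarrow> int. real_of_int (s 1) ^ 2 * 1 * of_int (s 3) ^ 2 * 1 - of_int (s 1) ^ 2 * 1 * of_int (s 3) * of_int (s 4)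
     - (of_int (s 1) * of_int (s 2) * of_int (s 3) ^ 2 * 1 - of_int (s 1) * of_int (s 2) * of_int (s 3) * of_int (s 4)))"
  have e: "{1..4::nat} = {1,2,3,4}" by auto
  have dep: "dep 4 \<Phi>" unfolding \<Phi>_def dep_def by simp
  have "inj_on \<pi> {1..4}" "\<pi> ` {1..4} \<subseteq> {1..n}"
    using assms unfolding e by (auto simp: \<pi>_def inj_on_def)
  from site_avg_reindex[OF this dep]
  have "site_avg n (\<lambda>s. (of_int (s k) - of_int (s k')) * (of_int (s l) - of_int (s l')) * (of_int (s k) * of_int (s l))) = site_avg 4 \<Phi>"
    by (simp add: \<pi>_def \<Phi>_def algebra_simps power2_eq_square)
  also have "\<dots> = A"
    unfolding site_avg_def A_const_def
  proof (rule Bochner_Integration.integral_cong[OF refl])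
    fix \<eta> :: real
    let ?G = "boltzmann (spins S) (site_energy \<eta>)"
    let ?m = "\<lambda>\<phi>::real \<Rightarrow> real. \<Sum>s\<in>spins S. \<phi> (of_int s) * ?G s"
    have one: "(\<Sum>s\<in>spins S. 1 * ?G s) = 1" by (simp add: boltzmann_sum)
    note four = avg_four[OF finite_spins, where G = ?G]
    have "avg (spins S) ?G 4 \<Phi> = ?m (\<lambda>x. x ^ 2) * 1 * ?m (\<lambda>x. x ^ 2) * 1 - ?m (\<lambda>x. x ^ 2) * 1 * ?m (\<lambda>x. x) * ?m (\<lambda>x. x)
      - (?m (\<lambda>x. x) * ?m (\<lambda>x. x) * ?m (\<lambda>x. x ^ 2) * 1 - ?m (\<lambda>x. x) * ?m (\<lambda>x. x) * ?m (\<lambda>x. x) * ?m (\<lambda>x. x))"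
      unfolding \<Phi>_def avg_diff
      unfolding four[where ?h1.0 = "\<lambda>x. real_of_int x ^ 2" and ?h2.0 = "\<lambda>_. 1" and ?h3.0 = "\<lambda>x. real_of_int x ^ 2" and ?h4.0 = "\<lambda>_. 1"]
        four[where ?h1.0 = "\<lambda>x. real_of_int x ^ 2" and ?h2.0 = "\<lambda>_. 1" and ?h3.0 = real_of_int and ?h4.0 = real_of_int]
        four[where ?h1.0 = real_of_int and ?h2.0 = real_of_int and ?h3.0 = "\<lambda>x. real_of_int x ^ 2" and ?h4.0 = "\<lambda>_. 1"]
        four[where ?h1.0 = real_of_int and ?h2.0 = real_of_int and ?h3.0 = real_of_int and ?h4.0 = real_of_int] one ..
    also have "\<dots> = (?m (\<lambda>x. x ^ 2) - (?m (\<lambda>x. x)) ^ 2) ^ 2"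
      by (simp only: mult_1_right power2_eq_square) (simp only: algebra_simps)
    finally show "avg (spins S) ?G 4 \<Phi> = (eta_avg S \<beta> D hf p q \<eta> (\<lambda>s. s\<^sup>2) - (eta_avg S \<beta> D hf p q \<eta> (\<lambda>s. s))\<^sup>2)\<^sup>2"
      unfolding eta_avg_boltzmann .
  qed
  finally show ?thesis .
qed

lemma site_avg_antisymmetric:
  assumes k: "k \<in> {1..n}" "k' \<in> {1..n}" and f: "dep n f"
    and anti: "\<And>s. f (s(k := s k', k' := s k)) = - f s"
  shows "site_avg n f = 0"
proof -
  let ?\<pi> = "id(k := k', k' := k)"
  have "inj_on ?\<pi> {1..n}" by (auto simp: inj_on_def)
  moreover have "?\<pi> ` {1..n} \<subseteq> {1..n}" using k by auto
  ultimately have "site_avg n (\<lambda>s. f (\<lambda>i. s (?\<pi> i))) = site_avg n f" by (rule site_avg_reindex[OF _ _ f])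
  moreover have "f (\<lambda>i. s (?\<pi> i)) = - 1 * f s" for s
  proof -
    have "(\<lambda>i. s (?\<pi> i)) = s(k := s k', k' := s k)" by (auto simp: fun_eq_iff)
    then show ?thesis by (simp only: anti mult_minus1)
  qed
  ultimately have "site_avg n (\<lambda>s. - 1 * f s) = site_avg n f" by (simp only:)
  then show ?thesis unfolding site_avg_cmult by simp
qed

lemma site_avg_lead:
  assumes dist: "distinct [k, k', l, l']" and sub: "set [k, k', l, l'] \<subseteq> {1..n}"
  shows "site_avg n (\<lambda>s. (of_int (s k) - of_int (s k')) * (of_int (s l) - of_int (s l'))) = 0"
proof (rule site_avg_antisymmetric[of k n k'])
  show "dep n (\<lambda>s::nat \<Rightarrow> int. (real_of_int (s k) - of_int (s k')) * (of_int (s l) - of_int (s l')))"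
    using sub by (intro dep_mult dep_diff dep_coord[where h = real_of_int]) auto
qed (use sub dist in \<open>auto simp: algebra_simps\<close>)

text \<open>The weight is odd under exchanging \<open>k\<close> with \<open>k'\<close> and under
  exchanging \<open>l\<close> with \<open>l'\<close>. A spin product survives only if it breaks both
  symmetries, that is, has one index in each pair; the two summands are the two ways to do
  so.\<close>

lemma site_avg_lead_pair:
  assumes dist: "distinct [k, k', l, l']" and sub: "set [k, k', l, l'] \<subseteq> {1..n}" and ab: "a \<in> {1..n}" "b \<in> {1..n}"
  shows "site_avg n (\<lambda>s. (of_int (s k) - of_int (s k')) * (of_int (s l) - of_int (s l')) * (of_int (s a) * of_int (s b)))
    = A * (dlt k k' a * dlt l l' b + dlt k k' b * dlt l l' a)"
proof -
  let ?f = "\<lambda>k k' l l' a b. \<lambda>s::nat \<Rightarrow> int. (real_of_int (s k) - of_int (s k')) * (of_int (s l) - of_int (s l')) * (of_int (s a) * of_int (s b))"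
  have dep: "dep n (?f k k' l l' a b)"
    using sub ab by (intro dep_mult dep_diff dep_coord[where h = real_of_int]) auto
  have cross: "site_avg n (?f k k' l l' a b) = A * (dlt k k' a * dlt l l' b)" if "a \<in> {k, k'}" "b \<in> {l, l'}" for a b
  proof -
    have neg1: "?f k k' l l' a b = (\<lambda>s. - 1 * ?f k' k l l' a b s)" for k k' l l' a b by (simp add: fun_eq_iff algebra_simps)
    have neg2: "?f k k' l l' a b = (\<lambda>s. - 1 * ?f k k' l' l a b s)" for k k' l l' a b by (simp add: fun_eq_iff algebra_simps)
    have "site_avg n (?f k k' l l' k l) = A" using site_avg_lead_base[OF dist sub] .
    moreover have "site_avg n (?f k k' l l' k' l) = - A"
      unfolding neg1[of k k'] site_avg_cmult using site_avg_lead_base[of k' k l l' n] dist sub by auto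
    moreover have "site_avg n (?f k k' l l' k l') = - A"
      unfolding neg2[of k k' l l'] site_avg_cmult using site_avg_lead_base[of k k' l' l n] dist sub by auto
    moreover have "site_avg n (?f k k' l l' k' l') = A"
      unfolding neg2[of k k' l l'] neg1[of k k' l' l] site_avg_cmult using site_avg_lead_base[of k' k l' l n] dist sub by auto
    ultimately show ?thesis using that dist by (auto simp: dlt_def)
  qed
  \<comment> \<open>The pairs are disjoint, so two indices either miss one of them altogether or
    meet each of them exactly once.\<close>
  consider "a \<notin> {k, k'}" "b \<notin> {k, k'}" | "a \<notin> {l, l'}" "b \<notin> {l, l'}" | "a \<in> {k, k'}" "b \<in> {l, l'}" | "b \<in> {k, k'}" "a \<in> {l, l'}"
    using dist by auto
  then show ?thesis
  proof cases
    case 1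
    have "site_avg n (?f k k' l l' a b) = 0"
      by (rule site_avg_antisymmetric[OF _ _ dep, of k k']) (use 1 sub dist in \<open>auto simp: algebra_simps\<close>)
    then show ?thesis using 1 by (simp add: dlt_def)
  next
    case 2
    have "site_avg n (?f k k' l l' a b) = 0"
      by (rule site_avg_antisymmetric[OF _ _ dep, of l l']) (use 2 sub dist in \<open>auto simp: algebra_simps\<close>)
    then show ?thesis using 2 by (simp add: dlt_def)
  next
    case 3
    then have "dlt k k' b = 0" using dist by (auto simp: dlt_def)
    then show ?thesis using cross[OF 3] by simp
  next
    case 4
    then have "dlt k k' a = 0" using dist by (auto simp: dlt_def)
    moreover have "?f k k' l l' a b = ?f k k' l l' b a" by (simp add: fun_eq_iff mult_ac)
    ultimately show ?thesis using cross[OF 4] by simp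
  qed
qed

text \<open>The spin variance given \<open>\<eta>\<close> is bounded by \<open>S^2\<close>. The
  bound on \<open>A\<close> makes \<open>1 - \<beta>^2 * A\<close> positive for small
  \<open>\<beta>\<close>.\<close>

lemma A_bounds: "0 \<le> A" "A \<le> real S ^ 4"
proof -
  show "0 \<le> A" unfolding A_const_def by (rule Bochner_Integration.integral_nonneg) simp
  interpret prob_space std_normal_measure by (rule prob_space_std_normal)
  let ?m = "\<lambda>\<eta> \<phi>. eta_avg S \<beta> D hf p q \<eta> \<phi>"
  have meas [measurable]: "(\<lambda>\<eta>. ?m \<eta> \<phi>) \<in> borel_measurable borel" for \<phi>
    unfolding eta_avg_boltzmann boltzmann_def site_energy_def by measurable
  have b: "\<bar>(?m \<eta> (\<lambda>s. s\<^sup>2) - (?m \<eta> (\<lambda>s. s))\<^sup>2)\<^sup>2\<bar> \<le> real S ^ 4" for \<eta>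
  proof -
    have m1: "\<bar>?m \<eta> (\<lambda>s. s)\<bar> \<le> real S" by (rule eta_avg_bounds) (rule abs_spin_le)
    then have m1': "(?m \<eta> (\<lambda>s. s))\<^sup>2 \<le> (real S)\<^sup>2" using power_mono[OF m1, of 2] by simp
    have "\<bar>?m \<eta> (\<lambda>s. s\<^sup>2)\<bar> \<le> (real S)\<^sup>2"
      by (rule eta_avg_bounds) (simp add: abs_le_square_iff[symmetric] abs_spin_le)
    moreover have "0 \<le> ?m \<eta> (\<lambda>s. s\<^sup>2)"
      unfolding eta_avg_boltzmann by (intro sum_nonneg mult_nonneg_nonneg boltzmann_nonneg) auto
    ultimately have "\<bar>?m \<eta> (\<lambda>s. s\<^sup>2) - (?m \<eta> (\<lambda>s. s))\<^sup>2\<bar> \<le> (real S)\<^sup>2"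
      using m1' zero_le_power2[of "?m \<eta> (\<lambda>s. s)"] by linarith
    from power_mono[OF this, of 2] show ?thesis by (simp add: power_mult[symmetric])
  qed
  have "A \<le> (\<integral>\<eta>. real S ^ 4 \<partial>std_normal_measure)"
    unfolding A_const_def
    by (rule integral_mono[OF integrable_std_normal_bounded[OF _ b]]) (use b in \<open>auto simp: abs_le_iff\<close>)
  then show "A \<le> real S ^ 4" by (simp add: prob_space[simplified])
qed

end

text \<open>Orders are counted in powers of \<open>1 / sqrt N\<close>. The site is carried as an
  argument so that the constants are uniform in it and estimates can be summed over sites.\<close>

definition big_O :: "nat \<Rightarrow> (nat \<Rightarrow> nat \<Rightarrow> real) \<Rightarrow> bool" where
  "big_O k g \<longleftrightarrow> (\<exists>C. \<forall>N m. m \<in> {1..N} \<longrightarrow> \<bar>g N m\<bar> \<le> C / sqrt (real N) ^ k)"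

lemma big_OI: "(\<And>N m. m \<in> {1..N} \<Longrightarrow> \<bar>g N m\<bar> \<le> C / sqrt (real N) ^ k) \<Longrightarrow> big_O k g"
  unfolding big_O_def by blast

lemma big_O_cong: "big_O k g \<Longrightarrow> (\<And>N m. m \<in> {1..N} \<Longrightarrow> g' N m = g N m) \<Longrightarrow> big_O k g'"
  unfolding big_O_def by simp

lemma big_O_add: 
  assumes "big_O k g" "big_O k h"
  shows "big_O k (\<lambda>N m. g N m + h N m)"
proof -
  from assms obtain C C' where *: "\<And>N m. m \<in> {1..N} \<Longrightarrow> \<bar>g N m\<bar> \<le> C / sqrt (real N) ^ k"
    "\<And>N m. m \<in> {1..N} \<Longrightarrow> \<bar>h N m\<bar> \<le> C' / sqrt (real N) ^ k" unfolding big_O_def by blast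
  show ?thesis
  proof (rule big_OI)
    fix N m :: nat assume m: "m \<in> {1..N}"
    show "\<bar>g N m + h N m\<bar> \<le> (C + C') / sqrt (real N) ^ k"
      using *(1)[OF m] *(2)[OF m] unfolding add_divide_distrib by linarith
  qed
qed

lemma big_O_cmult:
  assumes "big_O k g"
  shows "big_O k (\<lambda>N m. c * g N m)"
proof -
  from assms obtain C where *: "\<And>N m. m \<in> {1..N} \<Longrightarrow> \<bar>g N m\<bar> \<le> C / sqrt (real N) ^ k"
    unfolding big_O_def by blast
  show ?thesis
    by (rule big_OI[where C = "\<bar>c\<bar> * C"])
      (use mult_left_mono[OF *, of _ _ "\<bar>c\<bar>"] in \<open>simp add: abs_mult\<close>)
qed

lemma big_O_diff: "big_O k g \<Longrightarrow> big_O k h \<Longrightarrow> big_O k (\<lambda>N m. g N m - h N m)"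
  using big_O_add[of k g "\<lambda>N m. - 1 * h N m"] big_O_cmult[of k h "- 1"] by simp

lemma big_O_zero: "big_O k (\<lambda>_ _. 0)"
  by (rule big_OI[where C = 0]) simp

lemma big_O_sum: "finite I \<Longrightarrow> (\<And>i. i \<in> I \<Longrightarrow> big_O k (g i)) \<Longrightarrow> big_O k (\<lambda>N m. \<Sum>i\<in>I. g i N m)"
  by (induction I rule: finite_induct) (simp_all add: big_O_add big_O_zero)

lemma big_O_scale:
  assumes "big_O k g"
  shows "big_O (Suc k) (\<lambda>N m. 1 / sqrt (real N) * g N m)"
proof -
  from assms obtain C where *: "\<And>N m. m \<in> {1..N} \<Longrightarrow> \<bar>g N m\<bar> \<le> C / sqrt (real N) ^ k"
    unfolding big_O_def by blast
  show ?thesis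
    by (rule big_OI[where C = C]) (use mult_left_mono[OF *, of _ _ "1 / sqrt (real N)" for N] in \<open>simp add: abs_mult\<close>)
qed

lemma le_one_plus_square: "0 \<le> t \<Longrightarrow> t \<le> 1 + t\<^sup>2" for t :: real
  using zero_le_power2[of "t - 1"] by (simp add: power2_diff)

lemma mult_le_sum_squares: "0 \<le> a \<Longrightarrow> 0 \<le> b \<Longrightarrow> a * b \<le> a\<^sup>2 + b\<^sup>2" for a b :: real
proof -
  assume "0 \<le> a" "0 \<le> b"
  then have "0 \<le> a * b" by simp
  moreover have "2 * (a * b) \<le> a\<^sup>2 + b\<^sup>2"
    using zero_le_power2[of "a - b"] by (simp add: power2_diff)
  ultimately show ?thesis by linarith
qed

section \<open>Observables with bounded moments along the whole path\<close>

context sk_model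
begin

text \<open>Asking for all orders makes the class closed under products, and uniformity in
  \<open>\<theta>\<close> allows the drift to be controlled at intermediate points. Remainders then
  need no estimates of their own.\<close>

definition moments_bounded :: "nat \<Rightarrow> (nat \<Rightarrow> nat \<Rightarrow> (nat \<Rightarrow> nat \<Rightarrow> int) \<Rightarrow> real) \<Rightarrow> bool" where
  "moments_bounded n F \<longleftrightarrow> (\<forall>j. \<exists>C. \<forall>N m \<theta>. m \<in> {1..N} \<longrightarrow> \<theta> \<in> {0..pi/2} \<longrightarrow>
     ev N m \<theta> n (\<lambda>\<tau>. \<bar>F N m \<tau>\<bar> ^ j) \<le> C)"

lemma moments_boundedD:
  assumes "moments_bounded n F"
  obtains C :: real where "\<And>N m \<theta>. m \<in> {1..N} \<Longrightarrow> \<theta> \<in> {0..pi/2} \<Longrightarrow> ev N m \<theta> n (\<lambda>\<tau>. \<bar>F N m \<tau>\<bar> ^ j) \<le> C"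
  using assms unfolding moments_bounded_def by blast

lemma moments_bounded_ev:
  assumes "moments_bounded n F"
  obtains C :: real where "\<And>N m \<theta>. m \<in> {1..N} \<Longrightarrow> \<theta> \<in> {0..pi/2} \<Longrightarrow> \<bar>ev N m \<theta> n (F N m)\<bar> \<le> C"
proof -
  obtain C where C: "\<And>N m \<theta>. m \<in> {1..N} \<Longrightarrow> \<theta> \<in> {0..pi/2} \<Longrightarrow> ev N m \<theta> n (\<lambda>\<tau>. \<bar>F N m \<tau>\<bar> ^ 1) \<le> C"
    using moments_boundedD[OF assms, where j = 1] by metis
  show ?thesis
    by (rule that[of C]) (use order_trans[OF abs_ev_le C[simplified power_one_right]] in simp)
qed

lemma moments_bounded_bounded:
  assumes "\<And>N m \<tau>. m \<in> {1..N} \<Longrightarrow> \<tau> \<in> PiE {1..n} (\<lambda>_. configs S N) \<Longrightarrow> \<bar>F N m \<tau>\<bar> \<le> B"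
  shows "moments_bounded n F"
  unfolding moments_bounded_def
proof (intro allI exI impI)
  fix j N m :: nat and \<theta> :: real assume "m \<in> {1..N}"
  then have "ev N m \<theta> n (\<lambda>\<tau>. \<bar>F N m \<tau>\<bar> ^ j) \<le> ev N m \<theta> n (\<lambda>_. B ^ j)"
    by (intro ev_mono power_mono assms) auto
  then show "ev N m \<theta> n (\<lambda>\<tau>. \<bar>F N m \<tau>\<bar> ^ j) \<le> B ^ j" by (simp add: ev_const)
qed

lemma moments_bounded_const: "moments_bounded n (\<lambda>_ _ _. c)"
  by (rule moments_bounded_bounded[of _ _ "\<bar>c\<bar>"]) simp

lemma moments_bounded_add:
  assumes "moments_bounded n F" "moments_bounded n G"
  shows "moments_bounded n (\<lambda>N m \<tau>. F N m \<tau> + G N m \<tau>)"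
  unfolding moments_bounded_def
proof
  fix j
  obtain C C' where C: "\<And>N m \<theta>. m \<in> {1..N} \<Longrightarrow> \<theta> \<in> {0..pi/2} \<Longrightarrow> ev N m \<theta> n (\<lambda>\<tau>. \<bar>F N m \<tau>\<bar> ^ j) \<le> C"
    "\<And>N m \<theta>. m \<in> {1..N} \<Longrightarrow> \<theta> \<in> {0..pi/2} \<Longrightarrow> ev N m \<theta> n (\<lambda>\<tau>. \<bar>G N m \<tau>\<bar> ^ j) \<le> C'"
    using assms unfolding moments_bounded_def by metis
  have "ev N m \<theta> n (\<lambda>\<tau>. \<bar>F N m \<tau> + G N m \<tau>\<bar> ^ j) \<le> 2 ^ j * (C + C')" if "m \<in> {1..N}" "\<theta> \<in> {0..pi/2}" for N m \<theta>
  proof -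
    have "ev N m \<theta> n (\<lambda>\<tau>. \<bar>F N m \<tau> + G N m \<tau>\<bar> ^ j) \<le> ev N m \<theta> n (\<lambda>\<tau>. 2 ^ j * (\<bar>F N m \<tau>\<bar> ^ j + \<bar>G N m \<tau>\<bar> ^ j))"
      by (intro ev_mono abs_add_power_le)
    also have "\<dots> \<le> 2 ^ j * (C + C')"
      unfolding ev_cmult ev_add by (intro mult_left_mono add_mono C that) auto
    finally show ?thesis .
  qed
  then show "\<exists>C. \<forall>N m \<theta>. m \<in> {1..N} \<longrightarrow> \<theta> \<in> {0..pi/2} \<longrightarrow> ev N m \<theta> n (\<lambda>\<tau>. \<bar>F N m \<tau> + G N m \<tau>\<bar> ^ j) \<le> C"
    by blast
qed

lemma moments_bounded_mult:
  assumes "moments_bounded n F" "moments_bounded n G"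
  shows "moments_bounded n (\<lambda>N m \<tau>. F N m \<tau> * G N m \<tau>)"
  unfolding moments_bounded_def
proof
  fix j
  obtain C C' where C: "\<And>N m \<theta>. m \<in> {1..N} \<Longrightarrow> \<theta> \<in> {0..pi/2} \<Longrightarrow> ev N m \<theta> n (\<lambda>\<tau>. \<bar>F N m \<tau>\<bar> ^ (2 * j)) \<le> C"
    "\<And>N m \<theta>. m \<in> {1..N} \<Longrightarrow> \<theta> \<in> {0..pi/2} \<Longrightarrow> ev N m \<theta> n (\<lambda>\<tau>. \<bar>G N m \<tau>\<bar> ^ (2 * j)) \<le> C'"
    using assms unfolding moments_bounded_def by metis
  have "ev N m \<theta> n (\<lambda>\<tau>. \<bar>F N m \<tau> * G N m \<tau>\<bar> ^ j) \<le> C + C'" if "m \<in> {1..N}" "\<theta> \<in> {0..pi/2}" for N m \<theta>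
  proof -
    have "\<bar>x * y\<bar> ^ j \<le> \<bar>x\<bar> ^ (2 * j) + \<bar>y\<bar> ^ (2 * j)" for x y :: real
      unfolding mult.commute[of 2 j] power_mult abs_mult power_mult_distrib by (rule mult_le_sum_squares) auto
    then have "ev N m \<theta> n (\<lambda>\<tau>. \<bar>F N m \<tau> * G N m \<tau>\<bar> ^ j) \<le> ev N m \<theta> n (\<lambda>\<tau>. \<bar>F N m \<tau>\<bar> ^ (2 * j) + \<bar>G N m \<tau>\<bar> ^ (2 * j))"
      by (intro ev_mono)
    also have "\<dots> \<le> C + C'"
      unfolding ev_add by (intro add_mono C that)
    finally show ?thesis .
  qed
  then show "\<exists>C. \<forall>N m \<theta>. m \<in> {1..N} \<longrightarrow> \<theta> \<in> {0..pi/2} \<longrightarrow> ev N m \<theta> n (\<lambda>\<tau>. \<bar>F N m \<tau> * G N m \<tau>\<bar> ^ j) \<le> C"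
    by blast
qed

lemma moments_bounded_sum:
  "finite I \<Longrightarrow> (\<And>i. i \<in> I \<Longrightarrow> moments_bounded n (F i)) \<Longrightarrow> moments_bounded n (\<lambda>N m \<tau>. \<Sum>i\<in>I. F i N m \<tau>)"
  by (induction I rule: finite_induct) (simp_all add: moments_bounded_add moments_bounded_const)

lemma moments_bounded_prod:
  "finite I \<Longrightarrow> (\<And>i. i \<in> I \<Longrightarrow> moments_bounded n (F i)) \<Longrightarrow> moments_bounded n (\<lambda>N m \<tau>. \<Prod>i\<in>I. F i N m \<tau>)"
  by (induction I rule: finite_induct) (simp_all add: moments_bounded_mult moments_bounded_const)

lemma moments_bounded_more_replicas:
  assumes "moments_bounded n F" "\<And>N m. dep n (F N m)" "n \<le> n'"
  shows "moments_bounded n' F"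
proof -
  have "ev N m \<theta> n' (\<lambda>\<tau>. \<bar>F N m \<tau>\<bar> ^ j) = ev N m \<theta> n (\<lambda>\<tau>. \<bar>F N m \<tau>\<bar> ^ j)" for N m \<theta> j
    by (rule ev_more_replicas[OF _ assms(3)]) (rule dep_comp[OF assms(2)])
  then show ?thesis using assms(1) unfolding moments_bounded_def by simp
qed

lemma moments_bounded_spin:
  assumes "a \<in> {1..n}"
  shows "moments_bounded n (\<lambda>N m \<tau>. of_int (\<tau> a m))"
  by (rule moments_bounded_bounded[of _ _ "real S"]) (rule abs_spin_le, rule configs_spin, use assms in auto)

lemma moments_bounded_inverse_sqrt: "moments_bounded n (\<lambda>N m \<tau>. 1 / sqrt (real N))"
  by (rule moments_bounded_bounded[of _ _ 1]) (auto simp: divide_le_eq)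

lemmas moments_bounded_intros = moments_bounded_const moments_bounded_add moments_bounded_mult
  moments_bounded_sum moments_bounded_prod moments_bounded_spin moments_bounded_inverse_sqrt

text \<open>The remainder is kept as a function rather than as an estimate, because it is multiplied
  by a further spin factor before averaging.\<close>

lemma product_expansion:
  assumes "finite J" "\<And>j. j \<in> J \<Longrightarrow> moments_bounded n (X j)" "\<And>j. j \<in> J \<Longrightarrow> moments_bounded n (Y j)"
  shows "\<exists>R. moments_bounded n R \<and> (\<forall>N m \<tau>. (\<Prod>j\<in>J. X j N m \<tau> + 1 / sqrt (real N) * Y j N m \<tau>)
    = (\<Prod>j\<in>J. X j N m \<tau>) + 1 / sqrt (real N) * (\<Sum>j\<in>J. Y j N m \<tau> * (\<Prod>i\<in>J-{j}. X i N m \<tau>))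
      + 1 / sqrt (real N) * (1 / sqrt (real N) * R N m \<tau>))"
  using assms
proof (induction J rule: finite_induct)
  case empty
  show ?case by (rule exI[of _ "\<lambda>_ _ _. 0"]) (simp add: moments_bounded_const)
next
  case (insert j0 J)
  then obtain R where R: "moments_bounded n R" "\<And>N m \<tau>. (\<Prod>j\<in>J. X j N m \<tau> + 1 / sqrt (real N) * Y j N m \<tau>)
    = (\<Prod>j\<in>J. X j N m \<tau>) + 1 / sqrt (real N) * (\<Sum>j\<in>J. Y j N m \<tau> * (\<Prod>i\<in>J-{j}. X i N m \<tau>))
      + 1 / sqrt (real N) * (1 / sqrt (real N) * R N m \<tau>)"
    by auto
  define L where "L = (\<lambda>N m \<tau>. \<Sum>j\<in>J. Y j N m \<tau> * (\<Prod>i\<in>J-{j}. X i N m \<tau>))"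
  \<comment> \<open>The terms of order at least two when the new factor multiplies the expansion
    already obtained.\<close>
  define R' where "R' = (\<lambda>N m \<tau>. Y j0 N m \<tau> * L N m \<tau> + X j0 N m \<tau> * R N m \<tau> + 1 / sqrt (real N) * (Y j0 N m \<tau> * R N m \<tau>))"
  have "moments_bounded n R'"
    unfolding R'_def L_def using insert.prems insert.hyps
    by (intro moments_bounded_intros R(1)) auto
  moreover have "(\<Prod>j\<in>insert j0 J. X j N m \<tau> + 1 / sqrt (real N) * Y j N m \<tau>)
    = (\<Prod>j\<in>insert j0 J. X j N m \<tau>) + 1 / sqrt (real N) * (\<Sum>j\<in>insert j0 J. Y j N m \<tau> * (\<Prod>i\<in>insert j0 J-{j}. X i N m \<tau>))
      + 1 / sqrt (real N) * (1 / sqrt (real N) * R' N m \<tau>)" for N m \<tau>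
  proof -
    have "(\<Sum>j\<in>J. Y j N m \<tau> * (\<Prod>i\<in>insert j0 J-{j}. X i N m \<tau>)) = (\<Sum>j\<in>J. X j0 N m \<tau> * (Y j N m \<tau> * (\<Prod>i\<in>J-{j}. X i N m \<tau>)))"
    proof (intro sum.cong refl)
      fix j assume j: "j \<in> J"
      then have "insert j0 J - {j} = insert j0 (J - {j})" using insert.hyps by auto
      then show "Y j N m \<tau> * (\<Prod>i\<in>insert j0 J-{j}. X i N m \<tau>) = X j0 N m \<tau> * (Y j N m \<tau> * (\<Prod>i\<in>J-{j}. X i N m \<tau>))"
        using insert.hyps by simp
    qed
    then have "(\<Sum>j\<in>insert j0 J. Y j N m \<tau> * (\<Prod>i\<in>insert j0 J-{j}. X i N m \<tau>)) = Y j0 N m \<tau> * (\<Prod>j\<in>J. X j N m \<tau>) + X j0 N m \<tau> * L N m \<tau>"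
      using insert.hyps by (simp add: L_def sum_distrib_left)
    moreover have "(\<Prod>j\<in>insert j0 J. X j N m \<tau> + 1 / sqrt (real N) * Y j N m \<tau>)
      = (X j0 N m \<tau> + 1 / sqrt (real N) * Y j0 N m \<tau>) * ((\<Prod>j\<in>J. X j N m \<tau>) + 1 / sqrt (real N) * L N m \<tau> + 1 / sqrt (real N) * (1 / sqrt (real N) * R N m \<tau>))"
      using insert.hyps R(2) by (simp add: L_def)
    moreover have "(\<Prod>j\<in>insert j0 J. X j N m \<tau>) = X j0 N m \<tau> * (\<Prod>j\<in>J. X j N m \<tau>)"
      using insert.hyps by simp
    moreover have "(x + s * y) * (P + s * l + s * (s * r)) = x * P + s * (y * P + x * l) + s * (s * (y * l + x * r + s * (y * r)))"
      for x y s P l r :: real by (simp add: algebra_simps)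
    ultimately show ?thesis unfolding R'_def by (simp only:)
  qed
  ultimately show ?case by blast
qed

end

context sk_small
begin

text \<open>The recursion yields even moments at the end of the path only. Odd orders follow from
  \<open>t \<le> 1 + t^2\<close>, intermediate angles from the Gronwall comparison.\<close>

lemma moments_bounded_cavity_overlap:
  assumes ab: "a \<in> {1..n}" "b \<in> {1..n}"
  shows "moments_bounded n (\<lambda>N m. cavity_overlap N m a b)"
  unfolding moments_bounded_def
proof
  fix j
  obtain C where C: "\<And>N m. m \<in> {1..N} \<Longrightarrow> ev N m (pi/2) 2 (\<lambda>\<tau>. \<bar>overlap N 1 2 \<tau>\<bar> ^ (2 * j)) \<le> C"
    "\<And>N m. m \<in> {1..N} \<Longrightarrow> ev N m (pi/2) 2 (\<lambda>\<tau>. \<bar>overlap N 1 1 \<tau>\<bar> ^ (2 * j)) \<le> C"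
    using overlap_moments by blast
  obtain K where K: "\<And>a b::real. \<bar>b\<bar> \<le> (real S)\<^sup>2 \<Longrightarrow> \<bar>a + b\<bar> ^ (2 * j) \<le> 2 * \<bar>a\<bar> ^ (2 * j) + K"
    using add_power_le_twice[of "(real S)\<^sup>2" "2 * j"] by blast
  have "ev N m \<theta> n (\<lambda>\<tau>. \<bar>cavity_overlap N m a b \<tau>\<bar> ^ j) \<le> 1 + exp (96 * real S ^ 4) * ((2 * C + K) + (2 * C + K))"
    if m: "m \<in> {1..N}" and \<theta>: "\<theta> \<in> {0..pi/2}" for N m \<theta>
  proof -
    have cav: "ev N m (pi/2) 2 (\<lambda>\<tau>. \<bar>cavity_overlap N m c d \<tau>\<bar> ^ (2 * j)) \<le> 2 * C + K"
      if "ev N m (pi/2) 2 (\<lambda>\<tau>. \<bar>overlap N c d \<tau>\<bar> ^ (2 * j)) \<le> C" "c \<in> {1..2}" "d \<in> {1..2}" for c d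
      using cavity_overlap_moment_le[OF m that(2,3) K] that(1) by simp
    have "ev N m \<theta> n (\<lambda>\<tau>. \<bar>cavity_overlap N m a b \<tau>\<bar> ^ j) \<le> ev N m \<theta> n (\<lambda>\<tau>. 1 + \<bar>cavity_overlap N m a b \<tau>\<bar> ^ (2 * j))"
      
      unfolding mult.commute[of 2 j] power_mult by (intro ev_mono le_one_plus_square) simp
    also have "\<dots> \<le> 1 + exp (96 * real S ^ 4) * (ev N m (pi/2) 2 (\<lambda>\<tau>. \<bar>cavity_overlap N m 1 2 \<tau>\<bar> ^ (2 * j))
        + ev N m (pi/2) 2 (\<lambda>\<tau>. \<bar>cavity_overlap N m 1 1 \<tau>\<bar> ^ (2 * j)))"
      unfolding ev_add ev_const by (intro add_left_mono ev_cavity_overlap_le[OF m \<theta> ab])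
    also have "\<dots> \<le> 1 + exp (96 * real S ^ 4) * ((2 * C + K) + (2 * C + K))"
      by (intro add_mono mult_left_mono cav C[OF m]) auto
    finally show ?thesis .
  qed
  then show "\<exists>C. \<forall>N m \<theta>. m \<in> {1..N} \<longrightarrow> \<theta> \<in> {0..pi/2} \<longrightarrow> ev N m \<theta> n (\<lambda>\<tau>. \<bar>cavity_overlap N m a b \<tau>\<bar> ^ j) \<le> C"
    by blast
qed

lemma dep_drift: "dep (Suc (Suc n)) (drift N m n)"
  unfolding drift_def[abs_def]
  by (intro dep_sum dep_mult dep_const dep_coord[where h = "\<lambda>x. real_of_int (x _)"] dep_cavity_overlap) auto

lemma moments_bounded_drift: "moments_bounded (Suc (Suc n)) (\<lambda>N m. drift N m n)"
  unfolding drift_def[abs_def]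
  by (intro moments_bounded_intros moments_bounded_cavity_overlap) auto

lemma moments_bounded_times_drift:
  assumes "moments_bounded n F" "\<And>N m. dep n (F N m)"
  shows "moments_bounded (Suc (Suc n)) (\<lambda>N m \<tau>. F N m \<tau> * drift N m n \<tau>)"
  by (intro moments_bounded_mult moments_bounded_drift moments_bounded_more_replicas[OF assms]) auto

lemma ev_first_order:
  assumes F: "moments_bounded n F" "\<And>N m. dep n (F N m)"
  obtains C :: real where "\<And>N m \<theta>. m \<in> {1..N} \<Longrightarrow> \<theta> \<in> {0..pi/2} \<Longrightarrow> \<bar>ev N m \<theta> n (F N m) - ev N m 0 n (F N m)\<bar> \<le> C / sqrt (real N)"
proof -
  obtain C where C: "\<And>N m \<theta>. m \<in> {1..N} \<Longrightarrow> \<theta> \<in> {0..pi/2} \<Longrightarrow> \<bar>ev N m \<theta> (Suc (Suc n)) (\<lambda>\<tau>. F N m \<tau> * drift N m n \<tau>)\<bar> \<le> C"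
    using moments_bounded_ev[OF moments_bounded_times_drift[OF F]] by metis
  show ?thesis
  proof (rule that[of "2 * \<beta>\<^sup>2 * C"])
    fix N m :: nat and \<theta> :: real assume *: "m \<in> {1..N}" "\<theta> \<in> {0..pi/2}"
    have "\<bar>ev N m \<theta> n (F N m) - ev N m 0 n (F N m) - (sin \<theta>)\<^sup>2 / 2 * (\<beta>\<^sup>2 / sqrt (real N) * 0)\<bar> \<le> 2 * (\<beta>\<^sup>2 / sqrt (real N)) * C"
      by (rule ev_taylor[OF *(1) F(2) *(2)]) (use C[OF *(1)] in auto)
    then show "\<bar>ev N m \<theta> n (F N m) - ev N m 0 n (F N m)\<bar> \<le> 2 * \<beta>\<^sup>2 * C / sqrt (real N)" by simp
  qed
qed

lemma ev_first_order_end: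
  assumes "moments_bounded n F" "\<And>N m. dep n (F N m)"
  shows "big_O 1 (\<lambda>N m. ev N m (pi/2) n (F N m) - ev N m 0 n (F N m))"
proof -
  obtain C where "\<And>N m \<theta>. m \<in> {1..N} \<Longrightarrow> \<theta> \<in> {0..pi/2} \<Longrightarrow> \<bar>ev N m \<theta> n (F N m) - ev N m 0 n (F N m)\<bar> \<le> C / sqrt (real N)"
    using ev_first_order[OF assms] by metis
  then show ?thesis by (intro big_OI[where C = C]) (auto simp: pi_ge_zero)
qed

text \<open>The drift term is itself an observable with bounded moments, so the first-order estimate
  freezes it at angle 0 up to \<open>1 / sqrt N\<close>. The coefficient
  \<open>\<beta>^2 / 2\<close> is the value of \<open>(sin \<theta>)^2 / 2\<close> at the end of the
  path times \<open>\<beta>^2\<close>.\<close>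

lemma ev_second_order_end:
  assumes F: "moments_bounded n F" "\<And>N m. dep n (F N m)"
  shows "big_O 2 (\<lambda>N m. ev N m (pi/2) n (F N m) - ev N m 0 n (F N m)
    - \<beta>\<^sup>2 / 2 * (1 / sqrt (real N) * ev N m 0 (Suc (Suc n)) (\<lambda>\<tau>. F N m \<tau> * drift N m n \<tau>)))"
proof -
  have dep: "dep (Suc (Suc n)) (\<lambda>\<tau>. F N m \<tau> * drift N m n \<tau>)" for N m
    by (intro dep_mult dep_drift dep_mono[OF F(2)]) simp
  obtain C where C: "\<And>N m \<theta>. m \<in> {1..N} \<Longrightarrow> \<theta> \<in> {0..pi/2} \<Longrightarrow>
      \<bar>ev N m \<theta> (Suc (Suc n)) (\<lambda>\<tau>. F N m \<tau> * drift N m n \<tau>) - ev N m 0 (Suc (Suc n)) (\<lambda>\<tau>. F N m \<tau> * drift N m n \<tau>)\<bar> \<le> C / sqrt (real N)"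
    by (rule ev_first_order[OF moments_bounded_times_drift[OF F] dep]) blast
  show ?thesis
  proof (rule big_OI)
    fix N m :: nat assume m: "m \<in> {1..N}"
    have "\<bar>ev N m (pi/2) n (F N m) - ev N m 0 n (F N m) - (sin (pi/2))\<^sup>2 / 2 *
       (\<beta>\<^sup>2 / sqrt (real N) * ev N m 0 (Suc (Suc n)) (\<lambda>\<tau>. F N m \<tau> * drift N m n \<tau>))\<bar> \<le> 2 * (\<beta>\<^sup>2 / sqrt (real N)) * (C / sqrt (real N))"
      by (rule ev_taylor[OF m F(2) _ C[OF m]]) auto
    then show "\<bar>ev N m (pi/2) n (F N m) - ev N m 0 n (F N m)
      - \<beta>\<^sup>2 / 2 * (1 / sqrt (real N) * ev N m 0 (Suc (Suc n)) (\<lambda>\<tau>. F N m \<tau> * drift N m n \<tau>))\<bar> \<le> (2 * \<beta>\<^sup>2 * C) / sqrt (real N) ^ 2"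
      by (simp add: power2_eq_square)
  qed
qed

end

section \<open>The cavity expansion\<close>

text \<open>The coefficients of a factor \<open>T_{k,l}\<close> whose Gibbs means are read off the
  copies \<open>k'\<close> and \<open>l'\<close>.\<close>

definition lead :: "nat \<Rightarrow> nat \<Rightarrow> nat \<Rightarrow> nat \<Rightarrow> nat \<Rightarrow> nat \<Rightarrow> real" where
  "lead k k' l l' a b = dlt k k' a * dlt l l' b"

lemma sum_sum_dlt:
  assumes "finite I" "k \<in> I" "k' \<in> I" "finite I'" "l \<in> I'" "l' \<in> I'"
  shows "(\<Sum>a\<in>I. \<Sum>b\<in>I'. dlt k k' a * dlt l l' b * V a b) = V k l - V k l' - (V k' l - V k' l')"
proof -
  have "(\<Sum>a\<in>I. \<Sum>b\<in>I'. dlt k k' a * dlt l l' b * V a b) = (\<Sum>a\<in>I. dlt k k' a * (V a l - V a l'))"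
    by (simp only: mult.assoc sum_distrib_left[symmetric] sum_dlt[OF assms(4-6)])
  then show ?thesis by (simp add: sum_dlt[OF assms(1-3)])
qed

lemma avoids_sum [intro]: "(\<And>i. i \<in> I \<Longrightarrow> avoids m (f i)) \<Longrightarrow> avoids m (\<lambda>\<tau>. \<Sum>i\<in>I. f i \<tau>)"
  unfolding avoids_def by (auto intro!: sum.cong)

context sk_model
begin

text \<open>Every basis variable becomes a coefficient matrix on pairs of replicas. The same matrix
  is evaluated on the spins of one site (\<open>quad\<close>), on full overlaps (\<open>ovl\<close>)
  and on cavity overlaps (\<open>cav\<close>), which treats all five types of variables
  uniformly.\<close>

definition quad :: "nat \<Rightarrow> (nat \<Rightarrow> nat \<Rightarrow> real) \<Rightarrow> (nat \<Rightarrow> int) \<Rightarrow> real" where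
  "quad n u s = (\<Sum>a\<in>{1..n}. \<Sum>b\<in>{1..n}. u a b * (of_int (s a) * of_int (s b)))"

definition ovl :: "nat \<Rightarrow> (nat \<Rightarrow> nat \<Rightarrow> real) \<Rightarrow> nat \<Rightarrow> (nat \<Rightarrow> nat \<Rightarrow> int) \<Rightarrow> real" where
  "ovl n u N \<tau> = (\<Sum>a\<in>{1..n}. \<Sum>b\<in>{1..n}. u a b * overlap N a b \<tau>)"

definition cav :: "nat \<Rightarrow> (nat \<Rightarrow> nat \<Rightarrow> real) \<Rightarrow> nat \<Rightarrow> nat \<Rightarrow> (nat \<Rightarrow> nat \<Rightarrow> int) \<Rightarrow> real" where
  "cav n u N m \<tau> = (\<Sum>a\<in>{1..n}. \<Sum>b\<in>{1..n}. u a b * cavity_overlap N m a b \<tau>)"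

lemma ovl_eq_cav:
  assumes "m \<in> {1..N}"
  shows "ovl n u N \<tau> = cav n u N m \<tau> + 1 / sqrt (real N) * quad n u (\<lambda>k. \<tau> k m)"
  unfolding ovl_def cav_def quad_def overlap_eq_cavity[OF assms] distrib_left sum.distrib sum_distrib_left
  by (intro arg_cong2[of _ _ _ _ "(+)"] sum.cong refl) (simp add: mult_ac)

lemma dep_quad: "dep n (quad n u)"
  unfolding quad_def[abs_def] by (intro dep_sum dep_mult dep_const dep_coord[where h = real_of_int]) auto

lemma dep_cav: "dep n (cav n u N m)"
  unfolding cav_def[abs_def] by (intro dep_sum dep_mult dep_const dep_cavity_overlap) auto

lemma avoids_cav: "avoids m (cav n u N m)"
  unfolding cav_def[abs_def] by (intro avoids_sum avoids_mult avoids_const avoids_cavity_overlap)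

lemma quad_lead:
  assumes "set [k, k', l, l'] \<subseteq> {1..n}"
  shows "quad n (lead k k' l l') s = (of_int (s k) - of_int (s k')) * (of_int (s l) - of_int (s l'))"
  using sum_sum_dlt[of "{1..n}" k k' "{1..n}" l l' "\<lambda>a b. of_int (s a) * of_int (s b)"] assms
  unfolding quad_def lead_def by (simp add: algebra_simps)

lemma site_avg_sum: "finite I \<Longrightarrow> site_avg n (\<lambda>s. \<Sum>i\<in>I. f i s) = (\<Sum>i\<in>I. site_avg n (f i))"
  by (induction I rule: finite_induct) (simp_all add: site_avg_add site_avg_const)

text \<open>The Wick contraction of the removed factor with the matrix \<open>u\<close>, in units of
  \<open>A\<close>.\<close>

definition pairing :: "nat \<Rightarrow> nat \<Rightarrow> nat \<Rightarrow> nat \<Rightarrow> nat \<Rightarrow> (nat \<Rightarrow> nat \<Rightarrow> real) \<Rightarrow> real" where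
  "pairing n k k' l l' u = (\<Sum>a\<in>{1..n}. \<Sum>b\<in>{1..n}. u a b * (dlt k k' a * dlt l l' b + dlt k k' b * dlt l l' a))"

lemma site_avg_lead_quad:
  assumes "distinct [k, k', l, l']" "set [k, k', l, l'] \<subseteq> {1..n}"
  shows "site_avg n (\<lambda>s. quad n (lead k k' l l') s * quad n u s) = A * pairing n k k' l l' u"
proof -
  have "(\<lambda>s. quad n (lead k k' l l') s * quad n u s) = (\<lambda>s. \<Sum>a\<in>{1..n}. \<Sum>b\<in>{1..n}. u a b *
    ((of_int (s k) - of_int (s k')) * (of_int (s l) - of_int (s l')) * (of_int (s a) * of_int (s b))))"
    unfolding quad_lead[OF assms(2)] quad_def[of n u] sum_distrib_left by (intro ext sum.cong refl) (simp add: mult_ac)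
  then have "site_avg n (\<lambda>s. quad n (lead k k' l l') s * quad n u s) = (\<Sum>a\<in>{1..n}. \<Sum>b\<in>{1..n}. u a b *
    site_avg n (\<lambda>s. (of_int (s k) - of_int (s k')) * (of_int (s l) - of_int (s l')) * (of_int (s a) * of_int (s b))))"
    by (simp only: site_avg_sum finite_atLeastAtMost site_avg_cmult)
  also have "\<dots> = A * pairing n k k' l l' u"
    unfolding pairing_def sum_distrib_left
    by (intro sum.cong refl) (simp add: site_avg_lead_pair[OF assms])
  finally show ?thesis .
qed

text \<open>The four pairs consist of distinct replicas, so their centring constants are all
  \<open>q\<close> and cancel in the signed sum. What remains is a plain sum over sites with no
  subtraction.\<close>

lemma ovl_lead_eq_sum:
  assumes dist: "distinct [k, k', l, l']" and sub: "set [k, k', l, l'] \<subseteq> {1..n}"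
  shows "ovl n (lead k k' l l') N \<tau> = 1 / sqrt (real N) * (\<Sum>m\<in>{1..N}. quad n (lead k k' l l') (\<lambda>k. \<tau> k m))"
proof -
  have "ovl n (lead k k' l l') N \<tau> = overlap N k l \<tau> - overlap N k l' \<tau> - (overlap N k' l \<tau> - overlap N k' l' \<tau>)"
    using sum_sum_dlt[of "{1..n}" k k' "{1..n}" l l' "\<lambda>a b. overlap N a b \<tau>"] sub
    unfolding ovl_def lead_def by simp
  also have "\<dots> = 1 / sqrt (real N) * (\<Sum>m\<in>{1..N}. (of_int (\<tau> k m) - of_int (\<tau> k' m)) * (of_int (\<tau> l m) - of_int (\<tau> l' m)))"
    using dist by (simp add: overlap_def overlap_const_def algebra_simps sum.distrib sum_subtractf)
  finally show ?thesis unfolding quad_lead[OF sub] .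
qed

lemma moments_bounded_quad: "moments_bounded n (\<lambda>N m \<tau>. quad n u (\<lambda>k. \<tau> k m))"
  unfolding quad_def by (intro moments_bounded_intros) auto

text \<open>Only the pairs consisting of one replica from \<open>{k, k'}\<close> and one from \<open>{l, l'}\<close> survive in the drift at \<open>\<theta> = 0\<close>;
  their contributions recombine to the factor that was removed.\<close>

lemma ev_start_drift:
  assumes m: "m \<in> {1..N}" and dist: "distinct [k, k', l, l']" and sub: "set [k, k', l, l'] \<subseteq> {1..n}"
    and P: "dep n P" "avoids m P"
  shows "ev N m 0 (Suc (Suc n)) (\<lambda>\<tau>. quad n (lead k k' l l') (\<lambda>k. \<tau> k m) * P \<tau> * drift N m n \<tau>)
    = 2 * A * ev N m 0 n (\<lambda>\<tau>. cav n (lead k k' l l') N m \<tau> * P \<tau>)"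
proof -
  let ?n = "Suc (Suc n)"
  let ?I = "{1..Suc n}" and ?I' = "{1..Suc (Suc n)}"
  define V where "V = (\<lambda>a b. ev N m 0 ?n (\<lambda>\<tau>. cavity_overlap N m a b \<tau> * P \<tau>))"
  have V_sym: "V a b = V b a" for a b
  proof -
    have "cavity_overlap N m a b = cavity_overlap N m b a"
      unfolding cavity_overlap_def[abs_def] by (cases "a = b") (simp_all add: overlap_const_def mult.commute)
    then show ?thesis by (simp add: V_def)
  qed
  have sub': "set [k, k', l, l'] \<subseteq> {1..?n}" using sub by auto
  define \<psi> where "\<psi> = (\<lambda>a b. \<lambda>s::nat \<Rightarrow> int. quad n (lead k k' l l') s * (real_of_int (s a) * of_int (s b)))"
  have summand: "ev N m 0 ?n (\<lambda>\<tau>. \<psi> a b (\<lambda>k. \<tau> k m) * (cavity_overlap N m a b \<tau> * P \<tau>))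
    = A * (dlt k k' a * dlt l l' b + dlt k k' b * dlt l l' a) * V a b"
    if ab: "a \<in> ?I'" "b \<in> ?I'" for a b
  proof -
    have "dep ?n (\<psi> a b)" unfolding \<psi>_def
      by (intro dep_mult dep_mono[OF dep_quad] dep_coord[where h = real_of_int]) (use ab in auto)
    moreover have "avoids m (\<lambda>\<tau>. cavity_overlap N m a b \<tau> * P \<tau>)"
      by (intro avoids_mult avoids_cavity_overlap P(2))
    ultimately have "ev N m 0 ?n (\<lambda>\<tau>. \<psi> a b (\<lambda>k. \<tau> k m) * (cavity_overlap N m a b \<tau> * P \<tau>)) = site_avg ?n (\<psi> a b) * V a b"
      unfolding V_def by (rule ev_start[OF m])
    also have "site_avg ?n (\<psi> a b) = A * (dlt k k' a * dlt l l' b + dlt k k' b * dlt l l' a)"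
      unfolding \<psi>_def quad_lead[OF sub] by (rule site_avg_lead_pair[OF dist sub' ab])
    finally show ?thesis .
  qed
  have "ev N m 0 ?n (\<lambda>\<tau>. quad n (lead k k' l l') (\<lambda>k. \<tau> k m) * P \<tau> * drift N m n \<tau>)
    = ev N m 0 ?n (\<lambda>\<tau>. \<Sum>a\<in>?I. \<Sum>b\<in>?I'. contrast n a * contrast (Suc n) b * (\<psi> a b (\<lambda>k. \<tau> k m) * (cavity_overlap N m a b \<tau> * P \<tau>)))"
    unfolding drift_def sum_distrib_left \<psi>_def by (intro ev_cong sum.cong refl) (simp add: mult_ac)
  also have "\<dots> = (\<Sum>a\<in>?I. \<Sum>b\<in>?I'. contrast n a * contrast (Suc n) b * (A * (dlt k k' a * dlt l l' b + dlt k k' b * dlt l l' a) * V a b))"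
    unfolding ev_sum ev_cmult by (intro sum.cong refl arg_cong2[of _ _ _ _ "(*)"] summand) auto
  also have "\<dots> = (\<Sum>a\<in>?I. \<Sum>b\<in>?I'. A * (dlt k k' a * dlt l l' b * V a b + dlt l l' a * dlt k k' b * V a b))"
  proof (intro sum.cong refl)
    fix a b
    \<comment> \<open>A nonzero coefficient forces both indices into \<open>{k, k', l, l'}\<close>,
      hence below \<open>n\<close>, where both contrast weights are 1: the replicas added by
      differentiation do not contribute.\<close>
    have "dlt k k' a * dlt l l' b + dlt k k' b * dlt l l' a = 0 \<or> contrast n a = 1 \<and> contrast (Suc n) b = 1"
      using sub by (auto simp: dlt_def contrast_def)
    then show "contrast n a * contrast (Suc n) b * (A * (dlt k k' a * dlt l l' b + dlt k k' b * dlt l l' a) * V a b)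
      = A * (dlt k k' a * dlt l l' b * V a b + dlt l l' a * dlt k k' b * V a b)"
    proof
      assume "dlt k k' a * dlt l l' b + dlt k k' b * dlt l l' a = 0"
      moreover have "dlt k k' a * dlt l l' b * V a b + dlt l l' a * dlt k k' b * V a b = (dlt k k' a * dlt l l' b + dlt k k' b * dlt l l' a) * V a b"
        by (simp add: algebra_simps)
      ultimately show ?thesis by simp
    qed (simp add: algebra_simps)
  qed
  also have "\<dots> = A * ((\<Sum>a\<in>?I. \<Sum>b\<in>?I'. dlt k k' a * dlt l l' b * V a b) + (\<Sum>a\<in>?I. \<Sum>b\<in>?I'. dlt l l' a * dlt k k' b * V a b))"
    by (simp only: sum_distrib_left[symmetric] sum.distrib)
  also have "\<dots> = A * ((V k l - V k l' - (V k' l - V k' l')) + (V l k - V l k' - (V l' k - V l' k')))"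
  proof -
    have I: "set [k, k', l, l'] \<subseteq> ?I" "set [k, k', l, l'] \<subseteq> ?I'" using sub by auto
    have "(\<Sum>a\<in>?I. \<Sum>b\<in>?I'. dlt k k' a * dlt l l' b * V a b) = V k l - V k l' - (V k' l - V k' l')"
      "(\<Sum>a\<in>?I. \<Sum>b\<in>?I'. dlt l l' a * dlt k k' b * V a b) = V l k - V l k' - (V l' k - V l' k')"
      by (rule sum_sum_dlt; use I in force)+
    then show ?thesis by (simp only:)
  qed
  \<comment> \<open>Overlaps are symmetric, so the two orders of a pair agree; the resulting 2
    cancels the one half from the Taylor formula.\<close>
  also have "\<dots> = 2 * A * (V k l - V k l' - (V k' l - V k' l'))"
    by (simp add: V_sym[of l] V_sym[of l'] algebra_simps)
  also have "V k l - V k l' - (V k' l - V k' l') = ev N m 0 ?n (\<lambda>\<tau>. cav n (lead k k' l l') N m \<tau> * P \<tau>)"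
  proof -
    have "cav n (lead k k' l l') N m \<tau> = cavity_overlap N m k l \<tau> - cavity_overlap N m k l' \<tau> - (cavity_overlap N m k' l \<tau> - cavity_overlap N m k' l' \<tau>)" for \<tau>
      using sum_sum_dlt[of "{1..n}" k k' "{1..n}" l l' "\<lambda>a b. cavity_overlap N m a b \<tau>"] sub
      unfolding cav_def lead_def by simp
    then show ?thesis unfolding V_def by (simp only: left_diff_distrib ev_diff)
  qed
  also have "\<dots> = ev N m 0 n (\<lambda>\<tau>. cav n (lead k k' l l') N m \<tau> * P \<tau>)"
    by (rule ev_more_replicas) (auto intro!: dep_mult dep_cav P)
  finally show ?thesis .
qed

end

context sk_small
begin

lemma moments_bounded_cav: "moments_bounded n (cav n u)"
  unfolding cav_def[abs_def] by (intro moments_bounded_intros moments_bounded_cavity_overlap) auto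

lemma big_O_ev: "moments_bounded n F \<Longrightarrow> big_O 0 (\<lambda>N m. ev N m (pi/2) n (F N m))"
proof -
  assume F: "moments_bounded n F"
  obtain C where "\<And>N m \<theta>. m \<in> {1..N} \<Longrightarrow> \<theta> \<in> {0..pi/2} \<Longrightarrow> \<bar>ev N m \<theta> n (F N m)\<bar> \<le> C"
    using moments_bounded_ev[OF F] by metis
  then show ?thesis by (intro big_OI[where C = C]) (auto simp: pi_ge_zero)
qed

lemma ovl_prod_expansion:
  assumes "finite J"
  shows "\<exists>R. moments_bounded n R \<and> (\<forall>N m \<tau>. m \<in> {1..N} \<longrightarrow> (\<Prod>j\<in>J. ovl n (u j) N \<tau>)
    = (\<Prod>j\<in>J. cav n (u j) N m \<tau>) + 1 / sqrt (real N) * (\<Sum>j\<in>J. quad n (u j) (\<lambda>k. \<tau> k m) * (\<Prod>i\<in>J-{j}. cav n (u i) N m \<tau>))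
      + 1 / sqrt (real N) * (1 / sqrt (real N) * R N m \<tau>))"
proof -
  obtain R where R: "moments_bounded n R" "\<And>N m \<tau>. (\<Prod>j\<in>J. cav n (u j) N m \<tau> + 1 / sqrt (real N) * quad n (u j) (\<lambda>k. \<tau> k m))
    = (\<Prod>j\<in>J. cav n (u j) N m \<tau>) + 1 / sqrt (real N) * (\<Sum>j\<in>J. quad n (u j) (\<lambda>k. \<tau> k m) * (\<Prod>i\<in>J-{j}. cav n (u i) N m \<tau>))
      + 1 / sqrt (real N) * (1 / sqrt (real N) * R N m \<tau>)"
    using product_expansion[OF assms, of n "\<lambda>j. cav n (u j)" "\<lambda>j N m \<tau>. quad n (u j) (\<lambda>k. \<tau> k m)"]
      moments_bounded_cav moments_bounded_quad by blast
  show ?thesis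
    by (intro exI[of _ R] conjI R(1) allI impI) (simp only: ovl_eq_cav R(2))
qed

text \<open>Restoring site \<open>m\<close> and moving along the path each cost one power of
  \<open>1 / sqrt N\<close>. In the second-order expansion this exchange of ends is made only inside
  terms that already carry such a factor.\<close>

lemma ovl_prod_start:
  assumes "finite J"
  shows "big_O 1 (\<lambda>N m. ev N m (pi/2) n (\<lambda>\<tau>. \<Prod>j\<in>J. ovl n (u j) N \<tau>) - ev N m 0 n (\<lambda>\<tau>. \<Prod>j\<in>J. cav n (u j) N m \<tau>))"
proof -
  obtain R where R: "moments_bounded n R" "\<And>N m \<tau>. m \<in> {1..N} \<Longrightarrow> (\<Prod>j\<in>J. ovl n (u j) N \<tau>)
    = (\<Prod>j\<in>J. cav n (u j) N m \<tau>) + 1 / sqrt (real N) * (\<Sum>j\<in>J. quad n (u j) (\<lambda>k. \<tau> k m) * (\<Prod>i\<in>J-{j}. cav n (u i) N m \<tau>))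
      + 1 / sqrt (real N) * (1 / sqrt (real N) * R N m \<tau>)"
    using ovl_prod_expansion[OF assms, of n u] by blast
  let ?P = "\<lambda>N m \<tau>. \<Prod>j\<in>J. cav n (u j) N m \<tau>"
  define Q where "Q = (\<lambda>N m \<tau>. (\<Sum>j\<in>J. quad n (u j) (\<lambda>k. \<tau> k m) * (\<Prod>i\<in>J-{j}. cav n (u i) N m \<tau>)) + 1 / sqrt (real N) * R N m \<tau>)"
  have "moments_bounded n Q" unfolding Q_def
    by (intro moments_bounded_add moments_bounded_sum moments_bounded_mult moments_bounded_prod
        moments_bounded_inverse_sqrt moments_bounded_quad moments_bounded_cav R(1)) (use assms in auto)
  then have "big_O (Suc 0) (\<lambda>N m. 1 / sqrt (real N) * ev N m (pi/2) n (Q N m))"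
    by (intro big_O_scale big_O_ev)
  moreover have "big_O 1 (\<lambda>N m. ev N m (pi/2) n (?P N m) - ev N m 0 n (?P N m))"
    by (rule ev_first_order_end) (use assms in \<open>auto intro!: moments_bounded_prod moments_bounded_cav dep_prod dep_cav\<close>)
  ultimately have "big_O 1 (\<lambda>N m. 1 / sqrt (real N) * ev N m (pi/2) n (Q N m) + (ev N m (pi/2) n (?P N m) - ev N m 0 n (?P N m)))"
    by (simp add: big_O_add)
  then show ?thesis
  proof (rule big_O_cong)
    fix N m :: nat assume m: "m \<in> {1..N}"
    have "ev N m (pi/2) n (\<lambda>\<tau>. \<Prod>j\<in>J. ovl n (u j) N \<tau>) = ev N m (pi/2) n (\<lambda>\<tau>. ?P N m \<tau> + 1 / sqrt (real N) * Q N m \<tau>)"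
      by (intro ev_cong) (simp only: R(2)[OF m] Q_def distrib_left add.assoc)
    then show "ev N m (pi/2) n (\<lambda>\<tau>. \<Prod>j\<in>J. ovl n (u j) N \<tau>) - ev N m 0 n (?P N m)
      = 1 / sqrt (real N) * ev N m (pi/2) n (Q N m) + (ev N m (pi/2) n (?P N m) - ev N m 0 n (?P N m))"
      by (simp only: ev_add ev_cmult)
  qed
qed

text \<open>The remaining product is expanded around site \<open>m\<close>. Its zeroth term has mean
  zero at the decoupled end and contributes through the drift, its linear terms contribute site
  covariances of two factors, and the remainder is of order \<open>1 / N\<close>.\<close>

lemma cavity_step_site:
  assumes dist: "distinct [k, k', l, l']" and sub: "set [k, k', l, l'] \<subseteq> {1..n}"
    and J: "finite J" "j0 \<notin> J" and u0: "u j0 = lead k k' l l'"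
  defines "M \<equiv> \<lambda>I N m. ev N m (pi/2) n (\<lambda>\<tau>. \<Prod>j\<in>I. ovl n (u j) N \<tau>)"
  shows "big_O 2 (\<lambda>N m. ev N m (pi/2) n (\<lambda>\<tau>. quad n (u j0) (\<lambda>k. \<tau> k m) * (\<Prod>j\<in>J. ovl n (u j) N \<tau>))
    - 1 / sqrt (real N) * (\<beta>\<^sup>2 * A * M (insert j0 J) N m + (\<Sum>j\<in>J. A * pairing n k k' l l' (u j) * M (J - {j}) N m)))"
proof -
  let ?L = "\<lambda>m \<tau>. quad n (u j0) (\<lambda>k. \<tau> k m)"
  let ?P = "\<lambda>I N m \<tau>. \<Prod>j\<in>I. cav n (u j) N m \<tau>"
  obtain R where R: "moments_bounded n R" "\<And>N m \<tau>. m \<in> {1..N} \<Longrightarrow> (\<Prod>j\<in>J. ovl n (u j) N \<tau>)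
    = ?P J N m \<tau> + 1 / sqrt (real N) * (\<Sum>j\<in>J. quad n (u j) (\<lambda>k. \<tau> k m) * ?P (J - {j}) N m \<tau>)
      + 1 / sqrt (real N) * (1 / sqrt (real N) * R N m \<tau>)"
    using ovl_prod_expansion[OF J(1), of n u] by blast
  have finJ: "finite I" if "I \<subseteq> J" for I using J(1) that by (rule finite_subset[rotated])
  have dL: "dep n (\<lambda>\<tau>::nat \<Rightarrow> nat \<Rightarrow> int. quad n v (\<lambda>k. \<tau> k m))" for m v by (rule dep_site[OF dep_quad])
  have dP: "dep n (?P I N m)" for I N m by (intro dep_prod dep_cav)
  have aP: "avoids m (?P I N m)" for I N m by (intro avoids_prod avoids_cav)
  have mP: "moments_bounded n (?P I)" if "I \<subseteq> J" for I
    by (intro moments_bounded_prod moments_bounded_cav finJ that)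
  have start: "big_O 1 (\<lambda>N m. M I N m - ev N m 0 n (?P I N m))" if "I \<subseteq> insert j0 J" for I
    unfolding M_def by (rule ovl_prod_start) (use finite_subset[OF that] J(1) in simp)

  have "big_O 2 (\<lambda>N m. ev N m (pi/2) n (\<lambda>\<tau>. ?L m \<tau> * ?P J N m \<tau>) - ev N m 0 n (\<lambda>\<tau>. ?L m \<tau> * ?P J N m \<tau>)
    - \<beta>\<^sup>2 / 2 * (1 / sqrt (real N) * ev N m 0 (Suc (Suc n)) (\<lambda>\<tau>. ?L m \<tau> * ?P J N m \<tau> * drift N m n \<tau>)))"
    by (intro ev_second_order_end moments_bounded_mult moments_bounded_quad mP dep_mult dL dP order_refl)
  \<comment> \<open>The cavity product at angle 0 that the drift leaves behind is exchanged for the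
    full product at the end of the path; the prefactor lifts the error to second order.\<close>
  moreover have "big_O (Suc 1) (\<lambda>N m. 1 / sqrt (real N) * (\<beta>\<^sup>2 * A * (M (insert j0 J) N m - ev N m 0 n (?P (insert j0 J) N m))))"
    by (intro big_O_scale big_O_cmult start order_refl)
  note this[unfolded Suc_1]
  ultimately have "big_O 2 (\<lambda>N m. (ev N m (pi/2) n (\<lambda>\<tau>. ?L m \<tau> * ?P J N m \<tau>) - ev N m 0 n (\<lambda>\<tau>. ?L m \<tau> * ?P J N m \<tau>)
    - \<beta>\<^sup>2 / 2 * (1 / sqrt (real N) * ev N m 0 (Suc (Suc n)) (\<lambda>\<tau>. ?L m \<tau> * ?P J N m \<tau> * drift N m n \<tau>)))
    - 1 / sqrt (real N) * (\<beta>\<^sup>2 * A * (M (insert j0 J) N m - ev N m 0 n (?P (insert j0 J) N m))))"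
    by (rule big_O_diff)
  then have 1: "big_O 2 (\<lambda>N m. ev N m (pi/2) n (\<lambda>\<tau>. ?L m \<tau> * ?P J N m \<tau>) - 1 / sqrt (real N) * (\<beta>\<^sup>2 * A * M (insert j0 J) N m))"
  proof (rule big_O_cong)
    fix N m :: nat assume m: "m \<in> {1..N}"
    have "ev N m 0 n (\<lambda>\<tau>. ?L m \<tau> * ?P J N m \<tau>) = site_avg n (quad n (u j0)) * ev N m 0 n (?P J N m)"
      by (rule ev_start[OF m dep_quad aP])
    also have "site_avg n (quad n (u j0)) = 0"
      unfolding u0 quad_lead[OF sub] by (rule site_avg_lead[OF dist sub])
    finally have a: "ev N m 0 n (\<lambda>\<tau>. ?L m \<tau> * ?P J N m \<tau>) = 0" by simp
    \<comment> \<open>The drift restores the factor that was expanded, so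
      \<open>\<beta>^2 / 2 * 2 * A\<close> multiplies the original product.\<close>
    have b: "ev N m 0 (Suc (Suc n)) (\<lambda>\<tau>. ?L m \<tau> * ?P J N m \<tau> * drift N m n \<tau>) = 2 * A * ev N m 0 n (?P (insert j0 J) N m)"
      using ev_start_drift[OF m dist sub, of "?P J N m"] dP aP J by (simp add: u0)
    show "ev N m (pi/2) n (\<lambda>\<tau>. ?L m \<tau> * ?P J N m \<tau>) - 1 / sqrt (real N) * (\<beta>\<^sup>2 * A * M (insert j0 J) N m)
      = (ev N m (pi/2) n (\<lambda>\<tau>. ?L m \<tau> * ?P J N m \<tau>) - ev N m 0 n (\<lambda>\<tau>. ?L m \<tau> * ?P J N m \<tau>)
    - \<beta>\<^sup>2 / 2 * (1 / sqrt (real N) * ev N m 0 (Suc (Suc n)) (\<lambda>\<tau>. ?L m \<tau> * ?P J N m \<tau> * drift N m n \<tau>)))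
    - 1 / sqrt (real N) * (\<beta>\<^sup>2 * A * (M (insert j0 J) N m - ev N m 0 n (?P (insert j0 J) N m)))"
      unfolding a b by (simp add: algebra_simps)
  qed

  \<comment> \<open>A first-order estimate suffices, since these terms come with a factor
    \<open>1 / sqrt N\<close> from the expansion.\<close>
  have 2: "big_O 1 (\<lambda>N m. ev N m (pi/2) n (\<lambda>\<tau>. ?L m \<tau> * (quad n (u j) (\<lambda>k. \<tau> k m) * ?P (J - {j}) N m \<tau>))
      - A * pairing n k k' l l' (u j) * M (J - {j}) N m)" if j: "j \<in> J" for j
  proof -
    have "big_O 1 (\<lambda>N m. (ev N m (pi/2) n (\<lambda>\<tau>. ?L m \<tau> * (quad n (u j) (\<lambda>k. \<tau> k m) * ?P (J - {j}) N m \<tau>))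
        - ev N m 0 n (\<lambda>\<tau>. ?L m \<tau> * (quad n (u j) (\<lambda>k. \<tau> k m) * ?P (J - {j}) N m \<tau>)))
        - A * pairing n k k' l l' (u j) * (M (J - {j}) N m - ev N m 0 n (?P (J - {j}) N m)))"
      by (intro big_O_diff big_O_cmult start ev_first_order_end moments_bounded_mult moments_bounded_quad mP dep_mult dL dP) auto
    then show ?thesis
    proof (rule big_O_cong)
      fix N m :: nat assume m: "m \<in> {1..N}"
      have "ev N m 0 n (\<lambda>\<tau>. (quad n (u j0) (\<lambda>k. \<tau> k m) * quad n (u j) (\<lambda>k. \<tau> k m)) * ?P (J - {j}) N m \<tau>)
        = site_avg n (\<lambda>s. quad n (u j0) s * quad n (u j) s) * ev N m 0 n (?P (J - {j}) N m)"
        using ev_start[OF m dep_mult[OF dep_quad dep_quad] aP] .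
      also have "site_avg n (\<lambda>s. quad n (u j0) s * quad n (u j) s) = A * pairing n k k' l l' (u j)"
        unfolding u0 by (rule site_avg_lead_quad[OF dist sub])
      finally show "ev N m (pi/2) n (\<lambda>\<tau>. ?L m \<tau> * (quad n (u j) (\<lambda>k. \<tau> k m) * ?P (J - {j}) N m \<tau>)) - A * pairing n k k' l l' (u j) * M (J - {j}) N m
        = (ev N m (pi/2) n (\<lambda>\<tau>. ?L m \<tau> * (quad n (u j) (\<lambda>k. \<tau> k m) * ?P (J - {j}) N m \<tau>))
        - ev N m 0 n (\<lambda>\<tau>. ?L m \<tau> * (quad n (u j) (\<lambda>k. \<tau> k m) * ?P (J - {j}) N m \<tau>)))
        - A * pairing n k k' l l' (u j) * (M (J - {j}) N m - ev N m 0 n (?P (J - {j}) N m))"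
        by (simp add: mult.assoc right_diff_distrib)
    qed
  qed
  have "big_O (Suc 1) (\<lambda>N m. 1 / sqrt (real N) * (\<Sum>j\<in>J. ev N m (pi/2) n (\<lambda>\<tau>. ?L m \<tau> * (quad n (u j) (\<lambda>k. \<tau> k m) * ?P (J - {j}) N m \<tau>))
      - A * pairing n k k' l l' (u j) * M (J - {j}) N m))"
    by (intro big_O_scale big_O_sum J(1) 2)
  note corr = this[unfolded Suc_1]
  have "big_O (Suc (Suc 0)) (\<lambda>N m. 1 / sqrt (real N) * (1 / sqrt (real N) * ev N m (pi/2) n (\<lambda>\<tau>. ?L m \<tau> * R N m \<tau>)))"
    by (intro big_O_scale big_O_ev moments_bounded_mult moments_bounded_quad R(1))
  note this[folded numeral_2_eq_2]
  from big_O_add[OF big_O_add[OF 1 corr] this] have "big_O 2 (\<lambda>N m. (ev N m (pi/2) n (\<lambda>\<tau>. ?L m \<tau> * ?P J N m \<tau>) - 1 / sqrt (real N) * (\<beta>\<^sup>2 * A * M (insert j0 J) N m))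
     + 1 / sqrt (real N) * (\<Sum>j\<in>J. ev N m (pi/2) n (\<lambda>\<tau>. ?L m \<tau> * (quad n (u j) (\<lambda>k. \<tau> k m) * ?P (J - {j}) N m \<tau>))
      - A * pairing n k k' l l' (u j) * M (J - {j}) N m)
     + 1 / sqrt (real N) * (1 / sqrt (real N) * ev N m (pi/2) n (\<lambda>\<tau>. ?L m \<tau> * R N m \<tau>)))"
    .
  then show ?thesis
  proof (rule big_O_cong)
    fix N m :: nat assume m: "m \<in> {1..N}"
    have "ev N m (pi/2) n (\<lambda>\<tau>. ?L m \<tau> * (\<Prod>j\<in>J. ovl n (u j) N \<tau>))
      = ev N m (pi/2) n (\<lambda>\<tau>. ?L m \<tau> * ?P J N m \<tau> + 1 / sqrt (real N) * (\<Sum>j\<in>J. ?L m \<tau> * (quad n (u j) (\<lambda>k. \<tau> k m) * ?P (J - {j}) N m \<tau>))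
        + 1 / sqrt (real N) * (1 / sqrt (real N) * (?L m \<tau> * R N m \<tau>)))"
      unfolding R(2)[OF m] by (simp only: distrib_left sum_distrib_left mult.left_commute[of "quad n (u j0) _"])
    then have e: "ev N m (pi/2) n (\<lambda>\<tau>. ?L m \<tau> * (\<Prod>j\<in>J. ovl n (u j) N \<tau>))
      = ev N m (pi/2) n (\<lambda>\<tau>. ?L m \<tau> * ?P J N m \<tau>)
        + 1 / sqrt (real N) * (\<Sum>j\<in>J. ev N m (pi/2) n (\<lambda>\<tau>. ?L m \<tau> * (quad n (u j) (\<lambda>k. \<tau> k m) * ?P (J - {j}) N m \<tau>)))
        + 1 / sqrt (real N) * (1 / sqrt (real N) * ev N m (pi/2) n (\<lambda>\<tau>. ?L m \<tau> * R N m \<tau>))"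
      by (simp only: ev_add ev_sum ev_cmult)
    show "ev N m (pi/2) n (\<lambda>\<tau>. ?L m \<tau> * (\<Prod>j\<in>J. ovl n (u j) N \<tau>))
      - 1 / sqrt (real N) * (\<beta>\<^sup>2 * A * M (insert j0 J) N m + (\<Sum>j\<in>J. A * pairing n k k' l l' (u j) * M (J - {j}) N m))
      = (ev N m (pi/2) n (\<lambda>\<tau>. ?L m \<tau> * ?P J N m \<tau>) - 1 / sqrt (real N) * (\<beta>\<^sup>2 * A * M (insert j0 J) N m))
     + 1 / sqrt (real N) * (\<Sum>j\<in>J. ev N m (pi/2) n (\<lambda>\<tau>. ?L m \<tau> * (quad n (u j) (\<lambda>k. \<tau> k m) * ?P (J - {j}) N m \<tau>))
      - A * pairing n k k' l l' (u j) * M (J - {j}) N m)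
     + 1 / sqrt (real N) * (1 / sqrt (real N) * ev N m (pi/2) n (\<lambda>\<tau>. ?L m \<tau> * R N m \<tau>))"
      unfolding e sum_subtractf by (simp only: distrib_left right_diff_distrib)
  qed
qed

text \<open>Summing the one-site identity over all sites recovers the full product on the left; its
  copy generated by the drift is moved there too and produces
  \<open>1 - \<beta>^2 * A\<close>.\<close>

lemma cavity_step:
  assumes dist: "distinct [k, k', l, l']" and sub: "set [k, k', l, l'] \<subseteq> {1..n}"
    and J: "finite J" "j0 \<notin> J" and u0: "u j0 = lead k k' l l'"
  defines "M \<equiv> \<lambda>I N m. ev N m (pi/2) n (\<lambda>\<tau>. \<Prod>j\<in>I. ovl n (u j) N \<tau>)"
  shows "big_O 1 (\<lambda>N m. (1 - \<beta>\<^sup>2 * A) * M (insert j0 J) N m - A * (\<Sum>j\<in>J. pairing n k k' l l' (u j) * M (J - {j}) N m))"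
proof -
  define G where "G = (\<lambda>N m. \<beta>\<^sup>2 * A * M (insert j0 J) N m + (\<Sum>j\<in>J. A * pairing n k k' l l' (u j) * M (J - {j}) N m))"
  obtain C where C: "\<And>N m. m \<in> {1..N} \<Longrightarrow> \<bar>ev N m (pi/2) n (\<lambda>\<tau>. quad n (u j0) (\<lambda>k. \<tau> k m) * (\<Prod>j\<in>J. ovl n (u j) N \<tau>))
      - 1 / sqrt (real N) * G N m\<bar> \<le> C / sqrt (real N) ^ 2"
    using cavity_step_site[where u = u, OF assms(1-5)] unfolding big_O_def M_def G_def by blast
  show ?thesis
  proof (rule big_OI[where C = C])
    fix N m :: nat assume m: "m \<in> {1..N}"
    then have N: "real N > 0" by auto
    have indep: "M I N m' = M I N m" if "m' \<in> {1..N}" for m' I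
      unfolding M_def using ev_end_indep[OF that m] .
    then have G: "G N m' = G N m" if "m' \<in> {1..N}" for m'
      using that by (simp add: G_def)
    have "M (insert j0 J) N m = ev N m (pi/2) n (\<lambda>\<tau>. 1 / sqrt (real N) * (\<Sum>m'\<in>{1..N}. quad n (u j0) (\<lambda>k. \<tau> k m') * (\<Prod>j\<in>J. ovl n (u j) N \<tau>)))"
      unfolding M_def using J by (simp add: u0 ovl_lead_eq_sum[OF dist sub] sum_distrib_right)
    also have "\<dots> = 1 / sqrt (real N) * (\<Sum>m'\<in>{1..N}. ev N m' (pi/2) n (\<lambda>\<tau>. quad n (u j0) (\<lambda>k. \<tau> k m') * (\<Prod>j\<in>J. ovl n (u j) N \<tau>)))"
      unfolding ev_cmult ev_sum using ev_end_indep[OF m] by simp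
    finally have M: "M (insert j0 J) N m = 1 / sqrt (real N) * (\<Sum>m'\<in>{1..N}. ev N m' (pi/2) n (\<lambda>\<tau>. quad n (u j0) (\<lambda>k. \<tau> k m') * (\<Prod>j\<in>J. ovl n (u j) N \<tau>)))" .
    have "G N m = 1 / sqrt (real N) * (\<Sum>m'\<in>{1..N}. 1 / sqrt (real N) * G N m')"
      using N by (simp add: G)
    then have "M (insert j0 J) N m - G N m = 1 / sqrt (real N) * (\<Sum>m'\<in>{1..N}.
        ev N m' (pi/2) n (\<lambda>\<tau>. quad n (u j0) (\<lambda>k. \<tau> k m') * (\<Prod>j\<in>J. ovl n (u j) N \<tau>)) - 1 / sqrt (real N) * G N m')"
      unfolding M sum_subtractf right_diff_distrib by simp
    \<comment> \<open>There are \<open>N\<close> errors of size \<open>C / N\<close>, and the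
      prefactor leaves \<open>C / sqrt N\<close>.\<close>
    also have "\<bar>\<dots>\<bar> \<le> 1 / sqrt (real N) * (\<Sum>m'\<in>{1..N}. C / sqrt (real N) ^ 2)"
      unfolding abs_mult by (intro mult_mono order_trans[OF sum_abs] sum_mono C) auto
    also have "\<dots> = C / sqrt (real N) ^ 1" using N by simp
    finally show "\<bar>(1 - \<beta>\<^sup>2 * A) * M (insert j0 J) N m - A * (\<Sum>j\<in>J. pairing n k k' l l' (u j) * M (J - {j}) N m)\<bar> \<le> C / sqrt (real N) ^ 1"
      by (simp add: G_def algebra_simps sum_distrib_left)
  qed
qed

end

section \<open>Products of the basis variables\<close>

text \<open>A product of Gibbs averages is linearised by giving the factor \<open>j\<close> its own
  two replicas \<open>n + 2 * j + 1\<close> and \<open>n + 2 * j + 2\<close>; disjointness makes the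
  averages independent.\<close>

lemma avg_fresh_pairs:
  assumes C: "finite C" and K: "dep n K" and \<psi>: "\<And>j x y. dep n (\<lambda>\<tau>. \<psi> j \<tau> x y)"
  shows "avg C G n (\<lambda>\<tau>. K \<tau> * (\<Prod>j<H. \<Sum>x\<in>C. \<Sum>y\<in>C. \<psi> j \<tau> x y * (G x * G y)))
    = avg C G (n + 2 * H) (\<lambda>\<tau>. K \<tau> * (\<Prod>j<H. \<psi> j \<tau> (\<tau> (n + 2 * j + 1)) (\<tau> (n + 2 * j + 2))))"
  using K
proof (induction H arbitrary: K)
  case (Suc H)
  let ?E = "\<lambda>j \<tau>. \<Sum>x\<in>C. \<Sum>y\<in>C. \<psi> j \<tau> x y * (G x * G y)"
  let ?Q = "\<lambda>\<tau>. \<Prod>j<H. \<psi> j \<tau> (\<tau> (n + 2 * j + 1)) (\<tau> (n + 2 * j + 2))"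
  let ?f = "\<lambda>\<tau>. K \<tau> * (\<Prod>j<Suc H. \<psi> j \<tau> (\<tau> (n + 2 * j + 1)) (\<tau> (n + 2 * j + 2)))"
  let ?M = "n + 2 * H"
  \<comment> \<open>The last averaged factor reads only the first \<open>n\<close> replicas, so it
    can be absorbed into \<open>K\<close>; this is why the induction generalises over
    \<open>K\<close>.\<close>
  have "dep n (\<lambda>\<tau>. K \<tau> * ?E H \<tau>)"
    by (intro dep_mult dep_sum \<psi> dep_const Suc.prems)
  from Suc.IH[OF this]
  have 1: "avg C G n (\<lambda>\<tau>. K \<tau> * (\<Prod>j<Suc H. ?E j \<tau>)) = avg C G ?M (\<lambda>\<tau>. K \<tau> * ?E H \<tau> * ?Q \<tau>)"
    by (simp add: mult_ac)
  have upd: "?f (\<tau>(Suc ?M := x, Suc (Suc ?M) := y)) = K \<tau> * \<psi> H \<tau> x y * ?Q \<tau>" for \<tau> x y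
  proof -
    let ?\<tau> = "\<tau>(Suc ?M := x, Suc (Suc ?M) := y)"
    have "K ?\<tau> = K \<tau>" by (rule depD[OF Suc.prems]) auto
    moreover have \<psi>': "\<psi> j ?\<tau> x' y' = \<psi> j \<tau> x' y'" for j x' y' by (rule depD[OF \<psi>]) auto
    moreover have "(\<Prod>j<H. \<psi> j ?\<tau> (?\<tau> (n + 2 * j + 1)) (?\<tau> (n + 2 * j + 2))) = ?Q \<tau>"
      unfolding \<psi>' by (intro prod.cong refl) auto
    ultimately show ?thesis by simp
  qed
  have "avg C G (n + 2 * Suc H) ?f = avg C G ?M (\<lambda>\<tau>. \<Sum>x\<in>C. (\<Sum>y\<in>C. ?f (\<tau>(Suc ?M := x, Suc (Suc ?M) := y)) * G y) * G x)"
    using avg_Suc[OF C, of G "Suc ?M" ?f] avg_Suc[OF C, of G ?M "\<lambda>\<tau>. \<Sum>y\<in>C. ?f (\<tau>(Suc (Suc ?M) := y)) * G y"] by simp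
  also have "\<dots> = avg C G ?M (\<lambda>\<tau>. K \<tau> * ?E H \<tau> * ?Q \<tau>)"
  proof (intro avg_cong)
    fix \<tau>
    show "(\<Sum>x\<in>C. (\<Sum>y\<in>C. ?f (\<tau>(Suc ?M := x, Suc (Suc ?M) := y)) * G y) * G x) = K \<tau> * ?E H \<tau> * ?Q \<tau>"
      unfolding upd sum_distrib_left sum_distrib_right by (intro sum.cong refl) (simp add: mult_ac)
  qed
  finally show ?case using 1 by simp
qed simp

lemma sum_sum_separated:
  fixes G :: "'c \<Rightarrow> real"
  assumes "(\<Sum>x\<in>C. G x) = 1" "finite C"
  shows "(\<Sum>x\<in>C. \<Sum>y\<in>C. (c * (\<Sum>i\<in>I. f i x * h i y) + d) * (G x * G y))
    = c * (\<Sum>i\<in>I. (\<Sum>x\<in>C. f i x * G x) * (\<Sum>y\<in>C. h i y * G y)) + d"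
proof -
  have "(\<Sum>x\<in>C. \<Sum>y\<in>C. (c * (\<Sum>i\<in>I. f i x * h i y) + d) * (G x * G y))
    = (\<Sum>x\<in>C. \<Sum>y\<in>C. \<Sum>i\<in>I. c * ((f i x * G x) * (h i y * G y))) + d * (\<Sum>x\<in>C. \<Sum>y\<in>C. G x * G y)"
  proof -
    have "(c * (\<Sum>i\<in>I. f i x * h i y) + d) * (G x * G y) = (\<Sum>i\<in>I. c * ((f i x * G x) * (h i y * G y))) + d * (G x * G y)" for x y
    proof -
      have "(\<Sum>i\<in>I. f i x * h i y) * (G x * G y) = (\<Sum>i\<in>I. (f i x * G x) * (h i y * G y))"
        unfolding sum_distrib_right by (intro sum.cong refl) (simp add: mult_ac)
      then show ?thesis by (simp only: distrib_right mult.assoc sum_distrib_left[symmetric])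
    qed
    then show ?thesis by (simp only: sum.distrib sum_distrib_left[symmetric])
  qed
  also have "(\<Sum>x\<in>C. \<Sum>y\<in>C. G x * G y) = 1"
    using assms by (simp add: sum_product[symmetric])
  also have "(\<Sum>x\<in>C. \<Sum>y\<in>C. \<Sum>i\<in>I. c * ((f i x * G x) * (h i y * G y))) = (\<Sum>x\<in>C. \<Sum>i\<in>I. \<Sum>y\<in>C. c * ((f i x * G x) * (h i y * G y)))"
    by (intro sum.cong refl sum.swap)
  also have "\<dots> = (\<Sum>i\<in>I. \<Sum>x\<in>C. \<Sum>y\<in>C. c * ((f i x * G x) * (h i y * G y)))"
    by (rule sum.swap)
  also have "\<dots> = c * (\<Sum>i\<in>I. (\<Sum>x\<in>C. f i x * G x) * (\<Sum>y\<in>C. h i y * G y))"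
    unfolding sum_product unfolding sum_distrib_left ..
  finally show ?thesis by simp
qed

text \<open>Symbolic names for the basis variables: a monomial becomes a sequence of names, and an
  exponent becomes the number of positions carrying a name.\<close>

datatype factor = Tkl nat nat | Tk nat | T0 | Sk nat | S0

fun valid_factor :: "nat \<Rightarrow> factor \<Rightarrow> bool" where
  "valid_factor n (Tkl k l) \<longleftrightarrow> 1 \<le> k \<and> k < l \<and> l \<le> n"
| "valid_factor n (Tk k) \<longleftrightarrow> 1 \<le> k \<and> k \<le> n"
| "valid_factor n T0 \<longleftrightarrow> True"
| "valid_factor n (Sk k) \<longleftrightarrow> 1 \<le> k \<and> k \<le> n"
| "valid_factor n S0 \<longleftrightarrow> True"

abbreviation single :: "nat \<Rightarrow> nat \<Rightarrow> real" where
  "single k a \<equiv> (if a = k then 1 else 0)"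

text \<open>The Gibbs means \<open>b_i\<close> in a factor are written with two fresh replicas \<open>c\<close> and \<open>d\<close>.\<close>

fun factor_matrix :: "factor \<Rightarrow> nat \<Rightarrow> nat \<Rightarrow> nat \<Rightarrow> nat \<Rightarrow> real" where
  "factor_matrix (Tkl k l) c d a b = lead k c l d a b"
| "factor_matrix (Tk k) c d a b = dlt k c a * single d b"
| "factor_matrix T0 c d a b = single c a * single d b"
| "factor_matrix (Sk k) c d a b = single k a * single k b - single c a * single c b"
| "factor_matrix S0 c d a b = single c a * single c b"

lemma sum_single: "finite I \<Longrightarrow> k \<in> I \<Longrightarrow> (\<Sum>a\<in>I. single k a * x a) = (x k :: real)"
  by (simp add: if_distrib[of "\<lambda>y. y * _"] cong: if_cong)

lemma sum_factor_matrix: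
  assumes F: "valid_factor n F" and cd: "c \<in> {1..n'}" "d \<in> {1..n'}" and "n \<le> n'"
  shows "(\<Sum>a\<in>{1..n'}. \<Sum>b\<in>{1..n'}. factor_matrix F c d a b * V a b) =
    (case F of Tkl k l \<Rightarrow> V k l - V k d - (V c l - V c d) | Tk k \<Rightarrow> V k d - V c d | T0 \<Rightarrow> V c d
      | Sk k \<Rightarrow> V k k - V c c | S0 \<Rightarrow> V c c)"
proof -
  have s: "(\<Sum>a\<in>{1..n'}. \<Sum>b\<in>{1..n'}. f a * single k b * V a b) = (\<Sum>a\<in>{1..n'}. f a * V a k)"
    if "k \<in> {1..n'}" for f k
    by (simp only: mult.assoc sum_distrib_left[symmetric] sum_single[OF finite_atLeastAtMost that])
  show ?thesis
  proof (cases F)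
    case (Tkl k l)
    then have "k \<in> {1..n'}" "l \<in> {1..n'}" using assms by auto
    then show ?thesis
      using sum_sum_dlt[of "{1..n'}" k c "{1..n'}" l d V] cd by (simp add: Tkl lead_def)
  next
    case (Tk k)
    then have k: "k \<in> {1..n'}" using assms by auto
    show ?thesis unfolding Tk factor_matrix.simps s[OF cd(2)]
      using sum_dlt[of "{1..n'}" k c "\<lambda>a. V a d"] k cd by simp
  next
    case T0
    show ?thesis unfolding T0 factor_matrix.simps s[OF cd(2)] sum_single[OF finite_atLeastAtMost cd(1)] by simp
  next
    case (Sk k)
    then have k: "k \<in> {1..n'}" using assms by auto
    show ?thesis unfolding Sk factor_matrix.simps left_diff_distrib sum_subtractf s[OF cd(1)] s[OF k]
        sum_single[OF finite_atLeastAtMost cd(1)] sum_single[OF finite_atLeastAtMost k] by simp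
  next
    case S0
    show ?thesis unfolding S0 factor_matrix.simps s[OF cd(1)] sum_single[OF finite_atLeastAtMost cd(1)] by simp
  qed
qed

context sk_model
begin

fun factor_value :: "nat \<Rightarrow> (nat \<times> nat \<Rightarrow> real) \<Rightarrow> (nat \<Rightarrow> nat \<Rightarrow> int) \<Rightarrow> factor \<Rightarrow> real" where
  "factor_value N g \<tau> (Tkl k l) = T_kl S N \<beta> D hf g \<tau> k l"
| "factor_value N g \<tau> (Tk k) = T_k S N \<beta> D hf g \<tau> k"
| "factor_value N g \<tau> T0 = T_glob S N \<beta> D hf q g"
| "factor_value N g \<tau> (Sk k) = S_k S N \<beta> D hf g \<tau> k"
| "factor_value N g \<tau> S0 = S_glob S N \<beta> D hf p g"

text \<open>Each site term is a product of a function of one fresh configuration \<open>x\<close>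
  and a function of another, \<open>y\<close>, so that the double Gibbs sum separates. Where one
  fresh configuration is enough, the right factor is 1.\<close>

fun factor_left :: "(nat \<Rightarrow> nat \<Rightarrow> int) \<Rightarrow> factor \<Rightarrow> nat \<Rightarrow> (nat \<Rightarrow> int) \<Rightarrow> real" where
  "factor_left \<tau> (Tkl k l) i x = of_int (\<tau> k i) - of_int (x i)"
| "factor_left \<tau> (Tk k) i x = of_int (\<tau> k i) - of_int (x i)"
| "factor_left \<tau> T0 i x = of_int (x i)"
| "factor_left \<tau> (Sk k) i x = (of_int (\<tau> k i))\<^sup>2 - (of_int (x i))\<^sup>2"
| "factor_left \<tau> S0 i x = (of_int (x i))\<^sup>2"

fun factor_right :: "(nat \<Rightarrow> nat \<Rightarrow> int) \<Rightarrow> factor \<Rightarrow> nat \<Rightarrow> (nat \<Rightarrow> int) \<Rightarrow> real" where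
  "factor_right \<tau> (Tkl k l) i y = of_int (\<tau> l i) - of_int (y i)"
| "factor_right \<tau> (Tk k) i y = of_int (y i)"
| "factor_right \<tau> T0 i y = of_int (y i)"
| "factor_right \<tau> (Sk k) i y = 1"
| "factor_right \<tau> S0 i y = 1"

fun factor_shift :: "factor \<Rightarrow> real" where
  "factor_shift T0 = - q"
| "factor_shift S0 = - p"
| "factor_shift F = 0"

definition factor_kernel :: "nat \<Rightarrow> factor \<Rightarrow> (nat \<Rightarrow> nat \<Rightarrow> int) \<Rightarrow> (nat \<Rightarrow> int) \<Rightarrow> (nat \<Rightarrow> int) \<Rightarrow> real" where
  "factor_kernel N F \<tau> x y = 1 / real N * (\<Sum>i\<in>{1..N}. factor_left \<tau> F i x * factor_right \<tau> F i y) + factor_shift F"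

lemma gibbs_eq_boltzmann: "gibbs S N \<beta> D hf g = boltzmann (configs S N) (hamiltonian N \<beta> D hf g)"
  by (simp add: boltzmann_def gibbs_def fun_eq_iff)

lemma sum_gibbs: "(\<Sum>x\<in>configs S N. gibbs S N \<beta> D hf g x) = 1"
  unfolding gibbs_eq_boltzmann by (rule boltzmann_sum) auto

lemma factor_value_eq:
  "factor_value N g \<tau> F = (\<Sum>x\<in>configs S N. \<Sum>y\<in>configs S N. factor_kernel N F \<tau> x y * (gibbs S N \<beta> D hf g x * gibbs S N \<beta> D hf g y))"
proof -
  note sg = sum_gibbs[of N g]
  have c: "(\<Sum>x\<in>configs S N. (c - f x) * gibbs S N \<beta> D hf g x) = c - (\<Sum>x\<in>configs S N. f x * gibbs S N \<beta> D hf g x)" for c f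
    by (simp add: left_diff_distrib sum_subtractf sum_distrib_left[symmetric] sg)
  show ?thesis
    unfolding factor_kernel_def sum_sum_separated[OF sg finite_configs]
    by (cases F) (simp_all add: c sg T_kl_def T_k_def T_glob_def S_k_def S_glob_def bmag_def bsq_def power2_eq_square)
qed

lemma dep_factor_kernel:
  assumes "valid_factor n F"
  shows "dep n (\<lambda>\<tau>. factor_kernel N F \<tau> x y)"
proof -
  have "factor_kernel N F \<tau> x y = factor_kernel N F \<tau>' x y" if "\<forall>k\<in>{1..n}. \<tau> k = \<tau>' k" for \<tau> \<tau>'
    using that assms unfolding factor_kernel_def by (cases F) auto
  then show ?thesis unfolding dep_def by blast
qed

text \<open>In the differences \<open>T_{k,l}\<close>, \<open>T_k\<close> and \<open>S_k\<close> the
  centring constants cancel. For \<open>T\<close> the constant is \<open>q\<close> because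
  \<open>c\<close> and \<open>d\<close> are distinct, and for \<open>S\<close> it is
  \<open>p\<close> because \<open>c\<close> is paired with itself.\<close>

lemma factor_kernel_eq_ovl:
  assumes F: "valid_factor n F" and cd: "c \<in> {n<..n'}" "d \<in> {n<..n'}" "c \<noteq> d" and N: "N > 0"
  shows "sqrt (real N) * factor_kernel N F \<tau> (\<tau> c) (\<tau> d) = ovl n' (factor_matrix F c d) N \<tau>"
proof -
  have "sqrt (real N) * (1 / real N * x) = 1 / sqrt (real N) * x" for x
    using N by (simp add: real_sqrt_divide field_simps)
  then have k: "sqrt (real N) * factor_kernel N F \<tau> (\<tau> c) (\<tau> d)
    = 1 / sqrt (real N) * (\<Sum>i\<in>{1..N}. factor_left \<tau> F i (\<tau> c) * factor_right \<tau> F i (\<tau> d)) + sqrt (real N) * factor_shift F"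
    unfolding factor_kernel_def distrib_left by simp
  have "ovl n' (factor_matrix F c d) N \<tau> = (case F of Tkl k l \<Rightarrow> overlap N k l \<tau> - overlap N k d \<tau> - (overlap N c l \<tau> - overlap N c d \<tau>)
      | Tk k \<Rightarrow> overlap N k d \<tau> - overlap N c d \<tau> | T0 \<Rightarrow> overlap N c d \<tau>
      | Sk k \<Rightarrow> overlap N k k \<tau> - overlap N c c \<tau> | S0 \<Rightarrow> overlap N c c \<tau>)"
    unfolding ovl_def using cd by (intro sum_factor_matrix[OF F]) auto
  also have "\<dots> = 1 / sqrt (real N) * (\<Sum>i\<in>{1..N}. factor_left \<tau> F i (\<tau> c) * factor_right \<tau> F i (\<tau> d)) + sqrt (real N) * factor_shift F"
    using F cd by (cases F)
      (auto simp: overlap_def overlap_const_def algebra_simps sum.distrib sum_subtractf power2_eq_square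
        add_divide_distrib diff_divide_distrib)
  finally show ?thesis using k by simp
qed

text \<open>Entries involving the fresh replicas \<open>c'\<close> or \<open>d'\<close> contract to
  zero, since these occur nowhere in the removed factor. An entry \<open>(k, k)\<close> of
  \<open>S_k\<close> cannot meet both pairs, and the ordering of indices excludes the transpose, so
  only an equal \<open>T_{k,l}\<close> remains.\<close>

lemma pairing_factor:
  assumes F: "valid_factor n F" and kl: "valid_factor n (Tkl k l)"
    and fresh: "c \<in> {n<..n'}" "d \<in> {n<..n'}" "c' \<in> {n<..n'}" "d' \<in> {n<..n'}" "distinct [c, d, c', d']"
  shows "pairing n' k c l d (factor_matrix F c' d') = (if F = Tkl k l then 1 else 0)"
proof -
  have "pairing n' k c l d (factor_matrix F c' d') = (let V = \<lambda>a b. dlt k c a * dlt l d b + dlt k c b * dlt l d a in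
     case F of Tkl k l \<Rightarrow> V k l - V k d' - (V c' l - V c' d') | Tk k \<Rightarrow> V k d' - V c' d' | T0 \<Rightarrow> V c' d'
      | Sk k \<Rightarrow> V k k - V c' c' | S0 \<Rightarrow> V c' c')"
    unfolding pairing_def Let_def using fresh by (intro sum_factor_matrix[OF F]) auto
  also have "\<dots> = (if F = Tkl k l then 1 else 0)"
    using F kl fresh by (cases F) (auto simp: dlt_def)
  finally show ?thesis .
qed

definition fresh_matrix :: "nat \<Rightarrow> (nat \<Rightarrow> factor) \<Rightarrow> nat \<Rightarrow> nat \<Rightarrow> nat \<Rightarrow> real" where
  "fresh_matrix n fs j = factor_matrix (fs j) (n + 2 * j + 1) (n + 2 * j + 2)"

text \<open>Subproducts over \<open>I\<close> keep the replica labels of the whole product: the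
  recursion deletes factors without relabelling, so all its terms share \<open>n + 2 * H\<close>
  replicas.\<close>

lemma ev_ovl_eq_nu:
  assumes m: "m \<in> {1..N}" and fs: "\<And>j. j < H \<Longrightarrow> valid_factor n (fs j)" and I: "I \<subseteq> {..<H}"
  shows "ev N m (pi/2) (n + 2 * H) (\<lambda>\<tau>. \<Prod>j\<in>I. ovl (n + 2 * H) (fresh_matrix n fs j) N \<tau>)
    = sqrt (real N) ^ card I * nu S N \<beta> D hf n (\<lambda>g \<tau>. \<Prod>j\<in>I. factor_value N g \<tau> (fs j))"
proof -
  define \<psi> where "\<psi> = (\<lambda>j \<tau> x y. if j \<in> I then sqrt (real N) * factor_kernel N (fs j) \<tau> x y else 1)"
  let ?G = "\<lambda>g. gibbs S N \<beta> D hf g"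
  have dep: "dep n (\<lambda>\<tau>. \<psi> j \<tau> x y)" for j x y
  proof (cases "j \<in> I")
    case True
    then have "valid_factor n (fs j)" using I fs by auto
    then show ?thesis using True by (auto simp: \<psi>_def intro!: dep_mult dep_const dep_factor_kernel)
  qed (simp add: \<psi>_def dep_const)
  have E: "(\<Sum>x\<in>configs S N. \<Sum>y\<in>configs S N. \<psi> j \<tau> x y * (?G g x * ?G g y)) = (if j \<in> I then sqrt (real N) * factor_value N g \<tau> (fs j) else 1)"
    for j \<tau> g
    by (simp add: \<psi>_def factor_value_eq sum_distrib_left mult.assoc sum_product[symmetric] sum_gibbs)
  have "ev N m (pi/2) (n + 2 * H) (\<lambda>\<tau>. \<Prod>j\<in>I. ovl (n + 2 * H) (fresh_matrix n fs j) N \<tau>)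
    = ev N m (pi/2) (n + 2 * H) (\<lambda>\<tau>. 1 * (\<Prod>j<H. \<psi> j \<tau> (\<tau> (n + 2 * j + 1)) (\<tau> (n + 2 * j + 2))))"
  proof (rule ev_cong)
    fix \<tau> :: "nat \<Rightarrow> nat \<Rightarrow> int"
    have "(\<Prod>j<H. \<psi> j \<tau> (\<tau> (n + 2 * j + 1)) (\<tau> (n + 2 * j + 2))) = (\<Prod>j\<in>I. \<psi> j \<tau> (\<tau> (n + 2 * j + 1)) (\<tau> (n + 2 * j + 2)))"
      by (rule prod.mono_neutral_right) (use I in \<open>auto simp: \<psi>_def\<close>)
    also have "\<dots> = (\<Prod>j\<in>I. ovl (n + 2 * H) (fresh_matrix n fs j) N \<tau>)"
    proof (rule prod.cong[OF refl])
      fix j assume j: "j \<in> I"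
      then have "j < H" using I by auto
      then have "sqrt (real N) * factor_kernel N (fs j) \<tau> (\<tau> (n + 2 * j + 1)) (\<tau> (n + 2 * j + 2)) = ovl (n + 2 * H) (fresh_matrix n fs j) N \<tau>"
        unfolding fresh_matrix_def using m by (intro factor_kernel_eq_ovl[OF fs]) auto
      then show "\<psi> j \<tau> (\<tau> (n + 2 * j + 1)) (\<tau> (n + 2 * j + 2)) = ovl (n + 2 * H) (fresh_matrix n fs j) N \<tau>"
        using j by (simp add: \<psi>_def)
    qed
    finally show "(\<Prod>j\<in>I. ovl (n + 2 * H) (fresh_matrix n fs j) N \<tau>) = 1 * (\<Prod>j<H. \<psi> j \<tau> (\<tau> (n + 2 * j + 1)) (\<tau> (n + 2 * j + 2)))"
      by simp
  qed
  also have "\<dots> = (\<integral>g. avg (configs S N) (?G g) n (\<lambda>\<tau>. sqrt (real N) ^ card I * (\<Prod>j\<in>I. factor_value N g \<tau> (fs j))) \<partial>disorder_measure N)"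
    unfolding ev_end[OF m]
  proof (intro Bochner_Integration.integral_cong refl)
    fix g
    have "avg (configs S N) (?G g) (n + 2 * H) (\<lambda>\<tau>. 1 * (\<Prod>j<H. \<psi> j \<tau> (\<tau> (n + 2 * j + 1)) (\<tau> (n + 2 * j + 2))))
      = avg (configs S N) (?G g) n (\<lambda>\<tau>. 1 * (\<Prod>j<H. if j \<in> I then sqrt (real N) * factor_value N g \<tau> (fs j) else 1))"
      unfolding E[symmetric] by (rule avg_fresh_pairs[symmetric, OF finite_configs dep_const dep])
    also have "\<dots> = avg (configs S N) (?G g) n (\<lambda>\<tau>. sqrt (real N) ^ card I * (\<Prod>j\<in>I. factor_value N g \<tau> (fs j)))"
    proof (rule avg_cong)
      fix \<tau>
      have "(\<Prod>j<H. if j \<in> I then sqrt (real N) * factor_value N g \<tau> (fs j) else 1) = (\<Prod>j\<in>I. sqrt (real N) * factor_value N g \<tau> (fs j))"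
        by (rule prod.mono_neutral_cong_right) (use I in auto)
      then show "1 * (\<Prod>j<H. if j \<in> I then sqrt (real N) * factor_value N g \<tau> (fs j) else 1) = sqrt (real N) ^ card I * (\<Prod>j\<in>I. factor_value N g \<tau> (fs j))"
        by (simp add: prod.distrib)
    qed
    finally show "avg (configs S N) (?G g) (n + 2 * H) (\<lambda>\<tau>. 1 * (\<Prod>j<H. \<psi> j \<tau> (\<tau> (n + 2 * j + 1)) (\<tau> (n + 2 * j + 2))))
      = avg (configs S N) (?G g) n (\<lambda>\<tau>. sqrt (real N) ^ card I * (\<Prod>j\<in>I. factor_value N g \<tau> (fs j)))" .
  qed
  also have "\<dots> = sqrt (real N) ^ card I * nu S N \<beta> D hf n (\<lambda>g \<tau>. \<Prod>j\<in>I. factor_value N g \<tau> (fs j))"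
    unfolding avg_cmult nu_def gibbs_avg_def avg_def replica_configs_def by simp
  finally show ?thesis .
qed

end

section \<open>Gaussian moments and the recursion for products of overlaps\<close>

lemma gauss_moment_rec: "gauss_moment (Suc (Suc x)) = real (Suc x) * gauss_moment x"
proof (cases "even x")
  case True
  then obtain k where k: "x = 2 * k" by (rule evenE)
  have "gauss_moment (2 * j) = fact (2 * j) / (2 ^ j * fact j)" for j
    unfolding gauss_moment_def std_normal_measure_def by (rule std_normal_distribution_even_moments(1))
  note even = this
  have "gauss_moment (Suc (Suc x)) = fact (2 * Suc k) / (2 ^ Suc k * fact (Suc k))"
    using even[of "Suc k"] by (simp add: k)
  also have "fact (2 * Suc k) = real (2 * k + 2) * (real (2 * k + 1) * fact (2 * k))"
    by (simp add: algebra_simps)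
  also have "2 ^ Suc k * fact (Suc k) = real (2 * k + 2) * (2 ^ k * fact k)"
    by (simp add: algebra_simps)
  also have "real (2 * k + 2) * (real (2 * k + 1) * fact (2 * k)) / (real (2 * k + 2) * (2 ^ k * fact k))
    = real (2 * k + 1) * gauss_moment x"
    unfolding k even by (subst mult_divide_mult_cancel_left) auto
  finally show ?thesis by (simp add: k)
next
  case False
  then have "gauss_moment x = 0" "gauss_moment (Suc (Suc x)) = 0"
    unfolding gauss_moment_def std_normal_measure_def by (intro integral_std_normal_distribution_moment_odd; simp)+
  then show ?thesis by simp
qed

lemma gauss_moment_0: "gauss_moment 0 = 1"
  using prob_space.prob_space[OF prob_space_std_normal] by (simp add: gauss_moment_def)

lemma gauss_moment_1: "gauss_moment (Suc 0) = 0"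
  unfolding gauss_moment_def std_normal_measure_def by (intro integral_std_normal_distribution_moment_odd) simp

context sk_small
begin

lemma one_minus_A_pos: "1 - \<beta>\<^sup>2 * A > 0"
proof -
  have "real S ^ 4 * 1 \<le> real S ^ 4 * exp (96 * real S ^ 4)" by (intro mult_left_mono) auto
  then have "\<beta>\<^sup>2 * (1536 * A) \<le> \<beta>\<^sup>2 * (1536 * real S ^ 4 * exp (96 * real S ^ 4))"
    using A_bounds by (intro mult_left_mono) auto
  then show ?thesis using small by simp
qed

text \<open>The constant \<open>A2sq\<close> multiplied by \<open>N\<close>, i.e. the limiting
  variance after rescaling by \<open>sqrt N\<close>.\<close>

definition scaled_var :: real where
  "scaled_var = A / (1 - \<beta>\<^sup>2 * A)"

definition overlap_moment :: "nat \<Rightarrow> real" where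
  "overlap_moment x = gauss_moment x * sqrt scaled_var ^ x"

lemma scaled_var_nonneg: "0 \<le> scaled_var"
  unfolding scaled_var_def using A_bounds one_minus_A_pos by simp

text \<open>For \<open>c = 1\<close> both sides vanish, the left as an odd moment and the right
  through the factor \<open>c - 1\<close>, so the truncated subtraction \<open>c - 2\<close> does no
  harm.\<close>

lemma overlap_moment_rec:
  assumes "c \<ge> 1"
  shows "overlap_moment c = scaled_var * real (c - 1) * overlap_moment (c - 2)"
proof (cases "c = 1")
  case False
  then obtain x where "c = Suc (Suc x)" using assms by (metis Suc_le_D One_nat_def not0_implies_Suc)
  then show ?thesis using scaled_var_nonneg by (simp add: overlap_moment_def gauss_moment_rec)
qed (simp add: overlap_moment_def gauss_moment_1)

text \<open>One application of the cavity step removes a factor \<open>T_{k,l}\<close> together with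
  each further copy of it in turn, while all other factors survive. Every count therefore obeys the
  Gaussian recursion separately, and the limit is a product over pairs. Two factors disappear at a
  time, whence the strong induction on the cardinality.\<close>

lemma ovl_product_asymptotics:
  assumes fs: "\<And>j. j < H \<Longrightarrow> valid_factor n (fs j)" and I: "I \<subseteq> {..<H}"
  defines "M \<equiv> \<lambda>I N m. ev N m (pi/2) (n + 2 * H) (\<lambda>\<tau>. \<Prod>j\<in>I. ovl (n + 2 * H) (fresh_matrix n fs j) N \<tau>)"
    and "cnt \<equiv> \<lambda>I e. card {j\<in>I. fs j = Tkl (fst e) (snd e)}"
    and "base \<equiv> \<lambda>I. {j\<in>I. \<forall>k l. fs j \<noteq> Tkl k l}"
  shows "big_O 1 (\<lambda>N m. M I N m - (\<Prod>e\<in>pairs n. overlap_moment (cnt I e)) * M (base I) N m)"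
  using I
proof (induction "card I" arbitrary: I rule: less_induct)
  case less
  have fin: "finite I" using less.prems finite_subset by blast
  show ?case
  proof (cases "base I = I")
    case True
    then have "fs j \<noteq> Tkl k l" if "j \<in> I" for j k l using that unfolding base_def by blast
    then have none: "{j\<in>I. fs j = Tkl k l} = {}" for k l by blast
    have "cnt I e = 0" for e by (simp only: cnt_def none card.empty)
    then show ?thesis
      using True big_O_zero by (simp add: overlap_moment_def gauss_moment_0)
  next
    case False
    then obtain j0 k l where j0: "j0 \<in> I" "fs j0 = Tkl k l" by (auto simp: base_def)
    define J where "J = I - {j0}"
    define K where "K = {j\<in>J. fs j = Tkl k l}"
    define c where "c = cnt I (k, l)"
    define P where "P = (\<Prod>e\<in>pairs n - {(k, l)}. overlap_moment (cnt I e))"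
    have J: "finite J" "j0 \<notin> J" "insert j0 J = I" using fin j0 by (auto simp: J_def)
    have H: "j < H" if "j \<in> I" for j using that less.prems by auto
    have kl: "valid_factor n (Tkl k l)" using fs[OF H[OF j0(1)]] j0 by simp
    have kl_pairs: "(k, l) \<in> pairs n" using kl by (simp add: pairs_def)
    have K: "finite K" "K \<subseteq> J" using J by (auto simp: K_def)
    have "{j\<in>I. fs j = Tkl k l} = insert j0 K" using j0 J by (auto simp: K_def)
    then have c: "c = Suc (card K)"
      using K J by (simp add: c_def cnt_def) (metis card_insert_disjoint subsetD)
    have pair: "pairing (n + 2 * H) k (n + 2 * j0 + 1) l (n + 2 * j0 + 2) (fresh_matrix n fs j) = (if j \<in> K then 1 else 0)"
      if j: "j \<in> J" for j
    proof -
      have "j < H" "j0 < H" "j \<noteq> j0" using j j0 H by (auto simp: J_def)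
      then have "pairing (n + 2 * H) k (n + 2 * j0 + 1) l (n + 2 * j0 + 2) (fresh_matrix n fs j) = (if fs j = Tkl k l then 1 else 0)"
        unfolding fresh_matrix_def by (intro pairing_factor[OF fs kl]) (auto; presburger)+
      then show ?thesis using j by (simp add: K_def)
    qed
    have step: "big_O 1 (\<lambda>N m. (1 - \<beta>\<^sup>2 * A) * M (insert j0 J) N m
       - A * (\<Sum>j\<in>J. pairing (n + 2 * H) k (n + 2 * j0 + 1) l (n + 2 * j0 + 2) (fresh_matrix n fs j) * M (J - {j}) N m))"
      unfolding M_def
    proof (rule cavity_step)
      show "distinct [k, n + 2 * j0 + 1, l, n + 2 * j0 + 2]" using kl by auto
      show "set [k, n + 2 * j0 + 1, l, n + 2 * j0 + 2] \<subseteq> {1..n + 2 * H}" using kl H[OF j0(1)] by auto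
      show "fresh_matrix n fs j0 = lead k (n + 2 * j0 + 1) l (n + 2 * j0 + 2)"
        by (simp add: fresh_matrix_def j0 fun_eq_iff)
    qed (use J in auto)
    have sumK: "(\<Sum>j\<in>J. pairing (n + 2 * H) k (n + 2 * j0 + 1) l (n + 2 * j0 + 2) (fresh_matrix n fs j) * M (J - {j}) N m)
      = (\<Sum>j\<in>K. M (J - {j}) N m)" for N m
    proof -
      have "(\<Sum>j\<in>J. pairing (n + 2 * H) k (n + 2 * j0 + 1) l (n + 2 * j0 + 2) (fresh_matrix n fs j) * M (J - {j}) N m)
        = (\<Sum>j\<in>J. if j \<in> K then M (J - {j}) N m else 0)"
        by (intro sum.cong refl, simp only: pair, simp)
      also have "\<dots> = (\<Sum>j\<in>K. M (J - {j}) N m)"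
        using J(1) K(2) by (simp add: sum.If_cases Int_absorb1)
      finally show ?thesis .
    qed
    have IH: "big_O 1 (\<lambda>N m. M (J - {j}) N m - overlap_moment (c - 2) * P * M (base I) N m)" if j: "j \<in> K" for j
    proof -
      have "card (J - {j}) < card I" using J fin by (metis Diff_subset card_mono card_Diff1_less finite_Diff j0(1) J_def le_less_trans)
      moreover have "J - {j} \<subseteq> {..<H}" using less.prems by (auto simp: J_def)
      ultimately have "big_O 1 (\<lambda>N m. M (J - {j}) N m - (\<Prod>e\<in>pairs n. overlap_moment (cnt (J - {j}) e)) * M (base (J - {j})) N m)"
        by (rule less.hyps)
      moreover have "base (J - {j}) = base I" using j j0 by (auto simp: base_def J_def K_def)
      moreover have "(\<Prod>e\<in>pairs n. overlap_moment (cnt (J - {j}) e)) = overlap_moment (c - 2) * P"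
      proof -
        have "{i \<in> J - {j}. fs i = Tkl k l} = K - {j}" by (auto simp: K_def)
        \<comment> \<open>Both \<open>j0\<close> and \<open>j\<close> have gone; the subtraction is
          exact because \<open>j\<close> witnesses that \<open>K\<close> is nonempty.\<close>
        then have "cnt (J - {j}) (k, l) = c - 2" using c j K by (simp add: cnt_def)
        moreover have "cnt (J - {j}) e = cnt I e" if "e \<noteq> (k, l)" for e
        proof -
          have "{i \<in> J - {j}. fs i = Tkl (fst e) (snd e)} = {i \<in> I. fs i = Tkl (fst e) (snd e)}"
            using that j j0 by (cases e) (auto simp: J_def K_def)
          then show ?thesis by (simp add: cnt_def)
        qed
        ultimately show ?thesis
          unfolding P_def by (subst prod.remove[OF finite_pairs kl_pairs]) simp
      qed
      ultimately show ?thesis by simp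
    qed
    \<comment> \<open>Dividing by \<open>1 - \<beta>^2 * A\<close> turns the weight \<open>A\<close>
      into \<open>scaled_var\<close>, after which the induction hypothesis replaces each shortened
      product.\<close>
    have "big_O 1 (\<lambda>N m. 1 / (1 - \<beta>\<^sup>2 * A) * ((1 - \<beta>\<^sup>2 * A) * M (insert j0 J) N m
       - A * (\<Sum>j\<in>J. pairing (n + 2 * H) k (n + 2 * j0 + 1) l (n + 2 * j0 + 2) (fresh_matrix n fs j) * M (J - {j}) N m))
      + scaled_var * (\<Sum>j\<in>K. M (J - {j}) N m - overlap_moment (c - 2) * P * M (base I) N m))"
      by (intro big_O_add big_O_cmult big_O_sum step K IH)
    then show ?thesis
    proof (rule big_O_cong)
      fix N m :: nat
      \<comment> \<open>There are \<open>card K = c - 1\<close> choices of partner, exactly the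
        factor in the recursion of the moments. Without a partner both sides are zero.\<close>
      have W: "(\<Prod>e\<in>pairs n. overlap_moment (cnt I e)) = scaled_var * real (card K) * overlap_moment (c - 2) * P"
        using overlap_moment_rec[of c] c
        by (subst prod.remove[OF finite_pairs kl_pairs]) (simp add: P_def c_def[symmetric])
      show "M I N m - (\<Prod>e\<in>pairs n. overlap_moment (cnt I e)) * M (base I) N m
        = 1 / (1 - \<beta>\<^sup>2 * A) * ((1 - \<beta>\<^sup>2 * A) * M (insert j0 J) N m
       - A * (\<Sum>j\<in>J. pairing (n + 2 * H) k (n + 2 * j0 + 1) l (n + 2 * j0 + 2) (fresh_matrix n fs j) * M (J - {j}) N m))
      + scaled_var * (\<Sum>j\<in>K. M (J - {j}) N m - overlap_moment (c - 2) * P * M (base I) N m)"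
        unfolding W sumK J(3) sum_subtractf scaled_var_def using one_minus_A_pos
        by (simp add: right_diff_distrib)
    qed
  qed
qed

end

section \<open>From exponents to sequences of factors, and the final rescaling\<close>

lemma exists_enumeration:
  assumes "finite \<F>"
  shows "\<exists>(H::nat) fs. (\<forall>j<H. fs j \<in> \<F>) \<and> (\<forall>F\<in>\<F>. card {j\<in>{..<H}. fs j = F} = E F)"
proof -
  obtain xs where xs: "mset xs = (\<Sum>F\<in>\<F>. replicate_mset (E F) F)" using ex_mset by blast
  have count: "count (mset xs) F = (if F \<in> \<F> then E F else 0)" for F
    unfolding xs using assms by (simp add: count_sum if_distrib sum.delta cong: if_cong)
  have "xs ! j \<in> \<F>" if "j < length xs" for j
    using count[of "xs ! j"] that by (metis count_mset_0_iff nth_mem)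
  moreover have "card {j\<in>{..<length xs}. xs ! j = F} = E F" if "F \<in> \<F>" for F
  proof -
    have "count (mset xs) F = card {j. j < length xs \<and> xs ! j = F}"
      by (simp add: count_mset count_list_eq_length_filter length_filter_conv_card eq_commute)
    then show ?thesis using count[of F] that by simp
  qed
  ultimately show ?thesis by (intro exI[of _ "length xs"] exI[of _ "\<lambda>j. xs ! j"]) auto
qed

theorem theorem4p2:
  fixes S :: nat and hf D :: real
  assumes "S \<ge> 1" and "hf \<ge> 0"
  shows "\<exists>\<beta>'>0. \<forall>\<beta>. 0 < \<beta> \<and> \<beta> < \<beta>' \<longrightarrow>
    (\<forall>p q. is_pq S \<beta> D hf p q \<longrightarrow>
      (\<forall>(n::nat) (ekl::nat \<Rightarrow> nat \<Rightarrow> nat) (ek::nat \<Rightarrow> nat) (e::nat) (fk::nat \<Rightarrow> nat) (f::nat).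
        \<exists>C. \<forall>N::nat. N \<ge> 2 \<longrightarrow>
          (let H = (\<Sum>k\<in>{1..n}. \<Sum>l\<in>{k<..n}. ekl k l) + (\<Sum>k\<in>{1..n}. ek k) + e
                   + (\<Sum>k\<in>{1..n}. fk k) + f;
               Rest = (\<lambda>g \<tau>. (\<Prod>k\<in>{1..n}. T_k S N \<beta> D hf g \<tau> k ^ ek k) * T_glob S N \<beta> D hf q g ^ e
                   * (\<Prod>k\<in>{1..n}. S_k S N \<beta> D hf g \<tau> k ^ fk k) * S_glob S N \<beta> D hf p g ^ f)
           in \<bar>nu S N \<beta> D hf n (\<lambda>g \<tau>. (\<Prod>k\<in>{1..n}. \<Prod>l\<in>{k<..n}. T_kl S N \<beta> D hf g \<tau> k l ^ ekl k l) * Rest g \<tau>)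
               - (\<Prod>k\<in>{1..n}. \<Prod>l\<in>{k<..n}. gauss_moment (ekl k l) * sqrt (A2sq S N \<beta> D hf p q) ^ ekl k l)
                 * nu S N \<beta> D hf n Rest\<bar>
             \<le> C * real N powr (- (real H + 1) / 2))))"
proof -
  \<comment> \<open>The constant of the smallness condition. Since \<open>\<kappa> \<ge> 1\<close>,
    the single requirement \<open>\<beta> < 1 / \<kappa>\<close> yields both
    \<open>\<beta> \<le> 1\<close> and \<open>\<beta>^2 * \<kappa> \<le> 1\<close>.\<close>
  define \<kappa> where "\<kappa> = 1536 * real S ^ 4 * exp (96 * real S ^ 4)"
  have \<kappa>: "\<kappa> \<ge> 1"
  proof -
    have "1 \<le> real S ^ 4" using assms(1) by (intro one_le_power) simp
    then have "1 * 1 \<le> (1536 * real S ^ 4) * exp (96 * real S ^ 4)"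
      by (intro mult_mono) auto
    then show ?thesis by (simp add: \<kappa>_def)
  qed
  show ?thesis
  proof (rule exI[of _ "1 / \<kappa>"], intro conjI allI impI, goal_cases)
    case 1
    show ?case using \<kappa> by simp
  next
    case (2 \<beta> p q n ekl ek e fk f)
    then have \<beta>: "0 < \<beta> \<and> \<beta> < 1 / \<kappa>" and pq: "is_pq S \<beta> D hf p q" by auto
    have \<beta>1: "\<beta> * \<kappa> \<le> 1" using \<beta> \<kappa> by (simp add: pos_less_divide_eq less_imp_le)
    have "\<beta> * 1 \<le> \<beta> * \<kappa>" using \<beta> \<kappa> by (intro mult_left_mono) auto
    then have \<beta>2: "\<beta> \<le> 1" using \<beta>1 by simp
    have "\<beta> * (\<beta> * \<kappa>) \<le> 1 * 1" using \<beta> \<beta>1 \<beta>2 \<kappa> by (intro mult_mono) auto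
    then interpret sk_small S \<beta> D hf p q
      using \<beta> \<beta>2 pq by unfold_locales (auto simp: \<kappa>_def power2_eq_square mult.assoc)
    define \<T> where "\<T> = (\<lambda>e. Tkl (fst e) (snd e)) ` pairs n"
    define \<R> where "\<R> = Tk ` {1..n} \<union> {T0} \<union> Sk ` {1..n} \<union> {S0}"
    define E where "E = (\<lambda>F. case F of Tkl k l \<Rightarrow> ekl k l | Tk k \<Rightarrow> ek k | T0 \<Rightarrow> e | Sk k \<Rightarrow> fk k | S0 \<Rightarrow> f)"
    have fin: "finite \<T>" "finite \<R>" "\<T> \<inter> \<R> = {}" by (auto simp: \<T>_def \<R>_def)
    obtain H :: nat and fs where "\<forall>j<H. fs j \<in> \<T> \<union> \<R>" and "\<forall>F\<in>\<T> \<union> \<R>. card {j\<in>{..<H}. fs j = F} = E F"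
      using exists_enumeration[OF finite_UnI[OF fin(1,2)], of E] by blast
    then have fs: "\<And>j. j < H \<Longrightarrow> fs j \<in> \<T> \<union> \<R>" "\<And>F. F \<in> \<T> \<union> \<R> \<Longrightarrow> card {j\<in>{..<H}. fs j = F} = E F"
      by blast+
    define base where "base = {j\<in>{..<H}. \<forall>k l. fs j \<noteq> Tkl k l}"
    \<comment> \<open>The two parts of the monomial are functions of an arbitrary valuation
      \<open>v\<close> of the factors. The same identities are then used at the actual values and,
      for counting exponents, at constants.\<close>
    define R where "R = (\<lambda>v::factor \<Rightarrow> real. (\<Prod>k\<in>{1..n}. v (Tk k) ^ ek k) * v T0 ^ e * (\<Prod>k\<in>{1..n}. v (Sk k) ^ fk k) * v S0 ^ f)"
    define U where "U = (\<lambda>v::factor \<Rightarrow> real. \<Prod>k\<in>{1..n}. \<Prod>l\<in>{k<..n}. v (Tkl k l) ^ ekl k l)"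
    have valid: "valid_factor n (fs j)" if "j < H" for j
      using fs(1)[OF that] by (auto simp: \<T>_def \<R>_def pairs_def)
    have pairs_prod: "(\<Prod>e\<in>pairs n. h (fst e) (snd e)) = (\<Prod>k\<in>{1..n}. \<Prod>l\<in>{k<..n}. h k l)" for h :: "nat \<Rightarrow> nat \<Rightarrow> real"
    proof -
      have "pairs n = Sigma {1..n} (\<lambda>k. {k<..n})" by (auto simp: pairs_def)
      then show ?thesis by (simp add: prod.Sigma case_prod_beta)
    qed
    have R_eq: "(\<Prod>F\<in>\<R>. v F ^ E F) = R v" for v
    proof -
      let ?g = "\<lambda>F. v F ^ E F" and ?A = "Tk ` {1..n}" and ?B = "Sk ` {1..n}"
      have "prod ?g \<R> = prod ?g (?A \<union> {T0} \<union> ?B) * prod ?g {S0}"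
        unfolding \<R>_def by (rule prod.union_disjoint) auto
      also have "prod ?g (?A \<union> {T0} \<union> ?B) = prod ?g (?A \<union> {T0}) * prod ?g ?B"
        by (rule prod.union_disjoint) auto
      also have "prod ?g (?A \<union> {T0}) = prod ?g ?A * prod ?g {T0}"
        by (rule prod.union_disjoint) auto
      finally show ?thesis by (simp add: R_def prod.reindex inj_on_def E_def)
    qed
    have T_eq: "(\<Prod>F\<in>\<T>. v F ^ E F) = U v" for v
    proof -
      have "(\<Prod>F\<in>\<T>. v F ^ E F) = (\<Prod>e\<in>pairs n. v (Tkl (fst e) (snd e)) ^ ekl (fst e) (snd e))"
        unfolding \<T>_def by (subst prod.reindex) (auto simp: inj_on_def E_def)
      then show ?thesis unfolding U_def by (simp add: pairs_prod[of "\<lambda>k l. v (Tkl k l) ^ ekl k l"])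
    qed
    have all: "(\<Prod>j<H. v (fs j)) = U v * R v" for v
    proof -
      have "(\<Prod>j<H. v (fs j)) = (\<Prod>F\<in>\<T> \<union> \<R>. \<Prod>j\<in>{j\<in>{..<H}. fs j = F}. v (fs j))"
        using fs(1) fin by (intro prod.group[symmetric]) auto
      also have "\<dots> = (\<Prod>F\<in>\<T> \<union> \<R>. v F ^ E F)"
        by (intro prod.cong refl) (simp add: fs(2)[symmetric])
      finally show ?thesis using fin by (simp add: prod.union_disjoint R_eq T_eq)
    qed
    have base_sub: "base \<subseteq> {..<H}" by (auto simp: base_def)
    have basep: "(\<Prod>j\<in>base. v (fs j)) = R v" for v
    proof -
      have base: "fs j \<in> \<R>" if "j \<in> base" for j
        using that fs(1)[of j] by (auto simp: base_def \<T>_def)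
      have "(\<Prod>j\<in>base. v (fs j)) = (\<Prod>F\<in>\<R>. \<Prod>j\<in>{j\<in>base. fs j = F}. v (fs j))"
        using base fin by (intro prod.group[symmetric]) (auto simp: base_def)
      also have "\<dots> = (\<Prod>F\<in>\<R>. v F ^ E F)"
      proof (intro prod.cong refl)
        fix F assume F: "F \<in> \<R>"
        then have "{j\<in>base. fs j = F} = {j\<in>{..<H}. fs j = F}" by (auto simp: base_def \<R>_def)
        then show "(\<Prod>j\<in>{j\<in>base. fs j = F}. v (fs j)) = v F ^ E F" using F by (simp add: fs(2)[symmetric])
      qed
      finally show ?thesis by (simp add: R_eq)
    qed
    have H_eq: "H = (\<Sum>k\<in>{1..n}. \<Sum>l\<in>{k<..n}. ekl k l) + (\<Sum>k\<in>{1..n}. ek k) + e + (\<Sum>k\<in>{1..n}. fk k) + f"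
    proof -
      \<comment> \<open>At the constant valuation 2 the product identity becomes an equality of
        powers of 2, from which the total degree is read off.\<close>
      have "(2::real) ^ H = 2 ^ ((\<Sum>k\<in>{1..n}. \<Sum>l\<in>{k<..n}. ekl k l) + (\<Sum>k\<in>{1..n}. ek k) + e + (\<Sum>k\<in>{1..n}. fk k) + f)"
        using all[of "\<lambda>_. 2"] by (simp add: U_def R_def power_add power_sum mult_ac)
      then show ?thesis by (subst (asm) power_inject_exp) auto
    qed
    define M where "M = (\<lambda>I N m. ev N m (pi/2) (n + 2 * H) (\<lambda>\<tau>. \<Prod>j\<in>I. ovl (n + 2 * H) (fresh_matrix n fs j) N \<tau>))"
    have cnt: "card {j\<in>{..<H}. fs j = Tkl (fst x) (snd x)} = ekl (fst x) (snd x)" if "x \<in> pairs n" for x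
      using fs(2)[of "Tkl (fst x) (snd x)"] that by (auto simp: \<T>_def E_def)
    have "big_O 1 (\<lambda>N m. M {..<H} N m - (\<Prod>x\<in>pairs n. overlap_moment (card {j\<in>{..<H}. fs j = Tkl (fst x) (snd x)})) * M base N m)"
      unfolding M_def base_def by (rule ovl_product_asymptotics[OF valid order_refl])
    then have "big_O 1 (\<lambda>N m. M {..<H} N m - (\<Prod>k\<in>{1..n}. \<Prod>l\<in>{k<..n}. overlap_moment (ekl k l)) * M base N m)"
    proof (rule big_O_cong)
      fix N m :: nat
      have "(\<Prod>x\<in>pairs n. overlap_moment (card {j\<in>{..<H}. fs j = Tkl (fst x) (snd x)})) = (\<Prod>x\<in>pairs n. overlap_moment (ekl (fst x) (snd x)))"
        by (intro prod.cong refl arg_cong[where f = overlap_moment] cnt)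
      also have "\<dots> = (\<Prod>k\<in>{1..n}. \<Prod>l\<in>{k<..n}. overlap_moment (ekl k l))"
        by (rule pairs_prod)
      finally show "M {..<H} N m - (\<Prod>k\<in>{1..n}. \<Prod>l\<in>{k<..n}. overlap_moment (ekl k l)) * M base N m
        = M {..<H} N m - (\<Prod>x\<in>pairs n. overlap_moment (card {j\<in>{..<H}. fs j = Tkl (fst x) (snd x)})) * M base N m"
        by (simp only:)
    qed
    then obtain C where C: "\<And>N m. m \<in> {1..N} \<Longrightarrow>
        \<bar>M {..<H} N m - (\<Prod>k\<in>{1..n}. \<Prod>l\<in>{k<..n}. overlap_moment (ekl k l)) * M base N m\<bar> \<le> C / sqrt (real N) ^ 1"
      unfolding big_O_def by blast
    have main: "\<bar>nu S N \<beta> D hf n (\<lambda>g \<tau>. U (factor_value N g \<tau>) * R (factor_value N g \<tau>))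
       - (\<Prod>k\<in>{1..n}. \<Prod>l\<in>{k<..n}. gauss_moment (ekl k l) * sqrt (A2sq S N \<beta> D hf p q) ^ ekl k l)
         * nu S N \<beta> D hf n (\<lambda>g \<tau>. R (factor_value N g \<tau>))\<bar> \<le> C * real N powr (- (real H + 1) / 2)"
      (is "\<bar>?nu1 - ?W * ?nu2\<bar> \<le> _") if N: "N \<ge> 2" for N
    proof -
      let ?s = "sqrt (real N)"
      \<comment> \<open>All paths end in the same model, so site 1 can represent them.\<close>
      have m: "1 \<in> {1..N}" and s: "?s > 0" using N by auto
      have M1: "M {..<H} N 1 = ?s ^ H * ?nu1"
        unfolding M_def using ev_ovl_eq_nu[OF m valid order_refl] by (simp add: all)
      have M2: "M base N 1 = ?s ^ card base * ?nu2"
        unfolding M_def using ev_ovl_eq_nu[OF m valid base_sub] by (simp add: basep)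
      have "sqrt scaled_var = ?s * sqrt (A2sq S N \<beta> D hf p q)"
        unfolding real_sqrt_mult[symmetric] using N by (simp add: scaled_var_def A2sq_def)
      then have "(\<Prod>k\<in>{1..n}. \<Prod>l\<in>{k<..n}. overlap_moment (ekl k l)) = U (\<lambda>_. ?s) * ?W"
        by (simp add: overlap_moment_def U_def prod.distrib[symmetric] power_mult_distrib mult_ac)
      \<comment> \<open>The constant valuation \<open>sqrt N\<close> splits the scaling factor: the
        part belonging to the \<open>T_{k,l}\<close> turns \<open>scaled_var\<close> into
        \<open>A2sq\<close>, and the rest rescales the remaining product. The common power
        \<open>H\<close> then divides out and adds to the error exponent.\<close>
      moreover have "?s ^ card base = R (\<lambda>_. ?s)" "?s ^ H = U (\<lambda>_. ?s) * R (\<lambda>_. ?s)"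
        using basep[of "\<lambda>_. ?s"] all[of "\<lambda>_. ?s"] by simp_all
      ultimately have "M {..<H} N 1 - (\<Prod>k\<in>{1..n}. \<Prod>l\<in>{k<..n}. overlap_moment (ekl k l)) * M base N 1 = ?s ^ H * (?nu1 - ?W * ?nu2)"
        unfolding M1 M2 by (simp add: algebra_simps)
      then have "?s ^ H * \<bar>?nu1 - ?W * ?nu2\<bar> \<le> C / ?s"
        using C[OF m] s by (simp add: abs_mult)
      then have "\<bar>?nu1 - ?W * ?nu2\<bar> \<le> C / (?s ^ Suc H)"
        using s by (simp add: field_simps)
      also have "?s ^ Suc H = real N powr ((real H + 1) / 2)"
        using N by (simp add: powr_half_sqrt[symmetric] powr_realpow[symmetric] powr_powr add.commute del: power_Suc)
      also have "C / real N powr ((real H + 1) / 2) = C * real N powr (- (real H + 1) / 2)"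
        unfolding minus_divide_left[symmetric] powr_minus_divide by simp
      finally show ?thesis .
    qed
    show ?case
      unfolding Let_def H_eq[symmetric]
      by (intro exI[of _ C] allI impI) (use main in \<open>simp only: U_def R_def factor_value.simps\<close>)
  qed
qed

end
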